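(* Let $M$ be a $3$-connected matroid with a $3$-connected simple minor $N$ such that $k:=r(M)-r(N)\ge 2$. Then $M$ has a free family of cardinality $\lceil k/2\rceil+1$ each of whose members is either a singleton set $\{x\}$ with $x$ vertically $N$-contractible in $M$, or an $N$-filament of $M$.
   Context: For a $3$-connected matroid $M$ with an $N$-minor, an element $x$ (or a set $X$) is vertically $N$-contractible if $\mathrm{si}(M/x)$ (resp. $\mathrm{si}(M/X)$), the simplification, is a $3$-connected matroid with an $N$-minor. A line of $M$ is a rank-$2$ set of elements. For $n\ge 3$, a sequence $x_1,\dots,x_n,y_1,\dots,y_n$ of elements of $M$ is an $N$-carambole of $M$ if $L:=\{y_1,\dots,y_n\}$ is a vertically $N$-contractible line of $M$ with $n$ distinct elements and, for each $i\in\{1,\dots,n\}$, $(L-y_i)\cup x_i$ is a cocircuit of $M$; $L$ is then called the filament of the carambole, and a set that is the filament of some $N$-carambole of $M$ is called an $N$-filament of $M$. A family $\{X_1,\dots,X_n\}$ of subsets of $E(M)$ is free if $M|(X_1\cup\cdots\cup X_n)=M|X_1\oplus\cdots\oplus M|X_n$. *)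

theory Defs
  imports Complex_Main
begin

record 'a matroid =
  carrier :: "'a set"
  indep :: "'a set \<Rightarrow> bool"

definition matroid :: "'a matroid \<Rightarrow> bool" where
  "matroid M \<longleftrightarrow> finite (carrier M)
     \<and> (\<forall>I. indep M I \<longrightarrow> I \<subseteq> carrier M)
     \<and> indep M {}
     \<and> (\<forall>I J. indep M J \<and> I \<subseteq> J \<longrightarrow> indep M I)
     \<and> (\<forall>I J. indep M I \<and> indep M J \<and> card I < card J
            \<longrightarrow> (\<exists>e \<in> J - I. indep M (insert e I)))"

definition rank :: "'a matroid \<Rightarrow> 'a set \<Rightarrow> nat" where
  "rank M X = Max (card ` {I. I \<subseteq> X \<and> indep M I})"

abbreviation rk :: "'a matroid \<Rightarrow> nat" where
  "rk M \<equiv> rank M (carrier M)"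

definition basis :: "'a matroid \<Rightarrow> 'a set \<Rightarrow> bool" where
  "basis M B \<longleftrightarrow> indep M B \<and> (\<forall>e \<in> carrier M - B. \<not> indep M (insert e B))"

definition circuit :: "'a matroid \<Rightarrow> 'a set \<Rightarrow> bool" where
  "circuit M C \<longleftrightarrow> C \<subseteq> carrier M \<and> \<not> indep M C \<and> (\<forall>x \<in> C. indep M (C - {x}))"

definition dual :: "'a matroid \<Rightarrow> 'a matroid" where
  "dual M = \<lparr> carrier = carrier M,
              indep = (\<lambda>I. I \<subseteq> carrier M \<and> (\<exists>B. basis M B \<and> I \<inter> B = {})) \<rparr>"

definition cocircuit :: "'a matroid \<Rightarrow> 'a set \<Rightarrow> bool" where
  "cocircuit M C \<longleftrightarrow> circuit (dual M) C"

definition delete :: "'a matroid \<Rightarrow> 'a set \<Rightarrow> 'a matroid" where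
  "delete M D = \<lparr> carrier = carrier M - D, indep = (\<lambda>I. indep M I \<and> I \<inter> D = {}) \<rparr>"

definition restrict :: "'a matroid \<Rightarrow> 'a set \<Rightarrow> 'a matroid" where
  "restrict M X = delete M (carrier M - X)"

definition contract :: "'a matroid \<Rightarrow> 'a set \<Rightarrow> 'a matroid" where
  "contract M C = \<lparr> carrier = carrier M - C,
      indep = (\<lambda>I. I \<subseteq> carrier M - C \<and> rank M (I \<union> C) = card I + rank M C) \<rparr>"

definition iso :: "'a matroid \<Rightarrow> 'b matroid \<Rightarrow> bool" where
  "iso M N \<longleftrightarrow> (\<exists>f. bij_betw f (carrier M) (carrier N)
      \<and> (\<forall>X. X \<subseteq> carrier M \<longrightarrow> (indep M X \<longleftrightarrow> indep N (f ` X))))"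

definition has_minor :: "'a matroid \<Rightarrow> 'b matroid \<Rightarrow> bool" where
  "has_minor M N \<longleftrightarrow> (\<exists>C D. C \<subseteq> carrier M \<and> D \<subseteq> carrier M \<and> C \<inter> D = {}
      \<and> iso (delete (contract M C) D) N)"

definition loop :: "'a matroid \<Rightarrow> 'a \<Rightarrow> bool" where
  "loop M e \<longleftrightarrow> e \<in> carrier M \<and> \<not> indep M {e}"

definition simple :: "'a matroid \<Rightarrow> bool" where
  "simple M \<longleftrightarrow> (\<forall>C. circuit M C \<longrightarrow> card C \<ge> 3)"

text \<open>\<open>S\<close> is the ground set of a simplification of \<open>M\<close>: it contains no loops and
  exactly one element of each parallel class of non-loops.
  (The simplification is unique up to isomorphism.)\<close>
definition simplification_set :: "'a matroid \<Rightarrow> 'a set \<Rightarrow> bool" where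
  "simplification_set M S \<longleftrightarrow>
     S \<subseteq> {e \<in> carrier M. \<not> loop M e}
     \<and> (\<forall>e \<in> carrier M. \<not> loop M e \<longrightarrow> (\<exists>!s. s \<in> S \<and> rank M {e, s} = 1))"

definition k_separation :: "'a matroid \<Rightarrow> nat \<Rightarrow> 'a set \<Rightarrow> bool" where
  "k_separation M k X \<longleftrightarrow> X \<subseteq> carrier M \<and> card X \<ge> k \<and> card (carrier M - X) \<ge> k
     \<and> rank M X + rank M (carrier M - X) < rk M + k"

definition three_connected :: "'a matroid \<Rightarrow> bool" where
  "three_connected M \<longleftrightarrow> matroid M \<and> (\<forall>k X. 1 \<le> k \<and> k < 3 \<longrightarrow> \<not> k_separation M k X)"

definition vert_contractible_set :: "'a matroid \<Rightarrow> 'b matroid \<Rightarrow> 'a set \<Rightarrow> bool" where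
  "vert_contractible_set M N X \<longleftrightarrow> X \<subseteq> carrier M \<and>
     (\<exists>S. simplification_set (contract M X) S
        \<and> three_connected (restrict (contract M X) S)
        \<and> has_minor (restrict (contract M X) S) N)"

definition vert_contractible :: "'a matroid \<Rightarrow> 'b matroid \<Rightarrow> 'a \<Rightarrow> bool" where
  "vert_contractible M N x \<longleftrightarrow> x \<in> carrier M \<and> vert_contractible_set M N {x}"

definition line :: "'a matroid \<Rightarrow> 'a set \<Rightarrow> bool" where
  "line M L \<longleftrightarrow> L \<subseteq> carrier M \<and> rank M L = 2"

definition carambole :: "'a matroid \<Rightarrow> 'b matroid \<Rightarrow> nat \<Rightarrow> (nat \<Rightarrow> 'a) \<Rightarrow> (nat \<Rightarrow> 'a) \<Rightarrow> bool" where
  "carambole M N n x y \<longleftrightarrow> n \<ge> 3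
     \<and> inj_on y {..<n}
     \<and> line M (y ` {..<n})
     \<and> vert_contractible_set M N (y ` {..<n})
     \<and> (\<forall>i < n. cocircuit M ((y ` {..<n} - {y i}) \<union> {x i}))"

definition filament :: "'a matroid \<Rightarrow> 'b matroid \<Rightarrow> 'a set \<Rightarrow> bool" where
  "filament M N L \<longleftrightarrow> (\<exists>n x y. carambole M N n x y \<and> L = y ` {..<n})"

text \<open>A family \<open>F\<close> of subsets of \<open>E(M)\<close> is free if \<open>M|\<Union>F\<close> is the direct sum of the
  \<open>M|X\<close>, \<open>X \<in> F\<close> (direct sums require pairwise disjoint ground sets).\<close>
definition free_family :: "'a matroid \<Rightarrow> 'a set set \<Rightarrow> bool" where
  "free_family M F \<longleftrightarrow> (\<forall>X \<in> F. X \<subseteq> carrier M)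
     \<and> (\<forall>X \<in> F. \<forall>Y \<in> F. X \<noteq> Y \<longrightarrow> X \<inter> Y = {})
     \<and> (\<forall>I. I \<subseteq> \<Union>F \<longrightarrow> (indep M I \<longleftrightarrow> (\<forall>X \<in> F. indep M (I \<inter> X))))"

end

theory Submission
  imports Defs
begin

text \<open>
  The induction is on \<open>k\<close>. Call an element good if it is vertically \<open>N\<close>-contractible. Suppose \<open>y\<close> is
  not good, although contracting both \<open>x\<close> and \<open>y\<close> is admissible. Then the separation that blocks \<open>y\<close>
  consists of a plane \<open>P\<close> and a hyperplane \<open>H\<close> covering \<open>M\<close>, with \<open>x \<in> P - H\<close>. An element of \<open>P - H\<close>
  lying on three lines of \<open>P\<close> is good, so either \<open>P - H\<close> contains two independent good elements, or it
  is \<open>(L - y) \<union> c\<close> for a line \<open>L\<close> of bad points and a good \<open>c\<close>. It follows that the filaments are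
  exactly the contractible lines with at least three points and no good point.

  If \<open>M\<close> has a filament \<open>L\<close>, a family of \<open>M/L\<close> is lifted and \<open>L\<close> is added to it. If it has none, and all
  elements that are good in \<open>M/x\<close> are spanned by good elements of \<open>M\<close>, a family of \<open>M/x\<close> is lifted and
  \<open>x\<close> is added. In the remaining case there is a line \<open>K\<close> through a good \<open>u\<close> for which the loss in
  passing from \<open>M/K\<close> to \<open>M\<close> is only one dimension; a family of \<open>M/K\<close> is lifted and \<open>u\<close> is added. A member
  that cannot be lifted itself is exchanged for a good element outside the span of the others.
\<close>

section \<open>Rank functions and vertical connectivity\<close>

text \<open>Contracting a line costs two in \<open>k\<close> and brings one member, which is the
  source of \<open>k/2\<close>; contracting a point costs only one. The extra 1 is won at
  \<open>k = 2, 3\<close>, where a filament, or the line \<open>K\<close> of the remaining case,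
  comes with two more good elements, the tips of its wings. The obstacle is that an element good in
  \<open>M/x\<close> may be bad in \<open>M\<close> and may even lie outside the span of all good
  elements, so that no exchange replaces it. Lines with three points repair this. A cover of
  \<open>M\<close> by two flats cannot divide them, so their position in a separation is known, and
  a wing at one of their points gives a hyperplane containing everything but the line and the tip.
  Two such hyperplanes at different points cut the rank of one side of a separation by two, and this
  is what most contradictions rest on. Contraction changes only the rank function and not the ground
  set, so that \<open>M/X\<close> is treated by interpreting the same locale again.\<close>

definition rank_closure :: "('a set \<Rightarrow> int) \<Rightarrow> 'a set \<Rightarrow> 'a set" where
  "rank_closure r A = {e. r (insert e A) = r A}"

definition flat :: "('a set \<Rightarrow> int) \<Rightarrow> 'a set \<Rightarrow> bool" where
  "flat r A \<longleftrightarrow> rank_closure r A = A"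

definition contract_rank :: "('a set \<Rightarrow> int) \<Rightarrow> 'a set \<Rightarrow> 'a set \<Rightarrow> int" where
  "contract_rank r X Z = r (Z \<union> X) - r X"

text \<open>The ground set is \<open>UNIV\<close>: elements outside the carrier are loops. With \<open>r\<close> the rank function
  of \<open>M\<close>, this says that the simplification of \<open>M/X\<close> is 3-connected; non-spanning covers replace the
  cardinality conditions of a separation.\<close>
definition vert_conn :: "('a set \<Rightarrow> int) \<Rightarrow> 'a set \<Rightarrow> bool" where
  "vert_conn r X \<longleftrightarrow> (\<forall>A B. A \<union> B = UNIV \<longrightarrow> X \<subseteq> A \<longrightarrow> X \<subseteq> B \<longrightarrow> r A < r UNIV \<longrightarrow> r B < r UNIV
      \<longrightarrow> r UNIV + r X + 2 \<le> r A + r B)"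

text \<open>A vertical 3-separation \<open>(P - y, y, H - P)\<close> one of whose sides has rank 3.\<close>
definition fold_at :: "('a set \<Rightarrow> int) \<Rightarrow> 'a set \<Rightarrow> 'a set \<Rightarrow> 'a \<Rightarrow> bool" where
  "fold_at r P H y \<longleftrightarrow> flat r P \<and> flat r H \<and> P \<union> H = UNIV \<and> r P = 3 \<and> r H = r UNIV - 1
      \<and> r UNIV \<ge> 4 \<and> y \<in> P \<and> y \<in> H \<and> r {y} = 1"

locale matroid_rank =
  fixes r :: "'a set \<Rightarrow> int" and E :: "'a set"
  assumes finite_E: "finite E"
    and r_carrier: "r (A \<inter> E) = r A"
    and r_empty: "r {} = 0"
    and r_mono: "A \<subseteq> B \<Longrightarrow> r A \<le> r B"
    and r_insert_le: "r (insert e A) \<le> r A + 1"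
    and submod: "r (A \<union> B) + r (A \<inter> B) \<le> r A + r B"
begin

abbreviation "cl \<equiv> rank_closure r"
abbreviation "flt \<equiv> flat r"

section \<open>Closure, flats, parallel points and lines\<close>

lemma submod_le:
  assumes "D \<subseteq> A \<union> B" "C \<subseteq> A" "C \<subseteq> B"
  shows "r D + r C \<le> r A + r B"
  using submod[of A B] r_mono[of D "A \<union> B"] r_mono[of C "A \<inter> B"] assms by auto

lemma r_nonneg: "0 \<le> r A"
  using r_mono[of "{}" A] r_empty by simp

lemma r_le_UNIV: "r A \<le> r UNIV"
  by (simp add: r_mono)

lemma r_insert_ge: "r A \<le> r (insert e A)"
  by (rule r_mono) auto

lemma r_union_le: "r (A \<union> B) \<le> r A + r B"
  using submod_le[of "A \<union> B" A B "{}"] r_empty by auto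

lemma r_single_le: "r {e} \<le> 1"
  using r_insert_le[of e "{}"] r_empty by simp

lemma r_pair_le: "r {e, f} \<le> 2"
  using r_insert_le[of e "{f}"] r_single_le[of f] by simp

lemma r_triple_le: "r {e, f, g} \<le> 3"
  using r_insert_le[of e "{f, g}"] r_pair_le[of f g] by simp

lemma in_cl_iff: "e \<in> cl A \<longleftrightarrow> r (insert e A) = r A"
  by (simp add: rank_closure_def)

lemma r_insert_notin: "e \<notin> cl A \<Longrightarrow> r (insert e A) = r A + 1"
  using r_insert_le[of e A] r_insert_ge[of A e] by (auto simp: in_cl_iff)

lemma subset_cl: "A \<subseteq> cl A"
  by (auto simp: in_cl_iff insert_absorb)

lemma in_cl_self: "a \<in> A \<Longrightarrow> a \<in> cl A"
  using subset_cl by auto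

lemma cl_mono: assumes "A \<subseteq> B" shows "cl A \<subseteq> cl B"
proof
  fix e assume "e \<in> cl A"
  then have "r (insert e A) = r A" by (simp add: in_cl_iff)
  moreover have "r (insert e B) + r A \<le> r (insert e A) + r B"
    by (rule submod_le) (use assms in auto)
  ultimately have "r (insert e B) \<le> r B" by simp
  with r_insert_ge[of B e] show "e \<in> cl B" by (simp add: in_cl_iff)
qed

lemma r_cl_finite: "finite B \<Longrightarrow> B \<subseteq> cl A \<Longrightarrow> r (A \<union> B) = r A"
proof (induction B rule: finite_induct)
  case (insert e B)
  have "r (insert e (A \<union> B)) = r (A \<union> B)"
    using cl_mono[of A "A \<union> B"] insert.prems by (auto simp: in_cl_iff)
  with insert show ?case by simp
qed simp

text \<open>The sets may be infinite, so elements are added one by one only from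
  \<open>B \<inter> E\<close>, which is finite and has the rank of \<open>B\<close>.\<close>

lemma r_eq_if_subset_cl: assumes "A \<subseteq> B" "B \<subseteq> cl A" shows "r B = r A"
proof -
  have "r (A \<union> (B \<inter> E)) = r A"
    by (rule r_cl_finite) (use assms finite_E in auto)
  moreover have "r (A \<union> (B \<inter> E)) = r B"
  proof -
    have "(A \<union> (B \<inter> E)) \<inter> E = B \<inter> E" using assms by auto
    then show ?thesis by (metis r_carrier)
  qed
  ultimately show ?thesis by simp
qed

lemma r_cl [simp]: "r (cl A) = r A"
  by (rule r_eq_if_subset_cl[OF subset_cl]) simp

lemma subset_cl_if_rank: assumes "A \<subseteq> B" "r B \<le> r A" shows "B \<subseteq> cl A"
proof
  fix e assume "e \<in> B"
  then have "r (insert e A) \<le> r B" using assms by (intro r_mono) auto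
  with assms r_insert_ge[of A e] show "e \<in> cl A" by (simp add: in_cl_iff)
qed

lemma flat_cl [simp]: "flt (cl A)"
  unfolding flat_def
proof
  show "cl (cl A) \<subseteq> cl A"
  proof (rule subset_cl_if_rank)
    show "A \<subseteq> cl (cl A)" using subset_cl by blast
    show "r (cl (cl A)) \<le> r A" using r_eq_if_subset_cl[OF subset_cl, of "cl A"] by simp
  qed
qed (rule subset_cl)

lemma flat_UNIV [simp]: "flt UNIV"
  using subset_cl[of UNIV] by (auto simp: flat_def)

lemma cl_least: "A \<subseteq> F \<Longrightarrow> flt F \<Longrightarrow> cl A \<subseteq> F"
  using cl_mono[of A F] by (simp add: flat_def)

lemma flat_Int: assumes "flt A" "flt B" shows "flt (A \<inter> B)"
proof -
  have "cl (A \<inter> B) \<subseteq> A" "cl (A \<inter> B) \<subseteq> B"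
    using cl_least[OF _ assms(1), of "A \<inter> B"] cl_least[OF _ assms(2), of "A \<inter> B"] by simp_all
  then show ?thesis unfolding flat_def using subset_cl by blast
qed

lemma r_cl_Un [simp]: "r (cl A \<union> B) = r (A \<union> B)" "r (B \<union> cl A) = r (B \<union> A)"
proof -
  have "r (cl A \<union> B) = r (A \<union> B)"
    using cl_mono[of A "A \<union> B"] subset_cl[of "A \<union> B"] subset_cl[of A]
    by (intro r_eq_if_subset_cl) auto
  then show "r (cl A \<union> B) = r (A \<union> B)" "r (B \<union> cl A) = r (B \<union> A)" by (simp_all add: Un_commute)
qed

lemma flat_insert: "flt F \<Longrightarrow> e \<notin> F \<Longrightarrow> r (insert e F) = r F + 1"
  by (rule r_insert_notin) (simp add: flat_def)

lemma flat_less: assumes "flt F" "F \<subseteq> G" "e \<in> G" "e \<notin> F" shows "r F < r G"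
  using flat_insert[OF assms(1,4)] r_mono[of "insert e F" G] assms by auto

lemma flat_spanned: assumes "flt F" "A \<subseteq> F" "r F \<le> r A" shows "cl A = F"
  using subset_cl_if_rank[OF assms(2,3)] cl_least[OF assms(2,1)] by auto

lemma flat_eq: assumes "flt F" "F \<subseteq> G" "r G \<le> r F" shows "F = G"
  using subset_cl_if_rank[OF assms(2,3)] assms by (auto simp: flat_def)

lemma flat_psubset: assumes "flt F" "flt G" "\<not> F \<subseteq> G" shows "r (F \<inter> G) < r F"
proof -
  obtain e where "e \<in> F" "e \<notin> G" using assms by auto
  then show ?thesis using flat_less[OF flat_Int[OF assms(1,2)], of F e] by auto
qed

lemma exchange: assumes "b \<in> cl (insert a A)" "b \<notin> cl A" shows "a \<in> cl (insert b A)"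
proof -
  have "r (insert b (insert a A)) = r (insert a A)" using assms by (simp add: in_cl_iff)
  moreover have "r (insert b A) = r A + 1" using assms(2) by (rule r_insert_notin)
  ultimately have "r (insert a (insert b A)) \<le> r (insert b A)"
    using r_insert_le[of a A] by (simp add: insert_commute)
  then show ?thesis using r_insert_ge[of "insert b A" a] by (simp add: in_cl_iff)
qed

lemma cl_cl [simp]: "cl (cl A) = cl A"
  using flat_cl[of A] by (simp only: flat_def)

lemma cl_eqI: "A \<subseteq> cl B \<Longrightarrow> B \<subseteq> cl A \<Longrightarrow> cl A = cl B"
  by (simp add: antisym cl_least)

lemma r_pair: assumes "r {a} = 1" "b \<notin> cl {a}" shows "r {a, b} = 2"
  using r_insert_notin[OF assms(2)] assms(1) by (simp add: insert_commute)

lemma nonpar_nonloop: assumes "b \<notin> cl {a}" shows "r {b} = 1"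
proof -
  have "r {a, b} = r {a} + 1" using r_insert_notin[OF assms] by (simp add: insert_commute)
  moreover have "r {a, b} \<le> r {a} + r {b}" using r_union_le[of "{a}" "{b}"] by (simp add: insert_commute)
  ultimately show ?thesis using r_single_le[of b] by linarith
qed

lemma loop_in_flat: assumes "flt F" "r {e} = 0" shows "e \<in> F"
proof -
  have "r (insert e F) \<le> r F" using r_union_le[of "{e}" F] assms by simp
  then show ?thesis using flat_insert[OF assms(1), of e] by fastforce
qed

lemma notin_flat_nonloop: assumes "flt F" "e \<notin> F" shows "r {e} = 1"
  using loop_in_flat[OF assms(1), of e] assms r_single_le[of e] r_nonneg[of "{e}"] by force

lemma par_sym: assumes "b \<in> cl {a}" "r {b} = 1" shows "a \<in> cl {b}"
proof -
  have "b \<notin> cl {}" using assms(2) r_empty by (simp add: in_cl_iff)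
  then show ?thesis using exchange[of b a "{}"] assms by simp
qed

lemma par_flat: assumes "flt F" "b \<in> cl {a}" "r {b} = 1" "b \<in> F" shows "a \<in> F"
  using par_sym[OF assms(2,3)] cl_least[of "{b}" F] assms by auto

lemma nonpar_sym: assumes "b \<notin> cl {a}" "r {a} = 1" shows "a \<notin> cl {b}"
  using par_sym assms by blast

lemma line_span: assumes "flt L" "r L = 2" "a \<in> L" "b \<in> L" "r {a} = 1" "b \<notin> cl {a}"
  shows "cl {a, b} = L"
  using r_pair[OF assms(5,6)] assms by (intro flat_spanned) auto

lemma line_in_flat: assumes "flt L" "r L = 2" "flt F" "a \<in> L" "b \<in> L" "r {a} = 1" "b \<notin> cl {a}" "a \<in> F" "b \<in> F"
  shows "L \<subseteq> F"
  using line_span[OF assms(1,2,4,5,6,7)] cl_least[of "{a, b}" F] assms by auto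

lemma line_meet: assumes "flt L" "r L = 2" "flt F" "\<not> L \<subseteq> F" "y \<in> L" "y \<in> F" "r {y} = 1"
  shows "L \<inter> F = cl {y}"
proof
  show "cl {y} \<subseteq> L \<inter> F" using cl_least[OF _ flat_Int[OF assms(1,3)], of "{y}"] assms by simp
  show "L \<inter> F \<subseteq> cl {y}" using line_in_flat[of L F y] assms by blast
qed

lemma rank_two_points: assumes "2 \<le> r S" obtains a b where "a \<in> S" "b \<in> S" "r {a} = 1" "b \<notin> cl {a}"
proof -
  obtain a where a: "a \<in> S" "r {a} = 1"
  proof -
    have "\<not> S \<subseteq> cl {}" using r_mono[of S "cl {}"] assms r_empty by auto
    then obtain a where "a \<in> S" "a \<notin> cl {}" by auto
    then show ?thesis using that notin_flat_nonloop[of "cl {}" a] by auto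
  qed
  have "\<not> S \<subseteq> cl {a}" using r_mono[of S "cl {a}"] assms a by auto
  then show ?thesis using that a by auto
qed

lemma r_Un_closed: assumes "B \<subseteq> cl A" shows "r (A \<union> B) = r A"
  using assms subset_cl[of A] by (intro r_eq_if_subset_cl) auto

section \<open>Vertical connectivity in terms of covers by flats\<close>

lemma vcD:
  assumes "vert_conn r X" "\<And>e. e \<in> A \<or> e \<in> B" "X \<subseteq> A" "X \<subseteq> B" "r A < r UNIV" "r B < r UNIV"
  shows "r UNIV + r X + 2 \<le> r A + r B"
proof -
  have "A \<union> B = UNIV" using assms(2) by auto
  then show ?thesis using assms unfolding vert_conn_def by blast
qed

text \<open>Taking closures changes neither the ranks nor the covering property, so a violating
  cover can be taken to consist of flats.\<close>

lemma not_vcE: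
  assumes "\<not> vert_conn r X"
  obtains A B where "flt A" "flt B" "\<And>e. e \<in> A \<or> e \<in> B" "X \<subseteq> A" "X \<subseteq> B" "r A < r UNIV" "r B < r UNIV"
    "r A + r B \<le> r UNIV + r X + 1"
proof -
  obtain A B where AB: "A \<union> B = UNIV" "X \<subseteq> A" "X \<subseteq> B" "r A < r UNIV" "r B < r UNIV"
    "\<not> r UNIV + r X + 2 \<le> r A + r B" using assms unfolding vert_conn_def by blast
  show ?thesis
  proof (rule that[of "cl A" "cl B"])
    fix e show "e \<in> cl A \<or> e \<in> cl B" using AB(1) subset_cl[of A] subset_cl[of B] by blast
  qed (use AB subset_cl[of A] subset_cl[of B] in auto)
qed

text \<open>The two flats enter symmetrically. \<open>Q\<close> is the feature, such as containing a
  given point or line, that is used to name one of them \<open>A\<close>.\<close>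

lemma not_vc_choose:
  assumes nv: "\<not> vert_conn r X"
    and Q: "\<forall>A B. flt A \<and> flt B \<and> A \<union> B = UNIV \<and> X \<subseteq> A \<and> X \<subseteq> B \<longrightarrow> Q A \<or> Q B"
  obtains A B where "flt A" "flt B" "\<And>e. e \<in> A \<or> e \<in> B" "X \<subseteq> A" "X \<subseteq> B" "r A < r UNIV" "r B < r UNIV"
    "r A + r B \<le> r UNIV + r X + 1" "Q A"
proof -
  obtain A B where AB: "flt A" "flt B" "\<And>e. e \<in> A \<or> e \<in> B" "X \<subseteq> A" "X \<subseteq> B" "r A < r UNIV" "r B < r UNIV"
    "r A + r B \<le> r UNIV + r X + 1" by (rule not_vcE[OF nv]) blast
  have cov: "e \<in> B \<or> e \<in> A" for e using AB(3)[of e] by auto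
  have sum: "r B + r A \<le> r UNIV + r X + 1" using AB(8) by simp
  have "A \<union> B = UNIV" using AB(3) by blast
  then have "Q A \<or> Q B" using Q AB(1,2,4,5) by blast
  then show ?thesis using that[OF AB] that[OF AB(2,1) cov AB(5,4,7,6) sum] by blast
qed

lemma vc_cl: "vert_conn r (cl X) \<longleftrightarrow> vert_conn r X"
proof
  assume v: "vert_conn r (cl X)"
  show "vert_conn r X"
  proof (rule ccontr)
    assume "\<not> vert_conn r X"
    then obtain A B where AB: "flt A" "flt B" "\<And>e. e \<in> A \<or> e \<in> B" "X \<subseteq> A" "X \<subseteq> B" "r A < r UNIV" "r B < r UNIV"
      "r A + r B \<le> r UNIV + r X + 1" by (rule not_vcE) blast
    then have "cl X \<subseteq> A" "cl X \<subseteq> B" by (simp_all add: cl_least)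
    with vcD[OF v AB(3)] AB show False by force
  qed
next
  assume v: "vert_conn r X"
  show "vert_conn r (cl X)" unfolding vert_conn_def
  proof (intro allI impI)
    fix A B assume A: "A \<union> B = UNIV" "cl X \<subseteq> A" "cl X \<subseteq> B" "r A < r UNIV" "r B < r UNIV"
    then show "r UNIV + r (cl X) + 2 \<le> r A + r B"
      using vcD[OF v, of A B] subset_cl[of X] by auto
  qed
qed

lemma vc_cong: "cl X = cl Y \<Longrightarrow> vert_conn r X \<longleftrightarrow> vert_conn r Y"
  by (metis vc_cl)

lemma vc_par: assumes "vert_conn r {a}" "b \<in> cl {a}" "r {b} = 1" shows "vert_conn r {b}"
proof -
  have "cl {a} = cl {b}" using par_sym[OF assms(2,3)] assms(2) by (intro cl_eqI) auto
  then show ?thesis using vc_cong assms(1) by blast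
qed

section \<open>Contraction on an unchanged ground set\<close>

lemma ctr_rank: "matroid_rank (contract_rank r X) E"
proof
  show "finite E" by (rule finite_E)
  fix A B e
  show "contract_rank r X (A \<inter> E) = contract_rank r X A"
  proof -
    have "(A \<inter> E \<union> X) \<inter> E = (A \<union> X) \<inter> E" by auto
    then have "r (A \<inter> E \<union> X) = r (A \<union> X)" by (metis r_carrier)
    then show ?thesis by (simp add: contract_rank_def)
  qed
  show "contract_rank r X {} = 0" by (simp add: contract_rank_def)
  show "A \<subseteq> B \<Longrightarrow> contract_rank r X A \<le> contract_rank r X B" using r_mono[of "A \<union> X" "B \<union> X"] by (auto simp: contract_rank_def)
  show "contract_rank r X (insert e A) \<le> contract_rank r X A + 1" using r_insert_le[of e "A \<union> X"] by (simp add: contract_rank_def)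
  show "contract_rank r X (A \<union> B) + contract_rank r X (A \<inter> B) \<le> contract_rank r X A + contract_rank r X B"
    using submod_le[of "A \<union> B \<union> X" "A \<union> X" "B \<union> X" "A \<inter> B \<union> X"] by (auto simp: contract_rank_def)
qed

lemma clos_ctr: "rank_closure (contract_rank r X) A = cl (A \<union> X)"
  by (simp add: rank_closure_def contract_rank_def)

lemma flat_ctr: "flat (contract_rank r X) A \<longleftrightarrow> flt A \<and> X \<subseteq> A"
proof
  assume "flat (contract_rank r X) A"
  then have *: "cl (A \<union> X) = A" by (simp add: flat_def clos_ctr)
  then have "X \<subseteq> A" using subset_cl[of "A \<union> X"] by auto
  moreover have "flt A" using * flat_cl[of "A \<union> X"] by simp
  ultimately show "flt A \<and> X \<subseteq> A" by simp
next
  assume "flt A \<and> X \<subseteq> A"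
  then show "flat (contract_rank r X) A" by (simp add: flat_def clos_ctr Un_absorb2)
qed

text \<open>Adding \<open>X\<close> to both sides of a cover leaves the contracted ranks alone, and
  in the inequality the terms \<open>r X\<close> cancel.\<close>

lemma vc_ctr: "vert_conn (contract_rank r X) Y \<longleftrightarrow> vert_conn r (X \<union> Y)"
proof -
  interpret c: matroid_rank "contract_rank r X" E by (rule ctr_rank)
  show ?thesis
  proof
    assume v: "vert_conn (contract_rank r X) Y"
    show "vert_conn r (X \<union> Y)" unfolding vert_conn_def
    proof (intro allI impI)
      fix A B assume A: "A \<union> B = UNIV" "X \<union> Y \<subseteq> A" "X \<union> Y \<subseteq> B" "r A < r UNIV" "r B < r UNIV"
      then have "A \<union> X = A" "B \<union> X = B" by auto
      then have "contract_rank r X UNIV + contract_rank r X Y + 2 \<le> contract_rank r X A + contract_rank r X B"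
        using A by (intro c.vcD[OF v]) (auto simp: contract_rank_def)
      then show "r UNIV + r (X \<union> Y) + 2 \<le> r A + r B"
        using \<open>A \<union> X = A\<close> \<open>B \<union> X = B\<close> by (simp add: contract_rank_def Un_commute)
    qed
  next
    assume v: "vert_conn r (X \<union> Y)"
    show "vert_conn (contract_rank r X) Y" unfolding vert_conn_def
    proof (intro allI impI)
      fix A B assume A: "A \<union> B = UNIV" "Y \<subseteq> A" "Y \<subseteq> B" "contract_rank r X A < contract_rank r X UNIV" "contract_rank r X B < contract_rank r X UNIV"
      have "r UNIV + r (X \<union> Y) + 2 \<le> r (A \<union> X) + r (B \<union> X)"
        using A by (intro vcD[OF v]) (auto simp: contract_rank_def)
      then show "contract_rank r X UNIV + contract_rank r X Y + 2 \<le> contract_rank r X A + contract_rank r X B"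
        by (simp add: contract_rank_def Un_commute)
    qed
  qed
qed

lemma ctr_ctr: "contract_rank (contract_rank r X) Y = contract_rank r (X \<union> Y)"
  by (rule ext) (simp add: contract_rank_def Un_assoc Un_commute[of X Y])

end

section \<open>Minors of contractions\<close>

text \<open>For simple \<open>N\<close> the map \<open>g\<close> is injective and avoids the closure of \<open>C\<close>, so that the restriction of
  \<open>M/C\<close> to its image is a copy of \<open>N\<close>.\<close>
definition minor_embedding :: "('a set \<Rightarrow> int) \<Rightarrow> ('b set \<Rightarrow> int) \<Rightarrow> 'b set \<Rightarrow> 'a set \<Rightarrow> ('b \<Rightarrow> 'a) \<Rightarrow> bool" where
  "minor_embedding r rN EN C g \<longleftrightarrow> (\<forall>Z. Z \<subseteq> EN \<longrightarrow> r (g ` Z \<union> C) = rN Z + r C)"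

text \<open>For simple \<open>N\<close> this expresses that \<open>M/Y\<close> has an
  \<open>N\<close>-minor: \<open>C\<close> is contracted, and whatever lies neither in
  \<open>C\<close> nor in the image of \<open>g\<close> is deleted.\<close>

definition minor_after :: "('a set \<Rightarrow> int) \<Rightarrow> ('b set \<Rightarrow> int) \<Rightarrow> 'b set \<Rightarrow> 'a set \<Rightarrow> bool" where
  "minor_after r rN EN Y \<longleftrightarrow> (\<exists>C g. Y \<subseteq> C \<and> minor_embedding r rN EN C g)"

lemma finite_minimal_subset:
  assumes "finite J" "P J" obtains K where "K \<subseteq> J" "P K" "\<And>K'. K' \<subset> K \<Longrightarrow> \<not> P K'"
proof -
  have "finite {K. K \<subseteq> J \<and> P K}" using assms by simp
  then obtain K where "K \<in> {K. K \<subseteq> J \<and> P K}" "\<And>K'. K' \<in> {K. K \<subseteq> J \<and> P K} \<Longrightarrow> K' \<subseteq> K \<Longrightarrow> K = K'"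
    using finite_has_minimal[of "{K. K \<subseteq> J \<and> P K}"] assms by (metis (mono_tags, lifting) empty_iff mem_Collect_eq order_refl)
  then show ?thesis using that[of K] by blast
qed

text \<open>3-connectedness of \<open>N\<close> is split by order, as the two parts serve different
  ends: \<open>N_conn1\<close> excludes coloops, \<open>N_conn2\<close> keeps \<open>N\<close> from
  spreading over both sides of a separation of \<open>M/X\<close>.\<close>

locale matroid_minor = matroid_rank r E for r :: "'a set \<Rightarrow> int" and E +
  fixes rN :: "'b set \<Rightarrow> int" and EN :: "'b set"
  assumes finite_EN: "finite EN"
    and N_mono: "Y \<subseteq> Z \<Longrightarrow> Z \<subseteq> EN \<Longrightarrow> rN Y \<le> rN Z"
    and N_indep: "Z \<subseteq> EN \<Longrightarrow> card Z \<le> 2 \<Longrightarrow> rN Z = int (card Z)"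
    and N_conn1: "Z \<subseteq> EN \<Longrightarrow> Z \<noteq> {} \<Longrightarrow> Z \<noteq> EN \<Longrightarrow> rN EN + 1 \<le> rN Z + rN (EN - Z)"
    and N_conn2: "Z \<subseteq> EN \<Longrightarrow> 2 \<le> card Z \<Longrightarrow> 2 \<le> card (EN - Z) \<Longrightarrow> rN EN + 2 \<le> rN Z + rN (EN - Z)"
begin

abbreviation "is_embedding \<equiv> minor_embedding r rN EN"
abbreviation "is_minor_after \<equiv> minor_after r rN EN"

lemma embD: "is_embedding C g \<Longrightarrow> Z \<subseteq> EN \<Longrightarrow> r (g ` Z \<union> C) = rN Z + r C"
  by (simp add: minor_embedding_def)

lemma nmI: "is_embedding C g \<Longrightarrow> Y \<subseteq> C \<Longrightarrow> is_minor_after Y"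
  by (auto simp: minor_after_def)

lemma nm_mono: "is_minor_after Y \<Longrightarrow> Z \<subseteq> Y \<Longrightarrow> is_minor_after Z"
  by (auto simp: minor_after_def)

lemma emb_cl: "is_embedding C g \<Longrightarrow> is_embedding (cl C) g"
  by (simp add: minor_embedding_def)

lemma nm_cl: "is_minor_after Y \<Longrightarrow> is_minor_after (cl Y)"
  unfolding minor_after_def using emb_cl cl_mono by meson

lemma nm_cong: "cl Y = cl Z \<Longrightarrow> is_minor_after Y \<longleftrightarrow> is_minor_after Z"
  using nm_cl nm_mono subset_cl by metis

lemma ctr_minor: "matroid_minor (contract_rank r X) E rN EN"
  using ctr_rank[of X] finite_EN N_mono N_indep N_conn1 N_conn2
  by (simp add: matroid_minor_def matroid_minor_axioms_def)

lemma emb_ctr: "minor_embedding (contract_rank r X) rN EN C g \<longleftrightarrow> is_embedding (C \<union> X) g"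
  by (simp add: minor_embedding_def contract_rank_def Un_assoc)

lemma nm_ctr: "minor_after (contract_rank r X) rN EN Y \<longleftrightarrow> is_minor_after (X \<union> Y)"
proof
  assume "minor_after (contract_rank r X) rN EN Y"
  then show "is_minor_after (X \<union> Y)" unfolding minor_after_def emb_ctr by blast
next
  assume "is_minor_after (X \<union> Y)"
  then obtain C g where "X \<union> Y \<subseteq> C" "is_embedding C g" unfolding minor_after_def by blast
  moreover from this have "C \<union> X = C" by auto
  ultimately show "minor_after (contract_rank r X) rN EN Y" unfolding minor_after_def emb_ctr by (metis le_sup_iff)
qed

lemma rN_le1_card: assumes "S \<subseteq> EN" "rN S \<le> 1" shows "card S \<le> 1"
proof (rule ccontr)
  assume "\<not> card S \<le> 1"
  then obtain T where "T \<subseteq> S" "card T = 2" using obtain_subset_with_card_n[of 2 S] by auto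
  then have "rN T = 2" using N_indep[of T] assms by auto
  then show False using N_mono[OF \<open>T \<subseteq> S\<close> assms(1)] assms(2) by simp
qed

section \<open>Moving a minor across a separation of small order\<close>

lemma cap0: assumes "r (S \<union> B) = r S + r B" "Y \<subseteq> B" shows "r (Y \<union> S) = r Y + r S"
  using submod_le[of "S \<union> B" "Y \<union> S" B Y] r_union_le[of Y S] assms by force

text \<open>Here \<open>S\<close> is connected to \<open>B\<close> as strongly as all of
  \<open>A\<close> is, so subsets of \<open>B\<close> cannot tell the contraction of
  \<open>S\<close> from that of \<open>A\<close>.\<close>

lemma cap1:
  assumes "r (S \<union> B) = r S + r (A \<union> B) - r A" "S \<subseteq> A" "Y \<subseteq> B"
  shows "r (Y \<union> S) = r (Y \<union> A) - r A + r S"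
proof -
  have "r (Y \<union> A) + r S \<le> r (Y \<union> S) + r A" by (rule submod_le) (use assms in auto)
  moreover have "r (A \<union> B) + r (Y \<union> S) \<le> r (S \<union> B) + r (Y \<union> A)" by (rule submod_le) (use assms in auto)
  ultimately show ?thesis using assms(1) by linarith
qed

lemma nm_trivial:
  assumes "card EN \<le> 1" "r X + rN EN \<le> r UNIV" shows "is_minor_after X"
proof (cases "EN = {}")
  case True
  then show ?thesis using N_indep[of "{}"] by (intro nmI[of X undefined]) (auto simp: minor_embedding_def)
next
  case False
  then obtain e where e: "EN = {e}" using assms(1) finite_EN
    by (metis card_0_eq card_1_singletonE le_SucE le_zero_eq One_nat_def)
  have "rN EN = 1" using N_indep[of EN] e by simp
  then have "\<not> UNIV \<subseteq> cl X" using r_mono[of UNIV "cl X"] assms by auto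
  then obtain d where d: "d \<notin> cl X" by auto
  have "is_embedding X (\<lambda>_. d)" unfolding minor_embedding_def
  proof (intro allI impI)
    fix Z assume "Z \<subseteq> EN"
    then have "Z = {} \<or> Z = {e}" using e by auto
    then show "r ((\<lambda>_. d) ` Z \<union> X) = rN Z + r X"
      using N_indep[of Z] e r_insert_notin[OF d] by auto
  qed
  then show ?thesis by (rule nmI) simp
qed

text \<open>A coloop is a 1-separation of \<open>N\<close> unless it is all of
  \<open>N\<close>.\<close>

lemma coloop_trivial: assumes "e \<in> EN" "rN EN = rN (EN - {e}) + 1" shows "card EN \<le> 1"
proof (cases "EN = {e}")
  case False
  then show ?thesis using N_conn1[of "{e}"] N_indep[of "{e}"] assms by auto
qed simp

text \<open>The elements of the contracted set outside \<open>B\<close>, together with the at most one element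
  of \<open>N\<close> there, act on \<open>B\<close> in one of three ways: like nothing, like contracting the base
  point of the 2-sum, or like the base point itself. Each is simulated after contracting \<open>a\<close>.\<close>
lemma small_side0:
  assumes em: "is_embedding C g" and cov: "\<And>e. e \<in> A \<or> e \<in> B" and sum: "r A + r B \<le> r UNIV + 1"
    and EA: "card {e \<in> EN. g e \<notin> B} \<le> 1" and a: "a \<in> A" "a \<notin> cl B" and R2: "2 \<le> r UNIV"
  shows "is_minor_after {a}"
proof (cases "card EN \<le> 1")
  case True
  have "rN EN = int (card EN)" using N_indep[of EN] True by simp
  then show ?thesis using True R2 r_single_le[of a] by (intro nm_trivial) auto
next
  case nontriv: False
  define CA where "CA = C - B"
  define CB where "CB = C \<inter> B"
  have AB: "A \<union> B = UNIV" using cov by auto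
  have CA: "CA \<subseteq> A" "CB \<subseteq> B" "C = CB \<union> CA" using cov by (auto simp: CA_def CB_def)
  \<comment> \<open>The connectivity between \<open>A\<close> and \<open>B\<close> is at most 1, so
    every part of \<open>A\<close> has either none of it or all of it.\<close>
  have cap: "r (S \<union> B) = r S + r B \<or> r (S \<union> B) = r S + r (A \<union> B) - r A" if "S \<subseteq> A" for S
  proof -
    have "r (A \<union> B) + r S \<le> r (S \<union> B) + r A" by (rule submod_le) (use that in auto)
    then show ?thesis using r_union_le[of S B] sum AB by auto
  qed
  have a1: "r ({a} \<union> B) = r {a} + r B" "r {a} = 1"
    using r_insert_notin[OF a(2)] notin_flat_nonloop[OF _ a(2)] by auto
  have rC: "r C = r (CB \<union> CA)" using CA by simp
  have gB: "g ` Z \<union> CB \<subseteq> B" if "Z \<subseteq> EN" "Z \<inter> {e \<in> EN. g e \<notin> B} = {}" for Z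
    using that CA by blast
  consider "{e \<in> EN. g e \<notin> B} = {}" | e0 where "{e \<in> EN. g e \<notin> B} = {e0}"
    using EA finite_EN by (metis (no_types, lifting) One_nat_def card_0_eq card_1_singletonE
        finite_Collect_conjI le_SucE le_zero_eq finite_subset mem_Collect_eq subsetI)
  then show ?thesis
  proof cases
    case 1
    from cap[OF CA(1)] show ?thesis
    proof
      assume c0: "r (CA \<union> B) = r CA + r B"
      have "is_embedding (CB \<union> {a}) g" unfolding minor_embedding_def
      proof (intro allI impI)
        fix Z assume Z: "Z \<subseteq> EN"
        then have Y: "g ` Z \<union> CB \<subseteq> B" using 1 by (intro gB) auto
        have "r (g ` Z \<union> CB \<union> CA) = r (g ` Z \<union> CB) + r CA" "r (CB \<union> CA) = r CB + r CA"
          "r (g ` Z \<union> CB \<union> {a}) = r (g ` Z \<union> CB) + r {a}" "r (CB \<union> {a}) = r CB + r {a}"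
          using cap0[OF c0] cap0[OF a1(1)] Y CA by blast+
        then show "r (g ` Z \<union> (CB \<union> {a})) = rN Z + r (CB \<union> {a})"
          using embD[OF em Z] CA(3) by (simp add: Un_assoc)
      qed
      then show ?thesis by (rule nmI) auto
    next
      assume c1: "r (CA \<union> B) = r CA + r (A \<union> B) - r A"
      have "is_embedding (CB \<union> A) g" unfolding minor_embedding_def
      proof (intro allI impI)
        fix Z assume Z: "Z \<subseteq> EN"
        then have Y: "g ` Z \<union> CB \<subseteq> B" using 1 by (intro gB) auto
        have "r (g ` Z \<union> CB \<union> CA) = r (g ` Z \<union> CB \<union> A) - r A + r CA" "r (CB \<union> CA) = r (CB \<union> A) - r A + r CA"
          using cap1[OF c1 CA(1)] Y CA by blast+
        then show "r (g ` Z \<union> (CB \<union> A)) = rN Z + r (CB \<union> A)"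
          using embD[OF em Z] CA(3) by (simp add: Un_assoc)
      qed
      then show ?thesis by (rule nmI) (use a in auto)
    qed
  next
    case (2 e0)
    define q where "q = g e0"
    have e0: "e0 \<in> EN" "q \<notin> B" "q \<in> A" using 2 cov by (auto simp: q_def)
    have rest: "g ` Z \<union> CB \<subseteq> B" if "Z \<subseteq> EN" "e0 \<notin> Z" for Z
      using that 2 by (intro gB) auto
    have rq: "r (CA \<union> {q}) \<le> r CA + 1" using r_insert_le[of q CA] by simp
    have qA: "CA \<union> {q} \<subseteq> A" using CA e0 by auto
    have N1: "rN {e0} = 1" using N_indep[of "{e0}"] e0 by auto
    have tot: "rN EN = r (g ` (EN - {e0}) \<union> CB \<union> (CA \<union> {q})) - r C"
      "rN {e0} = r (CB \<union> (CA \<union> {q})) - r C"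
      "rN (EN - {e0}) = r (g ` (EN - {e0}) \<union> CB \<union> CA) - r C"
    proof -
      have "g ` (EN - {e0}) \<union> CB \<union> (CA \<union> {q}) = g ` EN \<union> C" "CB \<union> (CA \<union> {q}) = g ` {e0} \<union> C"
        "g ` (EN - {e0}) \<union> CB \<union> CA = g ` (EN - {e0}) \<union> C" using CA e0 by (auto simp: q_def)
      then show "rN EN = r (g ` (EN - {e0}) \<union> CB \<union> (CA \<union> {q})) - r C"
        "rN {e0} = r (CB \<union> (CA \<union> {q})) - r C"
        "rN (EN - {e0}) = r (g ` (EN - {e0}) \<union> CB \<union> CA) - r C"
        using embD[OF em, of EN] embD[OF em, of "{e0}"] embD[OF em, of "EN - {e0}"] e0 by auto
    qed
    have YB: "g ` (EN - {e0}) \<union> CB \<subseteq> B" by (rule rest) auto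
    \<comment> \<open>If \<open>CA\<close> with \<open>q\<close> were skew to \<open>B\<close>, or
      if \<open>CA\<close> alone already had the full connection to \<open>B\<close>, then
      \<open>e0\<close> would be a coloop of \<open>N\<close>. Hence \<open>CA\<close> has no
      connection to \<open>B\<close>, and it is \<open>q\<close> that provides it.\<close>
    have not0: "r (CA \<union> {q} \<union> B) \<noteq> r (CA \<union> {q}) + r B"
    proof
      assume c: "r (CA \<union> {q} \<union> B) = r (CA \<union> {q}) + r B"
      have "r (CA \<union> {q} \<union> B) \<le> r (CA \<union> B) + 1" using r_insert_le[of q "CA \<union> B"] by simp
      have "r (CA \<union> {q} \<union> B) + r CA \<le> r (CA \<union> {q}) + r (CA \<union> B)" by (rule submod_le) auto
      then have c': "r (CA \<union> B) = r CA + r B" using c r_union_le[of CA B] by linarith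
      have "rN EN = rN (EN - {e0}) + 1"
        using tot cap0[OF c YB] cap0[OF c CA(2)] cap0[OF c' YB] cap0[OF c' CA(2)] N1 rC by linarith
      then show False using coloop_trivial e0 nontriv by blast
    qed
    then have c1: "r (CA \<union> {q} \<union> B) = r (CA \<union> {q}) + r (A \<union> B) - r A" using cap[OF qA] by auto
    have c0: "r (CA \<union> B) = r CA + r B"
    proof (rule ccontr)
      assume "r (CA \<union> B) \<noteq> r CA + r B"
      then have c: "r (CA \<union> B) = r CA + r (A \<union> B) - r A" using cap[OF CA(1)] by auto
      have "rN EN = rN (EN - {e0}) + 1"
        using tot cap1[OF c1 qA YB] cap1[OF c1 qA CA(2)] cap1[OF c CA(1) YB] cap1[OF c CA(1) CA(2)] N1 rC
        by linarith
      then show False using coloop_trivial e0 nontriv by blast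
    qed
    have rq': "r (CA \<union> {q}) = r CA + 1"
    proof -
      have "r (CB \<union> (CA \<union> {q})) \<le> r CB + r (CA \<union> {q})" by (rule r_union_le)
      then show ?thesis using tot(2) N1 rC cap0[OF c0 CA(2)] rq by linarith
    qed
    \<comment> \<open>A maximal set through \<open>a\<close> that is skew to \<open>B\<close> can be
      contracted without harm to \<open>B\<close>. By maximality a further element \<open>d\<close>
      is connected to \<open>B\<close>, and it takes over the role of \<open>q\<close>. Intersecting
      with \<open>E\<close> makes the family finite.\<close>
    define \<D> where "\<D> = {D. D \<subseteq> A \<inter> E \<union> {a} \<and> a \<in> D \<and> r (D \<union> B) = r D + r B}"
    have "finite \<D>" using finite_E by (intro finite_subset[of \<D> "Pow (A \<inter> E \<union> {a})"]) (auto simp: \<D>_def)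
    moreover have "{a} \<in> \<D>" using a a1 by (auto simp: \<D>_def)
    ultimately obtain D where D: "D \<in> \<D>" "\<And>D'. D' \<in> \<D> \<Longrightarrow> D \<subseteq> D' \<Longrightarrow> D = D'"
      using finite_has_maximal[of \<D>] by (metis empty_iff)
    have DA: "D \<subseteq> A" "a \<in> D" "r (D \<union> B) = r D + r B" using D(1) a by (auto simp: \<D>_def)
    have AE: "r (A \<inter> E \<union> {a} \<union> B) = r (A \<union> B)" "r (A \<inter> E \<union> {a}) = r A"
    proof -
      have "r (A \<inter> E \<union> {a}) \<le> r A" using a by (intro r_mono) auto
      moreover have "r (A \<inter> E) \<le> r (A \<inter> E \<union> {a})" by (intro r_mono) auto
      ultimately show eq: "r (A \<inter> E \<union> {a}) = r A" using r_carrier[of A] by linarith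
      have "r (A \<union> B) = r ((A \<union> B) \<inter> E)" by (simp add: r_carrier)
      also have "\<dots> \<le> r (A \<inter> E \<union> {a} \<union> B)" by (rule r_mono) auto
      finally show "r (A \<inter> E \<union> {a} \<union> B) = r (A \<union> B)"
        using r_mono[of "A \<inter> E \<union> {a} \<union> B" "A \<union> B"] a by auto
    qed
    have one: "r (A \<union> B) \<noteq> r A + r B"
      using not0 cap[OF qA] c1 by auto
    have "D \<noteq> A \<inter> E \<union> {a}" using DA(3) AE one by auto
    then obtain d where d: "d \<in> A \<inter> E \<union> {a}" "d \<notin> D" using D(1) by (auto simp: \<D>_def)
    have dA: "D \<union> {d} \<subseteq> A" using d DA a by auto
    have "D \<union> {d} \<notin> \<D>" using D(2)[of "D \<union> {d}"] d by auto
    then have n0: "r (D \<union> {d} \<union> B) \<noteq> r (D \<union> {d}) + r B" using d D(1) by (auto simp: \<D>_def)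
    then have d1: "r (D \<union> {d} \<union> B) = r (D \<union> {d}) + r (A \<union> B) - r A" using cap[OF dA] by auto
    have rd: "r (D \<union> {d}) = r D + 1"
    proof -
      have "r (D \<union> {d}) = r D \<Longrightarrow> r (D \<union> {d} \<union> B) = r (D \<union> B)"
        using r_Un_closed[of "{d}" "D \<union> B"] cl_mono[of D "D \<union> B"] by (auto simp: in_cl_iff Un_ac)
      then have "r (D \<union> {d}) \<noteq> r D" using n0 DA(3) by auto
      moreover have "r (D \<union> {d}) \<le> r D + 1" "r D \<le> r (D \<union> {d})" using r_insert_le[of d D] r_insert_ge[of D d] by auto
      ultimately show ?thesis by linarith
    qed
    define g' where "g' = g(e0 := d)"
    have "is_embedding (CB \<union> D) g'" unfolding minor_embedding_def
    proof (intro allI impI)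
      fix Z assume Z: "Z \<subseteq> EN"
      define Z' where "Z' = Z - {e0}"
      have Z': "Z' \<subseteq> EN" "e0 \<notin> Z'" "g' ` Z' = g ` Z'" using Z by (auto simp: Z'_def g'_def)
      have Y: "g ` Z' \<union> CB \<subseteq> B" using Z' by (intro rest) auto
      show "r (g' ` Z \<union> (CB \<union> D)) = rN Z + r (CB \<union> D)"
      proof (cases "e0 \<in> Z")
        case False
        then have "Z' = Z" by (auto simp: Z'_def)
        then show ?thesis
          using embD[OF em Z] CA(3) Z'(3) cap0[OF DA(3) Y] cap0[OF DA(3) CA(2)] cap0[OF c0 Y] cap0[OF c0 CA(2)]
          by (simp add: Un_assoc)
      next
        case True
        then have "g' ` Z \<union> (CB \<union> D) = g ` Z' \<union> CB \<union> (D \<union> {d})" "g ` Z \<union> C = g ` Z' \<union> CB \<union> (CA \<union> {q})"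
          using CA(3) by (auto simp: Z'_def g'_def q_def)
        then show ?thesis
          using embD[OF em Z] cap1[OF d1 dA Y] cap1[OF c1 qA Y] rd rq' cap0[OF DA(3) CA(2)] cap0[OF c0 CA(2)] rC
          by simp
      qed
    qed
    then show ?thesis by (rule nmI) (use DA in auto)
  qed
qed

text \<open>Since \<open>z\<close> lies on both sides, its contraction lowers the connectivity from
  2 to 1, which is the situation of \<open>small_side0\<close>.\<close>

lemma small_side:
  assumes em: "is_embedding C g" "z \<in> C" and cov: "\<And>e. e \<in> A \<or> e \<in> B" and z: "z \<in> A" "z \<in> B" "r {z} = 1"
    and sum: "r A + r B \<le> r UNIV + 2"
    and EA: "card {e \<in> EN. g e \<notin> B} \<le> 1" and a: "a \<in> A" "flt B" "a \<notin> B" and R3: "3 \<le> r UNIV"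
  shows "is_minor_after {z, a}"
proof -
  interpret c: matroid_minor "contract_rank r {z}" E rN EN by (rule ctr_minor)
  have "minor_after (contract_rank r {z}) rN EN {a}"
  proof (rule c.small_side0[OF _ cov])
    show "minor_embedding (contract_rank r {z}) rN EN C g" using em by (simp add: emb_ctr insert_absorb)
    show "a \<notin> rank_closure (contract_rank r {z}) B" using a z by (simp add: clos_ctr insert_absorb flat_def)
  qed (use assms in \<open>auto simp: contract_rank_def insert_absorb\<close>)
  then show ?thesis by (simp add: nm_ctr insert_commute)
qed

text \<open>Such a cover of \<open>M/X\<close> would split \<open>N\<close> with connectivity at
  most 1, so by \<open>N_conn2\<close> one of the two parts of \<open>N\<close> has at most one
  element.\<close>

lemma emb_sides:
  assumes em: "is_embedding C g" "X \<subseteq> C" and cov: "\<And>e. e \<in> A \<or> e \<in> B" and X: "X \<subseteq> A" "X \<subseteq> B"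
    and sum: "r A + r B \<le> r UNIV + r X + 1"
  shows "card {e \<in> EN. g e \<notin> B} \<le> 1 \<or> card {e \<in> EN. g e \<notin> A} \<le> 1"
proof (rule ccontr)
  assume neg: "\<not> ?thesis"
  define S where "S = {e \<in> EN. g e \<notin> B}"
  define T where "T = EN - S"
  have ST: "S \<subseteq> EN" "T \<subseteq> EN" "g ` S \<subseteq> A" "g ` T \<subseteq> B" "S \<union> T = EN" using cov by (auto simp: S_def T_def)
  have "{e \<in> EN. g e \<notin> A} \<subseteq> T" using cov by (auto simp: S_def T_def)
  then have "card {e \<in> EN. g e \<notin> A} \<le> card T" using finite_EN by (intro card_mono) (auto simp: T_def)
  then have "rN EN + 2 \<le> rN S + rN T" using neg N_conn2[OF ST(1)] by (auto simp: S_def[symmetric] T_def)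
  moreover have "r (A \<union> C \<union> g ` T) + r (g ` S \<union> C) \<le> r (A \<union> C) + r (g ` EN \<union> C)"
    by (rule submod_le) (use ST in auto)
  moreover have "r UNIV + r (g ` T \<union> C) \<le> r (B \<union> C) + r (A \<union> C \<union> g ` T)"
    by (rule submod_le) (use cov ST in blast)+
  moreover have "r (A \<union> C) + r (A \<inter> C) \<le> r A + r C" "r (B \<union> C) + r (B \<inter> C) \<le> r B + r C"
    by (auto intro: submod_le)
  moreover have "r C + r X \<le> r (A \<inter> C) + r (B \<inter> C)" by (rule submod_le) (use cov X em in auto)
  ultimately show False
    using embD[OF em(1) ST(1)] embD[OF em(1) ST(2)] embD[OF em(1), of EN] sum by simp
qed

text \<open>\<open>A\<close> has rank at most 1 over \<open>D\<close>, and \<open>N\<close> is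
  simple, so at most one element of \<open>N\<close> is placed off \<open>B\<close>; then
  \<open>small_side\<close> applies to every \<open>a\<close> off \<open>B\<close>.\<close>

lemma nm_transfer:
  assumes D: "is_minor_after D" "z \<in> D" "r (A \<union> D) \<le> r D + 1"
    and cov: "\<And>e. e \<in> A \<or> e \<in> B" and z: "z \<in> A" "z \<in> B" "r {z} = 1"
    and sum: "r A + r B \<le> r UNIV + 2"
    and a: "a \<in> A" "flt B" "a \<notin> B" and R3: "3 \<le> r UNIV"
  shows "is_minor_after {z, a}"
proof -
  obtain C g where C: "D \<subseteq> C" "is_embedding C g" using D(1) by (auto simp: minor_after_def)
  define S where "S = {e \<in> EN. g e \<notin> B}"
  have S: "S \<subseteq> EN" "g ` S \<subseteq> A" using cov by (auto simp: S_def)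
  have "r (g ` S \<union> C) \<le> r (A \<union> C)" using S by (intro r_mono) auto
  moreover have "r (A \<union> C) + r D \<le> r (A \<union> D) + r C" by (rule submod_le) (use C in auto)
  ultimately have "rN S \<le> 1" using embD[OF C(2) S(1)] D(3) by linarith
  then have "card S \<le> 1" using rN_le1_card S by blast
  then show ?thesis using assms C by (intro small_side[of C g z A B a]) (auto simp: S_def)
qed

text \<open>With at most three elements, \<open>N\<close> is empty, a point or a triangle. A
  triangle is obtained from any circuit of \<open>M/X\<close> with at least three elements by
  contracting all but three of them.\<close>

lemma nm_small:
  assumes card3: "card EN \<le> 3" and v: "vert_conn r X" and R: "r X + rN EN \<le> r UNIV"
  shows "is_minor_after X"
proof (cases "card EN \<le> 1")
  case True then show ?thesis using R by (rule nm_trivial)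
next
  case False
  obtain e where e: "e \<in> EN" using False by fastforce
  have "EN \<noteq> {e}" using False by auto
  then have c1: "rN EN + 1 \<le> rN {e} + rN (EN - {e})" using N_conn1[of "{e}"] e by auto
  have cc: "card (EN - {e}) = card EN - 1" using e finite_EN by simp
  have N1: "rN {e} = 1" "rN (EN - {e}) = int (card EN) - 1"
    using N_indep[of "{e}"] N_indep[of "EN - {e}"] e cc card3 False by auto
  have "card EN \<noteq> 2" using c1 N1 N_indep[of EN] by auto
  then have card: "card EN = 3" using card3 False by auto
  obtain T where T: "T \<subseteq> EN" "card T = 2" using obtain_subset_with_card_n[of 2 EN] card by auto
  have rEN: "rN EN = 2" using N_mono[OF T(1)] N_indep[OF T(1)] T c1 N1 card by auto
  obtain I where I: "I \<subseteq> E" "r (X \<union> I) = r UNIV" "\<And>K. K \<subset> I \<Longrightarrow> r (X \<union> K) \<noteq> r UNIV"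
  proof (rule finite_minimal_subset[of E "\<lambda>I. r (X \<union> I) = r UNIV"])
    have "(X \<union> E) \<inter> E = UNIV \<inter> E" by auto
    then show "r (X \<union> E) = r UNIV" by (metis r_carrier)
  qed (use finite_E in auto)
  have finI: "finite I" using I finite_E finite_subset by blast
  have "I \<noteq> {}" using I(2) R rEN by auto
  then obtain i where i: "i \<in> I" by auto
  have "I - {i} \<subset> I" using i by auto
  from I(3)[OF this] have lt: "r (X \<union> (I - {i})) < r UNIV" using r_le_UNIV[of "X \<union> (I - {i})"] by linarith
  \<comment> \<open>A point and a hyperplane of \<open>M/X\<close> are too small to cover it. An
    element \<open>f\<close> off both depends on \<open>i\<close> and on at least one more element
    of \<open>I\<close>.\<close>
  have "\<exists>f. f \<notin> cl (X \<union> {i}) \<and> f \<notin> cl (X \<union> (I - {i}))"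
  proof (rule ccontr)
    assume n: "\<not> ?thesis"
    have Xi: "r (X \<union> {i}) \<le> r X + 1" using r_insert_le[of i X] by simp
    have "r UNIV + r X + 2 \<le> r (cl (X \<union> {i})) + r (cl (X \<union> (I - {i})))"
    proof (rule vcD[OF v])
      show "f \<in> cl (X \<union> {i}) \<or> f \<in> cl (X \<union> (I - {i}))" for f using n by auto
      show "X \<subseteq> cl (X \<union> {i})" "X \<subseteq> cl (X \<union> (I - {i}))" using subset_cl[of "X \<union> {i}"] subset_cl[of "X \<union> (I - {i})"] by auto
    qed (use lt Xi R rEN in auto)
    then show False using lt Xi by simp
  qed
  then obtain f where f: "f \<notin> cl (X \<union> {i})" "f \<notin> cl (X \<union> (I - {i}))" by auto
  have "f \<in> cl (X \<union> I)" using subset_cl_if_rank[of "X \<union> I" UNIV] I(2) by auto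
  then obtain J where J: "J \<subseteq> I" "f \<in> cl (X \<union> J)" "\<And>K. K \<subset> J \<Longrightarrow> f \<notin> cl (X \<union> K)"
    using finite_minimal_subset[of I "\<lambda>J. f \<in> cl (X \<union> J)"] finI by auto
  have iJ: "i \<in> J"
  proof (rule ccontr)
    assume "i \<notin> J"
    then have "cl (X \<union> J) \<subseteq> cl (X \<union> (I - {i}))" using J(1) by (intro cl_mono) auto
    then show False using J f by auto
  qed
  obtain j where j: "j \<in> J" "j \<noteq> i"
  proof -
    have "J \<noteq> {i}" using J(2) f(1) by auto
    then show ?thesis using iJ that by auto
  qed
  \<comment> \<open>By minimality of \<open>J\<close>, the set \<open>J\<close> together with
    \<open>f\<close> is a circuit of \<open>M/X\<close>; only \<open>i\<close>, \<open>j\<close> and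
    \<open>f\<close> are spared.\<close>
  define C where "C = X \<union> (J - {i, j})"
  have X1: "X \<union> (J - {j}) = insert i C" "X \<union> (J - {i}) = insert j C" "X \<union> J = insert i (insert j C)"
    using iJ j by (auto simp: C_def)
  have f1: "f \<notin> cl (insert i C)" "f \<notin> cl (insert j C)" "f \<in> cl (insert i (insert j C))"
    using J(2) J(3)[of "J - {j}"] J(3)[of "J - {i}"] iJ j unfolding X1 by auto
  have iC: "i \<notin> cl (insert j C)"
  proof
    assume "i \<in> cl (insert j C)"
    then have "insert i (insert j C) \<subseteq> cl (insert j C)" using subset_cl[of "insert j C"] by auto
    then show False using f1 cl_least[of _ "cl (insert j C)"] by (meson flat_cl subsetD)
  qed
  have jC: "j \<notin> cl (insert i C)"
  proof
    assume "j \<in> cl (insert i C)"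
    then have "insert i (insert j C) \<subseteq> cl (insert i C)" using subset_cl[of "insert i C"] by auto
    then show False using f1 cl_least[of _ "cl (insert i C)"] by (meson flat_cl subsetD)
  qed
  have nC: "i \<notin> cl C" "j \<notin> cl C" "f \<notin> cl C"
    using iC jC f1 cl_mono[of C "insert j C"] cl_mono[of C "insert i C"] by auto
  have ranks: "r (insert i C) = r C + 1" "r (insert j C) = r C + 1" "r (insert f C) = r C + 1"
    "r (insert i (insert j C)) = r C + 2" "r (insert f (insert i C)) = r C + 2" "r (insert f (insert j C)) = r C + 2"
    "r (insert f (insert i (insert j C))) = r C + 2"
    using r_insert_notin[OF nC(1)] r_insert_notin[OF nC(2)] r_insert_notin[OF nC(3)] r_insert_notin[OF iC]
      r_insert_notin[OF f1(1)] r_insert_notin[OF f1(2)] f1(3)[unfolded in_cl_iff] by linarith+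
  obtain x y w where xyw: "EN = {x, y, w}" "x \<noteq> y" "x \<noteq> w" "y \<noteq> w"
    using card by (auto simp: card_3_iff)
  define g where "g = (\<lambda>u. if u = x then i else if u = y then j else f)"
  have g: "g x = i" "g y = j" "g w = f" using xyw by (auto simp: g_def)
  have "is_embedding C g" unfolding minor_embedding_def
  proof (intro allI impI)
    fix Z assume ZE: "Z \<subseteq> EN"
    then have "Z \<in> Pow {x, y, w}" unfolding xyw(1) by simp
    then have "Z = {} \<or> Z = {x} \<or> Z = {y} \<or> Z = {w} \<or> Z = {x, y} \<or> Z = {x, w} \<or> Z = {y, w} \<or> Z = EN"
      unfolding xyw(1) Pow_insert Pow_empty image_insert image_empty Un_insert_left Un_empty_left
      by (elim insertE) (simp_all add: insert_commute)
    then show "r (g ` Z \<union> C) = rN Z + r C"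
    proof (elim disjE)
      assume Z: "Z = {x, y}"
      have "rN Z = 2" using N_indep[OF ZE] Z xyw(2) by simp
      then show ?thesis using Z ranks(4) by (simp add: g)
    next
      assume Z: "Z = {x, w}"
      have "rN Z = 2" using N_indep[OF ZE] Z xyw(3) by simp
      then show ?thesis using Z ranks(5) by (simp add: g insert_commute[of i f])
    next
      assume Z: "Z = {y, w}"
      have "rN Z = 2" using N_indep[OF ZE] Z xyw(4) by simp
      then show ?thesis using Z ranks(6) by (simp add: g insert_commute[of j f])
    next
      assume Z: "Z = EN"
      have "g ` EN \<union> C = insert f (insert i (insert j C))" unfolding xyw(1) by (auto simp: g)
      then show ?thesis using Z rEN ranks(7) by simp
    next
      assume "Z = {}" then show ?thesis using N_indep[OF ZE] by simp
    next
      assume Z: "Z = {x}" then show ?thesis using N_indep[OF ZE] ranks(1) by (simp add: g)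
    next
      assume Z: "Z = {y}" then show ?thesis using N_indep[OF ZE] ranks(2) by (simp add: g)
    next
      assume Z: "Z = {w}" then show ?thesis using N_indep[OF ZE] ranks(3) by (simp add: g)
    qed
  qed
  then show ?thesis by (rule nmI) (auto simp: C_def)
qed

end

section \<open>Blocked elements, folds and wings\<close>

definition contractible :: "('a set \<Rightarrow> int) \<Rightarrow> ('b set \<Rightarrow> int) \<Rightarrow> 'b set \<Rightarrow> 'a set \<Rightarrow> bool" where
  "contractible r rN EN X \<longleftrightarrow> vert_conn r X \<and> minor_after r rN EN X"

definition good :: "('a set \<Rightarrow> int) \<Rightarrow> ('b set \<Rightarrow> int) \<Rightarrow> 'b set \<Rightarrow> 'a \<Rightarrow> bool" where
  "good r rN EN x \<longleftrightarrow> r {x} = 1 \<and> contractible r rN EN {x}"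

definition three_points :: "('a set \<Rightarrow> int) \<Rightarrow> 'a set \<Rightarrow> bool" where
  "three_points r L \<longleftrightarrow> (\<exists>a\<in>L. \<exists>b\<in>L. \<exists>c\<in>L. r {a} = 1 \<and> b \<notin> rank_closure r {a} \<and> c \<notin> rank_closure r {a} \<and> c \<notin> rank_closure r {b})"

text \<open>The cocircuits of a carambole are not part of this definition: they are recovered from the
  absence of good points.\<close>
definition filament_line :: "('a set \<Rightarrow> int) \<Rightarrow> ('b set \<Rightarrow> int) \<Rightarrow> 'b set \<Rightarrow> 'a set \<Rightarrow> bool" where
  "filament_line r rN EN L \<longleftrightarrow> flat r L \<and> r L = 2 \<and> contractible r rN EN L \<and> three_points r L \<and> (\<forall>y\<in>L. \<not> good r rN EN y)"

text \<open>Up to parallel elements, the complement of \<open>H\<close> is the cocircuit \<open>(L - y) \<union> c\<close>.\<close>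
definition wing :: "('a set \<Rightarrow> int) \<Rightarrow> 'a set \<Rightarrow> 'a \<Rightarrow> 'a \<Rightarrow> 'a set \<Rightarrow> bool" where
  "wing r L y c H \<longleftrightarrow> flat r H \<and> r H = r UNIV - 1 \<and> H \<inter> L = rank_closure r {y} \<and> c \<notin> H \<and> c \<notin> L
     \<and> (\<forall>e. e \<in> L \<or> e \<in> rank_closure r {c} \<or> e \<in> H)"

text \<open>For \<open>X \<subseteq> F\<close> this says that in \<open>M/X\<close> the set
  \<open>V\<close> is not skew to \<open>F\<close>. It is weaker than \<open>F\<close> having an
  element of \<open>V\<close> off the span of \<open>X\<close>, and it is all that the exchange of a
  member needs.\<close>

definition touched :: "('a set \<Rightarrow> int) \<Rightarrow> 'a set \<Rightarrow> 'a set \<Rightarrow> 'a set \<Rightarrow> bool" where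
  "touched r V X F \<longleftrightarrow> (\<exists>S\<subseteq>V. r (S \<union> F) - r F < r (S \<union> X) - r X)"

context matroid_rank
begin

lemma three_points_pair:
  assumes "three_points r L" "r {y} = 1"
  obtains u v where "u \<in> L" "v \<in> L" "u \<notin> cl {y}" "v \<notin> cl {y}" "v \<notin> cl {u}"
proof -
  obtain a b c where abc: "a \<in> L" "b \<in> L" "c \<in> L" "r {a} = 1" "b \<notin> cl {a}" "c \<notin> cl {a}" "c \<notin> cl {b}"
    using assms(1) by (auto simp: three_points_def)
  have n: "r {b} = 1" "r {c} = 1" using abc nonpar_nonloop by auto
  have s: "z \<notin> cl {y}" if "y \<in> cl {w}" "z \<notin> cl {w}" "r {w} = 1" for w z
    using that par_sym[OF that(1) assms(2)] cl_eqI[of "{w}" "{y}"] by auto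
  have ps: "cl {w} = cl {y}" if "w \<in> cl {y}" "r {w} = 1" for w
    using par_sym[OF that] that by (intro cl_eqI) auto
  consider "a \<in> cl {y}" | "a \<notin> cl {y}" "b \<in> cl {y}" | "a \<notin> cl {y}" "b \<notin> cl {y}" by blast
  then show ?thesis
  proof cases
    case 1 then show ?thesis using that[of b c] ps[of a] abc by auto
  next
    case 2 then show ?thesis using that[of a c] ps[of b] abc n by auto
  next
    case 3 then show ?thesis using that[of a b] abc by auto
  qed
qed

text \<open>Two of the three points are on the same side and span the line. This is how lines are
  located with respect to a separation.\<close>

lemma three_points_side:
  assumes "three_points r L" "flt L" "r L = 2" "flt A" "flt B" "\<And>e. e \<in> A \<or> e \<in> B"
  shows "L \<subseteq> A \<or> L \<subseteq> B"
proof -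
  obtain a b c where abc: "a \<in> L" "b \<in> L" "c \<in> L" "r {a} = 1" "b \<notin> cl {a}" "c \<notin> cl {a}" "c \<notin> cl {b}"
    using assms(1) by (auto simp: three_points_def)
  have n: "r {b} = 1" using abc nonpar_nonloop by auto
  have "L \<subseteq> F" if "flt F" "a \<in> F \<and> b \<in> F \<or> a \<in> F \<and> c \<in> F \<or> b \<in> F \<and> c \<in> F" for F
    using that(2) line_in_flat[OF assms(2,3) that(1)] abc n by blast
  then show ?thesis using assms(4-6) by blast
qed

lemma three_points_sides:
  assumes "three_points r L" "flt L" "r L = 2"
  shows "\<forall>A B. flt A \<and> flt B \<and> A \<union> B = UNIV \<and> X \<subseteq> A \<and> X \<subseteq> B \<longrightarrow> L \<subseteq> A \<or> L \<subseteq> B"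
  by (intro allI impI three_points_side[OF assms]) auto

lemma r_triple_flat: assumes "r {a} = 1" "b \<notin> cl {a}" "c \<notin> cl {a, b}" shows "r {a, b, c} = 3"
  using r_insert_notin[OF assms(3)] r_pair[OF assms(1,2)] by (simp add: insert_commute)

lemma touchedI: "S \<subseteq> V \<Longrightarrow> r (S \<union> F) - r F < r (S \<union> X) - r X \<Longrightarrow> touched r V X F"
  by (auto simp: touched_def)

lemma touched_element:
  assumes "v \<in> V" "v \<in> F" "v \<notin> cl X" shows "touched r V X F"
  using assms r_insert_notin[of v X] by (intro touchedI[of "{v}"]) (auto simp: insert_absorb)

text \<open>In \<open>M/X\<close> the nonloop \<open>e\<close> lies both in \<open>F\<close> and in
  the span of \<open>V\<close>, so these cannot be skew.\<close>

lemma touched_cl: assumes "e \<in> cl (V \<union> X)" "e \<in> F" "e \<notin> cl X" "X \<subseteq> F" shows "touched r V X F"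
proof (rule touchedI[of V])
  have "r (V \<union> F) + r (insert e X) \<le> r (insert e (V \<union> X)) + r F"
    by (rule submod_le) (use assms in auto)
  moreover have "r (insert e (V \<union> X)) = r (V \<union> X)" using assms by (simp add: in_cl_iff)
  moreover have "r (insert e X) = r X + 1" using r_insert_notin assms by blast
  ultimately show "r (V \<union> F) - r F < r (V \<union> X) - r X" by linarith
qed simp

text \<open>If \<open>T\<close> and \<open>X\<close> spanned all of \<open>S\<close>, then
  \<open>S\<close> would be skew to \<open>F\<close> over \<open>X\<close> just as \<open>T\<close>
  is, and would lose no rank. \<open>T\<close> will be the union of the other members of a
  family.\<close>

lemma touched_exchange:
  assumes t: "touched r V X F" and X: "X \<subseteq> F"
    and skew: "r (T \<union> F) = r (T \<union> X) + r F - r X"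
  obtains v where "v \<in> V" "v \<notin> cl (T \<union> X)"
proof -
  obtain S where S: "S \<subseteq> V" "r (S \<union> F) - r F < r (S \<union> X) - r X" using t by (auto simp: touched_def)
  have "\<not> S \<subseteq> cl (T \<union> X)"
  proof
    assume sub: "S \<subseteq> cl (T \<union> X)"
    have 1: "r (T \<union> X \<union> S) = r (T \<union> X)" by (rule r_Un_closed[OF sub])
    have "cl (T \<union> X) \<subseteq> cl (T \<union> F)" by (rule cl_mono) (use X in auto)
    then have 2: "r (T \<union> F \<union> S) = r (T \<union> F)" using sub by (intro r_Un_closed) auto
    have "r (T \<union> F \<union> S) + r (S \<union> X) \<le> r (T \<union> X \<union> S) + r (S \<union> F)"
      by (rule submod_le) (use X in auto)
    then show False using 1 2 S skew by linarith
  qed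
  then show ?thesis using that S by auto
qed

end

locale conn_minor = matroid_minor +
  assumes vc0: "vert_conn r {}"
begin

abbreviation "is_contractible \<equiv> contractible r rN EN"
abbreviation "is_good \<equiv> good r rN EN"
abbreviation "is_filament \<equiv> filament_line r rN EN"

lemma ctr_conn: "vert_conn r X \<Longrightarrow> conn_minor (contract_rank r X) E rN EN"
  using ctr_minor[of X] vc_ctr[of X "{}"] by (simp add: conn_minor_def conn_minor_axioms_def)

lemma con_ctr: "contractible (contract_rank r X) rN EN Y \<longleftrightarrow> is_contractible (X \<union> Y)"
  by (simp add: contractible_def vc_ctr nm_ctr)

lemma con_cong: "cl X = cl Y \<Longrightarrow> is_contractible X \<longleftrightarrow> is_contractible Y"
  using vc_cong nm_cong unfolding contractible_def by blast

text \<open>Most contradictions below end here: one side of a separation is cut down while the cover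
  persists, until the ranks sum to at most \<open>r UNIV + 1\<close>.\<close>

lemma cover0:
  assumes "\<And>e. e \<in> A \<or> e \<in> B" "r A < r UNIV" "r B < r UNIV"
  shows "r UNIV + 2 \<le> r A + r B"
  using vcD[OF vc0 assms(1)] assms by (simp add: r_empty)

lemma good_par: assumes "is_good a" "b \<in> cl {a}" "r {b} = 1" shows "is_good b"
proof -
  have "cl {a} = cl {b}" using par_sym[OF assms(2,3)] assms(2) by (intro cl_eqI) auto
  then show ?thesis using con_cong assms unfolding good_def by blast
qed

text \<open>The sum of the ranks is exact: the failure at \<open>y\<close> bounds it from above, the
  connectivity of \<open>M\<close> itself from below.\<close>

lemma sep_choose:
  assumes "\<not> vert_conn r {y}" "r {y} = 1"
    and Q: "\<forall>A B. flt A \<and> flt B \<and> A \<union> B = UNIV \<and> {y} \<subseteq> A \<and> {y} \<subseteq> B \<longrightarrow> Q A \<or> Q B"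
  obtains A B where "flt A" "flt B" "\<And>e. e \<in> A \<or> e \<in> B" "y \<in> A" "y \<in> B" "r A < r UNIV" "r B < r UNIV"
    "r A + r B = r UNIV + 2" "Q A"
proof -
  obtain A B where AB: "flt A" "flt B" "\<And>e. e \<in> A \<or> e \<in> B" "{y} \<subseteq> A" "{y} \<subseteq> B" "r A < r UNIV" "r B < r UNIV"
    "r A + r B \<le> r UNIV + r {y} + 1" "Q A"
    by (rule not_vc_choose[OF assms(1) Q]) blast
  show ?thesis by (rule that[OF AB(1-3)]) (use AB cover0[OF AB(3)] assms in auto)
qed

lemma sep_at:
  assumes "\<not> vert_conn r {y}" "r {y} = 1"
  obtains A B where "flt A" "flt B" "\<And>e. e \<in> A \<or> e \<in> B" "y \<in> A" "y \<in> B" "r A < r UNIV" "r B < r UNIV"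
    "r A + r B = r UNIV + 2"
  by (rule sep_choose[OF assms, where Q = "\<lambda>_. True"]) auto

text \<open>The separation at \<open>y\<close> must not survive the contraction of \<open>x\<close>.
  So \<open>x\<close> is on one side \<open>A\<close> only, and adding it to \<open>B\<close> must
  make \<open>B\<close> spanning; hence \<open>B\<close> is a hyperplane and \<open>A\<close> a
  plane.\<close>

lemma fold_from_pair:
  assumes y: "\<not> vert_conn r {y}" "r {y} = 1" and xy: "vert_conn r {x, y}" "x \<notin> cl {y}"
  obtains P H where "fold_at r P H y" "x \<in> P" "x \<notin> H"
proof -
  obtain A B where A: "flt A" "flt B" "\<And>e. e \<in> A \<or> e \<in> B" "y \<in> A" "y \<in> B" "r A < r UNIV" "r B < r UNIV"
    "r A + r B = r UNIV + 2" "x \<in> A" by (rule sep_choose[OF y, where Q = "\<lambda>A. x \<in> A"]) blast+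
  have r2: "r {x, y} = 2" using r_pair[OF y(2) xy(2)] by (simp add: insert_commute)
  have xB: "x \<notin> B" using vcD[OF xy(1) A(3)] A r2 by auto
  have rx: "r (insert x B) = r B + 1" using flat_insert[OF A(2) xB] .
  have cov: "e \<in> A \<or> e \<in> insert x B" for e using A(3)[of e] by auto
  have "\<not> r (insert x B) < r UNIV" using vcD[OF xy(1) cov] A r2 rx by auto
  then have "r B = r UNIV - 1" using rx A(7) by linarith
  then show ?thesis using that[of A B] A xB y unfolding fold_at_def by auto
qed

section \<open>The plane of a fold\<close>

lemma fold_cover: "fold_at r P H y \<Longrightarrow> e \<in> P \<or> e \<in> H"
  unfolding fold_at_def by auto

text \<open>In a separation at \<open>c\<close>, two of \<open>u\<close>, \<open>v\<close>,
  \<open>w\<close> are on the same side, which then contains \<open>P\<close>. The other side can be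
  intersected with \<open>H\<close> and loses \<open>c\<close>, hence rank.\<close>

lemma three_lines:
  assumes f: "fold_at r P H y" and c: "c \<in> P" "c \<notin> H" and uvw: "u \<in> P" "v \<in> P" "w \<in> P"
    and r3: "r {c, u, v} = 3" "r {c, u, w} = 3" "r {c, v, w} = 3"
  shows "vert_conn r {c}"
proof (rule ccontr)
  assume nvc: "\<not> vert_conn r {c}"
  have F: "flt P" "flt H" "r P = 3" using f by (auto simp: fold_at_def)
  have c1: "r {c} = 1" using notin_flat_nonloop[OF F(2) c(2)] .
  have PF: "P \<subseteq> F'" if "flt F'" "c \<in> F'" "u \<in> F' \<and> v \<in> F' \<or> u \<in> F' \<and> w \<in> F' \<or> v \<in> F' \<and> w \<in> F'" for F'
  proof -
    have "cl {c, u, v} = P" "cl {c, u, w} = P" "cl {c, v, w} = P"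
      using F uvw c r3 flat_spanned[OF F(1), of "{c, u, v}"] flat_spanned[OF F(1), of "{c, u, w}"]
        flat_spanned[OF F(1), of "{c, v, w}"] by simp_all
    then show ?thesis using that cl_least[OF _ that(1), of "{c, u, v}"] cl_least[OF _ that(1), of "{c, u, w}"]
        cl_least[OF _ that(1), of "{c, v, w}"] by auto
  qed
  have side: "\<forall>A B. flt A \<and> flt B \<and> A \<union> B = UNIV \<and> {c} \<subseteq> A \<and> {c} \<subseteq> B \<longrightarrow> P \<subseteq> A \<or> P \<subseteq> B"
  proof (intro allI impI)
    fix A B assume AB: "flt A \<and> flt B \<and> A \<union> B = UNIV \<and> {c} \<subseteq> A \<and> {c} \<subseteq> B"
    then have "u \<in> A \<or> u \<in> B" "v \<in> A \<or> v \<in> B" "w \<in> A \<or> w \<in> B" by auto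
    then show "P \<subseteq> A \<or> P \<subseteq> B" using PF[of A] PF[of B] AB by auto
  qed
  obtain A B where A: "flt A" "flt B" "\<And>e. e \<in> A \<or> e \<in> B" "c \<in> A" "c \<in> B" "r A < r UNIV" "r B < r UNIV"
    "r A + r B = r UNIV + 2" "P \<subseteq> A"
    by (rule sep_choose[OF nvc c1 side]) blast
  have lt: "r (B \<inter> H) < r B" using c A by (intro flat_psubset F) auto
  have cov: "e \<in> A \<or> e \<in> B \<inter> H" for e using A(3)[of e] A(9) fold_cover[OF f, of e] by auto
  show False using cover0[OF cov] lt A by auto
qed

lemma bad_two_lines:
  assumes "fold_at r P H y" "c \<in> P" "c \<notin> H" "u \<in> P" "v \<in> P" "w \<in> P" "\<not> vert_conn r {c}"
  shows "r {c, u, v} \<le> 2 \<or> r {c, u, w} \<le> 2 \<or> r {c, v, w} \<le> 2"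
  using three_lines[OF assms(1-6)] assms(7) r_triple_le[of c u v] r_triple_le[of c u w] r_triple_le[of c v w]
  by force

lemma fold_rank: assumes "fold_at r P H y" shows "r (P - H) = 3"
proof (rule ccontr)
  assume n: "r (P - H) \<noteq> 3"
  have F: "r P = 3" "r H = r UNIV - 1" "r UNIV \<ge> 4" using assms by (auto simp: fold_at_def)
  have "r (P - H) \<le> 3" using r_mono[of "P - H" P] F by auto
  then have lt: "r (P - H) \<le> 2" using n by auto
  have cov: "e \<in> P - H \<or> e \<in> H" for e using fold_cover[OF assms, of e] by auto
  show False using cover0[OF cov] lt F by auto
qed

text \<open>Two points \<open>c\<close>, \<open>d\<close> of \<open>P\<close> off the line
  \<open>ab\<close> must be parallel: otherwise the badness of \<open>a\<close> and of
  \<open>b\<close> would put both on the line \<open>cd\<close>. As \<open>y\<close> is in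
  \<open>H\<close> and \<open>c\<close> is not, \<open>y\<close> is on the line \<open>ab\<close>,
  and the lines from \<open>c\<close> to \<open>a\<close>, \<open>b\<close> and \<open>y\<close>
  show that \<open>c\<close> is not blocked.\<close>

lemma fold_struct:
  assumes f: "fold_at r P H y" and a: "a \<in> P" "a \<notin> H" and b: "b \<in> P" "b \<notin> H" and ab: "b \<notin> cl {a}"
    and bad: "\<not> vert_conn r {a}" "\<not> vert_conn r {b}"
  obtains c where "c \<in> P" "c \<notin> H" "vert_conn r {c}" "c \<notin> cl {a, b}" "y \<in> cl {a, b}"
    "P = cl {a, b} \<union> cl {c}" "P \<inter> H = cl {y}" "cl {a, b} \<inter> H = cl {y}"
proof -
  have F: "flt P" "flt H" "r P = 3" "y \<in> P" "y \<in> H" "r {y} = 1" using f by (auto simp: fold_at_def)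
  have n: "r {a} = 1" "r {b} = 1" using notin_flat_nonloop F a b by blast+
  have rab: "r {a, b} = 2" using r_pair[OF n(1) ab] .
  let ?L = "cl {a, b}"
  have LP: "?L \<subseteq> P" using a b F by (intro cl_least) auto
  have "\<not> P - H \<subseteq> ?L" using r_mono[of "P - H" ?L] fold_rank[OF f] rab by auto
  then obtain c where c: "c \<in> P" "c \<notin> H" "c \<notin> ?L" by auto
  have nc: "r {c} = 1" using notin_flat_nonloop F c by blast
  have abd: "r {a, b, d} = 3" if "d \<notin> ?L" for d using r_triple_flat[OF n(1) ab that] .
  have par: "d \<in> cl {c}" if d: "d \<in> P" "d \<notin> ?L" for d
  proof (rule ccontr)
    assume nd: "d \<notin> cl {c}"
    have "r {a, c, d} \<le> 2" using bad_two_lines[OF f a b(1) c(1) d(1) bad(1)] abd[OF c(3)] abd[OF d(2)] by auto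
    moreover have "r {b, c, d} \<le> 2"
      using bad_two_lines[OF f b a(1) c(1) d(1) bad(2)] abd[OF c(3)] abd[OF d(2)] by (auto simp: insert_commute)
    moreover have "r {c, d} = 2" using r_pair[OF nc nd] .
    ultimately have "{a, c, d} \<subseteq> cl {c, d}" "{b, c, d} \<subseteq> cl {c, d}"
      using subset_cl_if_rank[of "{c, d}" "{a, c, d}"] subset_cl_if_rank[of "{c, d}" "{b, c, d}"] by auto
    then have "r {a, b, c} \<le> r (cl {c, d})" by (intro r_mono) auto
    then show False using abd[OF c(3)] \<open>r {c, d} = 2\<close> by simp
  qed
  have ycn: "z \<notin> cl {c}" if "z \<in> H" "r {z} = 1" for z
    using par_flat[OF F(2) _ that(2,1), of c] c by auto
  have y: "y \<in> ?L" using par[of y] ycn[of y] F by auto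
  have nH: "\<not> ?L \<subseteq> H" using a subset_cl[of "{a, b}"] by auto
  have LH: "?L \<inter> H = cl {y}" using line_meet[OF flat_cl _ F(2) nH y F(5,6)] rab by simp
  have PL: "P = ?L \<union> cl {c}" using par LP cl_least[of "{c}" P] c F by auto
  have "P \<inter> H \<subseteq> cl {y}"
  proof
    fix e assume e: "e \<in> P \<inter> H"
    show "e \<in> cl {y}"
    proof (cases "e \<in> ?L")
      case True then show ?thesis using LH e by auto
    next
      case False
      then have "e \<in> cl {c}" using par e by auto
      then have "r {e} \<noteq> 1" using ycn[of e] e by auto
      then have "r {e} = 0" using r_single_le[of e] r_nonneg[of "{e}"] by linarith
      then show ?thesis by (rule loop_in_flat[OF flat_cl])
    qed
  qed
  then have PH: "P \<inter> H = cl {y}" using LH LP by auto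
  have "r {a, y} = 2" using r_pair[OF F(6), of a] par_sym[of a y] a cl_least[of "{y}" H] F
    by (auto simp: insert_commute)
  then have Lay: "cl {a, y} = ?L" "cl {b, y} = ?L"
  proof -
    have "a \<notin> cl {y}" "b \<notin> cl {y}" using a b cl_least[of "{y}" H] F by auto
    then show "cl {a, y} = ?L" "cl {b, y} = ?L"
      using line_span[OF flat_cl _ y _ F(6), of a] line_span[OF flat_cl _ y _ F(6), of b] rab subset_cl[of "{a, b}"]
      by (auto simp: insert_commute)
  qed
  have r3: "r {c, a, b} = 3" "r {c, a, y} = 3" "r {c, b, y} = 3"
    using r_insert_notin[of c "{a, b}"] r_insert_notin[of c "{a, y}"] r_insert_notin[of c "{b, y}"]
      c Lay r_cl[of "{a, y}"] r_cl[of "{b, y}"] rab by auto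
  have "vert_conn r {c}" by (rule three_lines[OF f c(1,2) a(1) b(1) F(4) r3])
  then show ?thesis using that c y PL PH LH by blast
qed

lemma fold_good: assumes f: "fold_at r P H y" obtains c where "c \<in> P" "c \<notin> H" "vert_conn r {c}"
proof -
  obtain a b where ab: "a \<in> P - H" "b \<in> P - H" "r {a} = 1" "b \<notin> cl {a}"
    using rank_two_points[of "P - H"] fold_rank[OF f] by auto
  show ?thesis
  proof (cases "vert_conn r {a} \<or> vert_conn r {b}")
    case True then show ?thesis using that ab by auto
  next
    case False then show ?thesis using fold_struct[OF f _ _ _ _ ab(4)] ab that by (metis DiffE)
  qed
qed

text \<open>A separation blocking \<open>{a, y}\<close> has \<open>P\<close> on one side. On the
  other side, intersecting with \<open>H\<close> drops \<open>a\<close> and lowers the rank, which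
  makes room for \<open>x\<close>; the result blocks \<open>{x, y}\<close>.\<close>

lemma vc_transfer:
  assumes f: "fold_at r P H y" and x: "x \<in> P" "x \<notin> H" and a: "a \<in> P" "a \<notin> H" and v: "vert_conn r {x, y}"
  shows "vert_conn r {a, y}"
proof (rule ccontr)
  assume nv: "\<not> vert_conn r {a, y}"
  have F: "flt P" "flt H" "r P = 3" "y \<in> P" "y \<in> H" "r {y} = 1" using f by (auto simp: fold_at_def)
  have z: "z \<notin> cl {y}" if "z \<notin> H" for z using cl_least[of "{y}" H] F that by auto
  have r2: "r {x, y} = 2" "r {a, y} = 2"
    using r_pair[OF F(6) z[OF x(2)]] r_pair[OF F(6) z[OF a(2)]] by (auto simp: insert_commute)
  have ay: "P \<inter> F' \<subseteq> cl {a, y}" if "flt F'" "{a, y} \<subseteq> F'" "\<not> P \<subseteq> F'" for F'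
  proof (rule subset_cl_if_rank)
    show "{a, y} \<subseteq> P \<inter> F'" using a F that by auto
    show "r (P \<inter> F') \<le> r {a, y}" using flat_psubset[OF F(1) that(1,3)] F r2 by auto
  qed
  have nP: "\<not> P \<subseteq> cl {a, y}" using r_mono[of P "cl {a, y}"] F r2 by auto
  have side: "\<forall>A B. flt A \<and> flt B \<and> A \<union> B = UNIV \<and> {a, y} \<subseteq> A \<and> {a, y} \<subseteq> B \<longrightarrow> P \<subseteq> A \<or> P \<subseteq> B"
    using ay nP by blast
  obtain A B where A: "flt A" "flt B" "\<And>e. e \<in> A \<or> e \<in> B" "{a, y} \<subseteq> A" "{a, y} \<subseteq> B" "r A < r UNIV" "r B < r UNIV"
    "r A + r B \<le> r UNIV + r {a, y} + 1" "P \<subseteq> A"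
    by (rule not_vc_choose[OF nv side]) blast
  show False
  proof (cases "P \<subseteq> B")
    case True then show False using vcD[OF v A(3)] A r2 x F by auto
  next
    case False
    have lt: "r (B \<inter> H) < r B" using a A by (intro flat_psubset F) auto
    have rB: "r (insert x (B \<inter> H)) \<le> r B" using r_insert_le[of x "B \<inter> H"] lt by auto
    have cov: "e \<in> A \<or> e \<in> insert x (B \<inter> H)" for e using A(3)[of e] A(9) fold_cover[OF f, of e] by auto
    have "r UNIV + r {x, y} + 2 \<le> r A + r (insert x (B \<inter> H))"
      using A x F rB by (intro vcD[OF v cov]) auto
    then show False using A r2 rB by linarith
  qed
qed

text \<open>The plane \<open>P\<close> has rank just one more than \<open>{x, y}\<close>, as
  \<open>nm_transfer\<close> requires.\<close>

lemma fold_nm: assumes f: "fold_at r P H y" and x: "x \<in> P" "x \<notin> H" and a: "a \<in> P" "a \<notin> H" and v: "is_minor_after {x, y}"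
  shows "is_minor_after {a, y}"
proof -
  have F: "flt P" "flt H" "r P = 3" "y \<in> P" "y \<in> H" "r {y} = 1" "r H = r UNIV - 1" "4 \<le> r UNIV"
    using f by (auto simp: fold_at_def)
  have "x \<notin> cl {y}" using cl_least[of "{y}" H] F x by auto
  then have "r {x, y} = 2" using r_pair[OF F(6)] by (auto simp: insert_commute)
  moreover have "P \<union> {x, y} = P" using x F by auto
  ultimately have "is_minor_after {y, a}"
    using F a fold_cover[OF f] by (intro nm_transfer[OF v, of y P H a]) auto
  then show ?thesis by (simp add: insert_commute)
qed

lemma fold_con: "fold_at r P H y \<Longrightarrow> x \<in> P \<Longrightarrow> x \<notin> H \<Longrightarrow> a \<in> P \<Longrightarrow> a \<notin> H \<Longrightarrow> is_contractible {x, y} \<Longrightarrow> is_contractible {a, y}"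
  using vc_transfer fold_nm unfolding contractible_def by blast

section \<open>Wings at the points of a line\<close>

lemma wing_sub:
  assumes w: "wing r L y c H" and A: "flt A" "c \<notin> A" "e \<in> A" "e \<notin> L" shows "e \<in> H"
proof (rule ccontr)
  assume eH: "e \<notin> H"
  then have "e \<in> cl {c}" "r {e} = 1" using w A notin_flat_nonloop unfolding wing_def by blast+
  then show False using par_flat[OF A(1), of e c] A by auto
qed

lemma wing_cover: "wing r L y c H \<Longrightarrow> e \<in> L \<or> e \<in> cl {c} \<or> e \<in> H"
  unfolding wing_def by auto

lemma wing_point: "wing r L y c H \<Longrightarrow> y \<in> H \<and> y \<in> L"
  using in_cl_self[of y "{y}"] unfolding wing_def by auto

text \<open>Otherwise both tips lie in the plane spanned by \<open>L\<close> and \<open>c\<close>,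
  and this plane covers everything together with \<open>H \<inter> H'\<close>, which has rank at
  most \<open>r UNIV - 2\<close>.\<close>

lemma wing_distinct:
  assumes L: "flt L" "r L = 2" and w: "wing r L y c H" "wing r L y' c' H'" and y: "y \<notin> cl {y'}" and R: "4 \<le> r UNIV"
  shows "r (L \<union> {c, c'}) = 4"
proof (rule ccontr)
  assume n: "r (L \<union> {c, c'}) \<noteq> 4"
  let ?P = "cl (insert c L)"
  have rP: "r ?P = 3" using flat_insert[OF L(1), of c] w L by (auto simp: wing_def)
  have "r (insert c' (insert c L)) \<noteq> r (insert c L) + 1" using n rP by (auto simp: insert_commute)
  then have c': "c' \<in> ?P" using r_insert_notin by blast
  have sub: "cl {c} \<subseteq> ?P" "cl {c'} \<subseteq> ?P" "L \<subseteq> ?P"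
    using c' cl_mono[of "{c}" "insert c L"] cl_least[of "{c'}" ?P] subset_cl[of "insert c L"] by auto
  have cov: "e \<in> ?P \<or> e \<in> H \<inter> H'" for e
    using wing_cover[OF w(1), of e] wing_cover[OF w(2), of e] sub by auto
  have "\<not> H \<subseteq> H'" using wing_point[OF w(1)] y w(2) unfolding wing_def by auto
  then have "r (H \<inter> H') < r H" using w by (intro flat_psubset) (auto simp: wing_def)
  then show False using cover0[OF cov] rP R w by (auto simp: wing_def)
qed

text \<open>The point \<open>y'\<close> is lost on passing to \<open>H\<close>, and \<open>y\<close>
  on passing further to \<open>H'\<close>; each costs a dimension.\<close>

lemma wing_meet:
  assumes L: "flt A" "L \<subseteq> A" and w: "wing r L y c H" "wing r L y' c' H'"
    and y: "y \<notin> cl {y'}" "r {y'} = 1"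
  shows "r (A \<inter> H \<inter> H') \<le> r A - 2"
proof -
  have H: "flt H" "flt H'" using w by (auto simp: wing_def)
  have "y' \<notin> H" using par_sym[of y' y] y w(1) wing_point[OF w(2)] unfolding wing_def by blast
  then have "r (A \<inter> H) < r A" using wing_point[OF w(2)] L H by (intro flat_psubset) auto
  moreover have "y \<notin> H'" using y w(2) wing_point[OF w(1)] unfolding wing_def by blast
  then have "r (A \<inter> H \<inter> H') < r (A \<inter> H)"
    using wing_point[OF w(1)] L H by (intro flat_psubset flat_Int) auto
  ultimately show ?thesis by linarith
qed

text \<open>A flat that misses both tips lies in both hyperplanes apart from \<open>L\<close>. So
  all of \<open>A\<close> but \<open>L\<close> can be given to \<open>B\<close>, which stays
  non-spanning by \<open>wing_meet\<close>, and \<open>L\<close> is too small to complete the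
  cover.\<close>

lemma two_wings_out:
  assumes L: "r L = 2" and A: "flt A" "L \<subseteq> A" "\<And>e. e \<in> A \<or> e \<in> B" and w: "wing r L y c H" "wing r L y' c' H'"
    and y: "y \<notin> cl {y'}" "r {y'} = 1" and c: "c \<notin> A" "c' \<notin> A" and Y: "Y \<subseteq> A \<inter> H \<inter> H'" "Y \<subseteq> B"
    and sum: "r A + r B \<le> r UNIV + r Y + 1" and R: "4 \<le> r UNIV"
  shows False
proof -
  let ?Q = "A \<inter> H \<inter> H'"
  have "r (B \<union> ?Q) + r Y \<le> r B + r ?Q" by (rule submod_le) (use Y in auto)
  then have lt: "r (B \<union> ?Q) \<le> r UNIV - 1" using wing_meet[OF A(1,2) w y] sum by linarith
  have cov: "e \<in> L \<or> e \<in> B \<union> ?Q" for e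
    using A(3)[of e] wing_sub[OF w(1) A(1) c(1), of e] wing_sub[OF w(2) A(1) c(2), of e] by auto
  show False using cover0[OF cov] lt L R by auto
qed

end

section \<open>Existence of good elements\<close>

context conn_minor
begin

text \<open>This recovers the cocircuits of a carambole. All points of \<open>L\<close> are blocked,
  so there is a fold at \<open>y\<close>, and \<open>fold_struct\<close> for two other points of
  \<open>L\<close> shows that its plane is \<open>L\<close> with one further point.\<close>

lemma fil_wing:
  assumes L: "is_filament L" and y: "y \<in> L" "r {y} = 1"
  obtains c H where "wing r L y c H" "is_good c" "4 \<le> r UNIV" "cl (insert c L) = L \<union> cl {c}"
proof -
  have L': "flt L" "r L = 2" "is_contractible L" "three_points r L" "\<And>y. y \<in> L \<Longrightarrow> \<not> is_good y"
    using L by (auto simp: filament_line_def)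
  obtain u v where uv: "u \<in> L" "v \<in> L" "u \<notin> cl {y}" "v \<notin> cl {y}" "v \<notin> cl {u}"
    using three_points_pair[OF L'(4) y(2)] by blast
  have n: "r {u} = 1" "r {v} = 1" using uv nonpar_nonloop by blast+
  have Lspan: "cl {y, u} = L" "cl {u, v} = L"
    using line_span[OF L'(1,2)] y uv n by blast+
  have contractible: "is_contractible {u, y}"
    using con_cong[of "{u, y}" L] Lspan L'(1,3) by (simp add: insert_commute flat_def)
  have nmz: "is_minor_after {z}" if "z \<in> L" for z using nm_mono[of L "{z}"] L'(3) that by (auto simp: contractible_def)
  have bad: "\<not> vert_conn r {z}" if "z \<in> L" "r {z} = 1" for z
    using L'(5)[OF that(1)] nmz[OF that(1)] that(2) by (auto simp: good_def contractible_def)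
  obtain P H where f: "fold_at r P H y" "u \<in> P" "u \<notin> H"
    using fold_from_pair[OF bad[OF y] y(2), of u] contractible uv by (auto simp: contractible_def)
  have F: "flt P" "flt H" "r P = 3" "y \<in> P" "y \<in> H" "r H = r UNIV - 1" "4 \<le> r UNIV"
    using f(1) by (auto simp: fold_at_def)
  have LP: "L \<subseteq> P" using line_in_flat[OF L'(1,2) F(1) y(1) uv(1) y(2) uv(3) F(4) f(2)] .
  have vH: "v \<notin> H"
    using line_in_flat[OF L'(1,2) F(2) y(1) uv(2) y(2) uv(4) F(5)] uv(1) f(3) by auto
  obtain c where c: "c \<in> P" "c \<notin> H" "vert_conn r {c}" "c \<notin> L" "P = L \<union> cl {c}" "P \<inter> H = cl {y}" "L \<inter> H = cl {y}"
    using fold_struct[OF f(1) f(2,3) _ vH uv(5) bad[OF uv(1) n(1)] bad[OF uv(2) n(2)]] LP uv Lspan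
    by (metis subsetD)
  have "is_minor_after {c, y}" using fold_nm[OF f c(1,2)] contractible by (simp add: contractible_def)
  then have "is_good c"
    using c nm_mono[of "{c, y}" "{c}"] notin_flat_nonloop[OF F(2) c(2)] by (auto simp: good_def contractible_def)
  moreover have "wing r L y c H"
    unfolding wing_def using F c fold_cover[OF f(1)] by blast
  moreover have "cl (insert c L) = P"
    using flat_spanned[OF F(1), of "insert c L"] flat_insert[OF L'(1) c(4)] L'(2) F c LP by auto
  ultimately show ?thesis using that F c(5) by auto
qed

text \<open>Wings at three points of \<open>L\<close> have good tips, which lie off \<open>F\<close>
  if \<open>F\<close> is not touched; then \<open>F\<close> splits into \<open>L\<close> and its
  part \<open>Y\<close> in the three hyperplanes. If a separation blocked \<open>Y\<close>, two of
  the three tips would be both inside or both outside of its side containing \<open>L\<close>, and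
  each is impossible.\<close>

lemma fil_lift_core:
  assumes L: "is_filament L" and F: "flt F" "L \<subseteq> F" "vert_conn r F"
  shows "touched r {v. is_good v} L F \<or>
    (\<exists>Y. flt Y \<and> Y \<subseteq> F \<and> F = L \<union> Y \<and> r F = r Y + 2 \<and> vert_conn r Y)"
proof (rule ccontr)
  assume neg: "\<not> ?thesis"
  have L': "flt L" "r L = 2" "three_points r L" using L by (auto simp: filament_line_def)
  obtain a b c where abc: "a \<in> L" "b \<in> L" "c \<in> L" "r {a} = 1" "b \<notin> cl {a}" "c \<notin> cl {a}" "c \<notin> cl {b}"
    using L'(3) by (auto simp: three_points_def)
  have n: "r {b} = 1" "r {c} = 1" using abc nonpar_nonloop by blast+
  have R: "4 \<le> r UNIV" using fil_wing[OF L abc(1,4)] by blast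
  obtain ca Ha where wa: "wing r L a ca Ha" "is_good ca" using fil_wing[OF L abc(1,4)] by blast
  obtain cb Hb where wb: "wing r L b cb Hb" "is_good cb" using fil_wing[OF L abc(2) n(1)] by blast
  obtain cc Hc where wc: "wing r L c cc Hc" "is_good cc" using fil_wing[OF L abc(3) n(2)] by blast
  have out: "v \<notin> F" if "is_good v" "v \<notin> L" for v
    using touched_element[of v "{v. is_good v}" F L] neg that L' by (auto simp: flat_def)
  have cF: "ca \<notin> F" "cb \<notin> F" "cc \<notin> F" using out wa wb wc by (auto simp: wing_def)
  let ?Y = "F \<inter> Ha \<inter> Hb"
  have H: "flt Ha" "flt Hb" "flt Hc" using wa wb wc by (auto simp: wing_def)
  have FY: "F = L \<union> ?Y" using F wing_sub[OF wa(1) F(1) cF(1)] wing_sub[OF wb(1) F(1) cF(2)] by blast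
  have "r (F \<inter> Hb \<inter> Ha) \<le> r F - 2" using wing_meet[OF F(1,2) wb(1) wa(1) abc(5,4)] .
  then have Yle: "r ?Y \<le> r F - 2" by (simp add: Int_assoc Int_commute[of Hb])
  have rF: "r F = r ?Y + 2" using r_union_le[of L ?Y] FY L' Yle by simp
  have fY: "flt ?Y" using F H by (intro flat_Int)
  have Yc: "?Y \<subseteq> Hc"
  proof
    fix e assume e: "e \<in> ?Y"
    show "e \<in> Hc"
    proof (cases "e \<in> L")
      case False then show ?thesis using wing_sub[OF wc(1) F(1) cF(3)] e by auto
    next
      case True
      then have eab: "e \<in> cl {a}" "e \<in> cl {b}" using e wa wb by (auto simp: wing_def)
      have "r {e} \<noteq> 1"
      proof
        assume e1: "r {e} = 1"
        have "b \<in> cl {a}" using par_sym[OF eab(2) e1] cl_least[of "{e}" "cl {a}"] eab by auto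
        then show False using abc by simp
      qed
      then have "r {e} = 0" using r_single_le[of e] r_nonneg[of "{e}"] by linarith
      then show ?thesis by (rule loop_in_flat[OF H(3)])
    qed
  qed
  have "\<not> vert_conn r ?Y" using neg fY FY rF by blast
  then obtain A B where A: "flt A" "flt B" "\<And>e. e \<in> A \<or> e \<in> B" "?Y \<subseteq> A" "?Y \<subseteq> B" "r A < r UNIV" "r B < r UNIV"
    "r A + r B \<le> r UNIV + r ?Y + 1" "L \<subseteq> A"
    by (rule not_vc_choose[OF _ three_points_sides[OF L'(3,1,2)]]) blast
  have FA: "F \<subseteq> A" using FY A by blast
  have le: "r (B \<union> L) \<le> r B + 2" using r_union_le[of B L] L' by simp
  have cov: "e \<in> A \<or> e \<in> B \<union> L" for e using A(3)[of e] by auto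
  have "\<not> r (B \<union> L) < r UNIV"
  proof
    assume lt: "r (B \<union> L) < r UNIV"
    have "F \<subseteq> B \<union> L" using FY A by blast
    then show False using vcD[OF F(3) cov FA _ A(6) lt] le A rF by auto
  qed
  \<comment> \<open>So \<open>A\<close> exceeds \<open>F\<close> by at most one dimension, whereas
    two tips in \<open>A\<close> add two over \<open>L\<close>: they would touch
    \<open>F\<close>.\<close>
  then have rA: "r A \<le> r F + 1" using le A rF by linarith
  have two_in: False if w: "wing r L p v H" "wing r L p' v' H'" "p \<notin> cl {p'}" "is_good v" "is_good v'" "v \<in> A" "v' \<in> A"
    for p v H p' v' H'
  proof -
    have "r (L \<union> {v, v'}) = 4" by (rule wing_distinct[OF L'(1,2) w(1-3) R])
    moreover have "r ({v, v'} \<union> F) \<le> r A" using FA w by (intro r_mono) auto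
    ultimately have "touched r {v. is_good v} L F"
      using w rA L' by (intro touchedI[of "{v, v'}"]) (auto simp: Un_commute)
    then show False using neg by blast
  qed
  have two_out: False if w: "wing r L p v H" "wing r L p' v' H'" "p \<notin> cl {p'}" "r {p'} = 1" "v \<notin> A" "v' \<notin> A"
    "?Y \<subseteq> H" "?Y \<subseteq> H'" for p v H p' v' H'
    by (rule two_wings_out[OF L'(2) A(1,9,3) w(1-6), of ?Y]) (use w A R in auto)
  show False
    using two_in[OF wb(1) wa(1) abc(5) wb(2) wa(2)] two_in[OF wc(1) wa(1) abc(6) wc(2) wa(2)]
      two_in[OF wc(1) wb(1) abc(7) wc(2) wb(2)] two_out[OF wb(1) wa(1) abc(5,4)]
      two_out[OF wc(1) wa(1) abc(6,4)] two_out[OF wc(1) wb(1) abc(7) n(1)] Yc by blast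
qed

text \<open>If \<open>C\<close> has only loops, \<open>N\<close> is a restriction of smaller rank
  than \<open>M\<close>, and an element off its span can be contracted without changing it.\<close>

lemma exists_nm: assumes n0: "is_minor_after {}" and k: "rN EN + 1 \<le> r UNIV" obtains x where "r {x} = 1" "is_minor_after {x}"
proof -
  obtain C g where em: "is_embedding C g" using n0 by (auto simp: minor_after_def)
  show ?thesis
  proof (cases "\<exists>x\<in>C. r {x} = 1")
    case True
    then obtain x where "x \<in> C" "r {x} = 1" by auto
    then show ?thesis using that nmI[OF em, of "{x}"] by auto
  next
    case False
    have "C \<subseteq> cl {}"
    proof
      fix x assume "x \<in> C"
      then have "r {x} \<noteq> 1" using False by auto
      then have "r {x} = 0" using r_single_le[of x] r_nonneg[of "{x}"] by linarith
      then show "x \<in> cl {}" by (simp add: in_cl_iff r_empty)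
    qed
    then have rC: "r C = 0" using r_mono[of C "cl {}"] r_nonneg[of C] r_empty by auto
    have "r (g ` EN \<union> C) = rN EN" using embD[OF em, of EN] rC by simp
    then have "\<not> UNIV \<subseteq> cl (g ` EN \<union> C)" using r_mono[of UNIV "cl (g ` EN \<union> C)"] k by auto
    then obtain x where x: "x \<notin> cl (g ` EN \<union> C)" by auto
    have "is_embedding (insert x C) g" unfolding minor_embedding_def
    proof (intro allI impI)
      fix Z assume Z: "Z \<subseteq> EN"
      have "x \<notin> cl (g ` Z \<union> C)" using x cl_mono[of "g ` Z \<union> C" "g ` EN \<union> C"] Z by blast
      moreover have "x \<notin> cl C" using x cl_mono[of C "g ` EN \<union> C"] by blast
      ultimately show "r (g ` Z \<union> insert x C) = rN Z + r (insert x C)"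
        using embD[OF em Z] r_insert_notin[of x "g ` Z \<union> C"] r_insert_notin[of x C] by simp
    qed
    then have "is_minor_after {x}" by (rule nmI) auto
    then show ?thesis using that notin_flat_nonloop[OF flat_cl x] by blast
  qed
qed

text \<open>By submodularity, failure of the first alternative makes the opposite corners
  \<open>A \<union> A2\<close> and \<open>B \<inter> B2\<close> too small for a non-spanning cover.
  Then \<open>A \<union> A2\<close> spans, which leaves rank at most 1 for
  \<open>B \<inter> B2\<close>.\<close>

lemma uncross:
  assumes cov: "\<And>e. e \<in> A \<or> e \<in> B" "\<And>e. e \<in> A2 \<or> e \<in> B2"
    and sum: "r A + r B = r UNIV + 2" "r A2 + r B2 = r UNIV + 2" and B: "r B < r UNIV"
  shows "r (A \<inter> A2) + r (B \<union> B2) \<le> r UNIV + 2 \<or> r (B \<inter> B2) \<le> 1"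
proof (rule disjCI)
  assume n: "\<not> r (B \<inter> B2) \<le> 1"
  have cov1: "e \<in> A \<union> A2 \<or> e \<in> B \<inter> B2" for e using cov(1)[of e] cov(2)[of e] by auto
  have s: "r (A \<inter> A2) + r (A \<union> A2) \<le> r A + r A2" "r (B \<inter> B2) + r (B \<union> B2) \<le> r B + r B2"
    using submod[of A A2] submod[of B B2] by linarith+
  show "r (A \<inter> A2) + r (B \<union> B2) \<le> r UNIV + 2"
  proof (rule ccontr)
    assume "\<not> ?thesis"
    then have s1: "r (A \<union> A2) + r (B \<inter> B2) \<le> r UNIV + 1" using s sum by linarith
    have "r (B \<inter> B2) < r UNIV" using r_mono[of "B \<inter> B2" B] B by auto
    then have "\<not> r (A \<union> A2) < r UNIV" using cover0[OF cov1] s1 by auto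
    then show False using s1 n by linarith
  qed
qed

text \<open>Among all pairs of an element \<open>x\<close> and a separation \<open>(A, B)\<close> that blocks its contraction,
  with the minor living on \<open>B\<close>, take one minimizing the rank of \<open>A\<close>. Uncrossing it with a
  separation that blocks some \<open>a \<in> A - B\<close> forces one of the two to be a fold.\<close>
lemma exists_good:
  assumes n0: "is_minor_after {}" and k: "rN EN + 1 \<le> r UNIV"
  shows "\<exists>x. is_good x"
proof (rule ccontr)
  assume neg: "\<not> ?thesis"
  \<comment> \<open>For \<open>N\<close> with at most three elements, \<open>nm_small\<close>
    supplies the minor together with vertical connectivity, so the minor is only tracked for larger
    \<open>N\<close>.\<close>
  define W where "W = (\<lambda>x. is_minor_after {x} \<or> card EN \<le> 3)"
  have bad: "\<not> vert_conn r {x}" if "r {x} = 1" "W x" for x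
  proof
    assume v: "vert_conn r {x}"
    have "is_minor_after {x}" using that nm_small[OF _ v] k by (auto simp: W_def)
    then show False using neg v that by (auto simp: good_def contractible_def)
  qed
  define SP where "SP = (\<lambda>A. \<exists>x B. flt A \<and> flt B \<and> (\<forall>e. e \<in> A \<or> e \<in> B) \<and> x \<in> A \<and> x \<in> B \<and> r {x} = 1 \<and> r A < r UNIV
     \<and> r B < r UNIV \<and> r A + r B = r UNIV + 2 \<and> (\<forall>a\<in>A. a \<notin> B \<longrightarrow> W a))"
  have SPI: "SP A" if "flt A" "flt B" "\<And>e. e \<in> A \<or> e \<in> B" "x \<in> A" "x \<in> B" "r {x} = 1" "r A < r UNIV"
     "r B < r UNIV" "r A + r B = r UNIV + 2" "\<And>a. a \<in> A \<Longrightarrow> a \<notin> B \<Longrightarrow> W a" for A B x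
    unfolding SP_def using that by (intro exI[of _ x] exI[of _ B]) simp
  have "\<exists>A. SP A"
  proof -
    obtain x where x: "r {x} = 1" "is_minor_after {x}" using exists_nm[OF n0 k] .
    then have "\<not> vert_conn r {x}" using bad by (auto simp: W_def)
    then obtain A B where AB: "flt A" "flt B" "\<And>e. e \<in> A \<or> e \<in> B" "x \<in> A" "x \<in> B" "r A < r UNIV" "r B < r UNIV"
      "r A + r B = r UNIV + 2" using sep_at x by blast
    obtain C g where em: "{x} \<subseteq> C" "is_embedding C g" using x(2) by (auto simp: minor_after_def)
    have R3: "3 \<le> r UNIV" using AB by linarith
    have nmx: "W a" if "is_minor_after {x, a}" for a using nm_mono[OF that, of "{a}"] by (auto simp: W_def)
    have "card {e \<in> EN. g e \<notin> B} \<le> 1 \<or> card {e \<in> EN. g e \<notin> A} \<le> 1"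
      by (rule emb_sides[OF em(2,1) AB(3)]) (use AB x in auto)
    then show ?thesis
    proof
      assume c: "card {e \<in> EN. g e \<notin> B} \<le> 1"
      have "W a" if "a \<in> A" "a \<notin> B" for a
        using small_side[OF em(2) _ AB(3-5) x(1) _ c that(1) AB(2) that(2) R3] em AB nmx by simp
      then have "SP A" by (rule SPI[OF AB(1-5) x(1) AB(6-8)])
      then show ?thesis by (rule exI)
    next
      assume c: "card {e \<in> EN. g e \<notin> A} \<le> 1"
      have cov: "e \<in> B \<or> e \<in> A" for e using AB(3)[of e] by auto
      have sum: "r B + r A = r UNIV + 2" using AB by simp
      have "W a" if "a \<in> B" "a \<notin> A" for a
        using small_side[OF em(2) _ cov AB(5,4) x(1) _ c that(1) AB(1) that(2) R3] em sum nmx by simp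
      then have "SP B" by (rule SPI[OF AB(2,1) cov AB(5,4) x(1) AB(7,6) sum])
      then show ?thesis by (rule exI)
    qed
  qed
  then obtain A where A: "SP A" "\<And>A'. SP A' \<Longrightarrow> nat (r A) \<le> nat (r A')"
    using ex_has_least_nat[of SP _ "\<lambda>A. nat (r A)"] by blast
  have min: "r A \<le> r A'" if "SP A'" for A' using A(2)[OF that] r_nonneg[of A] r_nonneg[of A'] by linarith
  obtain x B where AB: "flt A" "flt B" "\<And>e. e \<in> A \<or> e \<in> B" "x \<in> A" "x \<in> B" "r {x} = 1" "r A < r UNIV" "r B < r UNIV"
      "r A + r B = r UNIV + 2" and WA: "\<And>a. a \<in> A \<Longrightarrow> a \<notin> B \<Longrightarrow> W a" using A(1) unfolding SP_def by blast
  have "B \<noteq> UNIV" using AB by auto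
  then obtain a where a: "a \<in> A" "a \<notin> B" using AB(3) by blast
  have a1: "r {a} = 1" using notin_flat_nonloop[OF AB(2) a(2)] .
  obtain A' B' where AB': "flt A'" "flt B'" "\<And>e. e \<in> A' \<or> e \<in> B'" "a \<in> A'" "a \<in> B'" "r A' < r UNIV" "r B' < r UNIV"
      "r A' + r B' = r UNIV + 2" using sep_at[OF bad[OF a1 WA[OF a]] a1] by blast
  \<comment> \<open>If both corners are large, uncrossing gives a separation at \<open>a\<close>
    with side \<open>A \<inter> A2\<close>. Minimality makes this side equal to \<open>A\<close>,
    and then the rank of \<open>B \<union> B2\<close> forces \<open>a\<close> into the flat
    \<open>B\<close>.\<close>
  have dich: "r (A \<inter> A2) \<le> 2 \<or> r (B \<inter> B2) \<le> 1"
    if 2: "flt A2" "flt B2" "\<And>e. e \<in> A2 \<or> e \<in> B2" "a \<in> A2" "a \<in> B2" "r A2 + r B2 = r UNIV + 2" for A2 B2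
  proof (rule ccontr)
    assume n: "\<not> ?thesis"
    have cov2: "e \<in> A \<inter> A2 \<or> e \<in> cl (B \<union> B2)" for e
      using AB(3)[of e] 2(3)[of e] subset_cl[of "B \<union> B2"] by auto
    have sum: "r (A \<inter> A2) + r (B \<union> B2) \<le> r UNIV + 2"
      using uncross[OF AB(3) 2(3) AB(9) 2(6) AB(8)] n by auto
    have rlt: "r (A \<inter> A2) < r UNIV" using r_mono[of "A \<inter> A2" A] AB by auto
    have "r UNIV + 2 \<le> r (A \<inter> A2) + r (cl (B \<union> B2))"
      by (rule cover0[OF cov2 rlt]) (use sum n in simp)
    then have eq: "r (A \<inter> A2) + r (cl (B \<union> B2)) = r UNIV + 2" using sum by simp
    have sub: "B \<union> B2 \<subseteq> cl (B \<union> B2)" by (rule subset_cl)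
    have "SP (A \<inter> A2)"
    proof (rule SPI[OF flat_Int[OF AB(1) 2(1)] flat_cl cov2 _ _ a1 rlt _ eq])
      show "a \<in> A \<inter> A2" using a 2 by simp
      show "a \<in> cl (B \<union> B2)" using 2 sub by blast
      show "r (cl (B \<union> B2)) < r UNIV" using eq n by linarith
      show "W e" if "e \<in> A \<inter> A2" "e \<notin> cl (B \<union> B2)" for e using WA[of e] that sub by blast
    qed
    then have "A \<inter> A2 = A" using min flat_eq[OF flat_Int[OF AB(1) 2(1)], of A] by auto
    then have "r (B \<union> B2) \<le> r B" using sum AB by simp
    moreover have "r (insert a B) \<le> r (B \<union> B2)" using 2 by (intro r_mono) auto
    ultimately show False using flat_insert[OF AB(2) a(2)] by linarith
  qed
  have rA3: "3 \<le> r A" "3 \<le> r B" using AB by linarith+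
  show False
  proof (cases "r (A \<inter> A') \<le> 2 \<and> r (A \<inter> B') \<le> 2")
    case True
    have "r A + r {a} \<le> r (A \<inter> A') + r (A \<inter> B')" by (rule submod_le) (use AB' a in auto)
    then have "r A = 3" using True a1 rA3 by linarith
    then have f: "fold_at r A B x" unfolding fold_at_def using AB by auto
    obtain c where c: "c \<in> A" "c \<notin> B" "vert_conn r {c}" using fold_good[OF f] .
    then show False using bad[OF notin_flat_nonloop[OF AB(2) c(2)]] WA by blast
  next
    case False
    then obtain A2 B2 where 2: "flt A2" "flt B2" "\<And>e. e \<in> A2 \<or> e \<in> B2" "a \<in> A2" "a \<in> B2" "r A2 + r B2 = r UNIV + 2"
      "r A2 < r UNIV" "r B2 < r UNIV" "\<not> r (A \<inter> A2) \<le> 2"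
      using AB' by (metis add.commute)
    have b1: "r (B \<inter> B2) \<le> 1" using dich[OF 2(1-6)] 2(9) by blast
    have cov': "e \<in> B2 \<or> e \<in> A2" for e using 2(3)[of e] by auto
    have "r B \<le> r (B \<inter> A2) + r (B \<inter> B2)"
    proof -
      have "B = B \<inter> A2 \<union> B \<inter> B2" using 2(3) by blast
      then show ?thesis using r_union_le[of "B \<inter> A2" "B \<inter> B2"] by simp
    qed
    then have l2: "r (A \<inter> B2) \<le> 2"
      using dich[OF 2(2,1) cov' 2(5,4)] 2(6) b1 rA3 by (simp add: add.commute)
    define l where "l = A \<inter> B2"
    have B2: "B2 \<subseteq> l \<union> (B \<inter> B2)" using AB(3) by (auto simp: l_def)
    have "r B2 \<le> r l + r (B \<inter> B2)" using r_union_le[of l "B \<inter> B2"] r_mono[OF B2] by linarith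
    then have rk: "r B2 = 3" "r l = 2" "r (B \<inter> B2) = 1" "r A2 = r UNIV - 1"
      using l2 b1 2(6,7,8) by (auto simp: l_def)
    have fl: "flt l" unfolding l_def by (rule flat_Int[OF AB(1) 2(2)])
    have f: "fold_at r B2 A2 a"
      unfolding fold_at_def using 2 rk a1 by auto
    have al: "a \<in> l" using a 2 by (auto simp: l_def)
    have "r (B2 - A2) \<le> r (l - A2) + r (B \<inter> B2)"
    proof -
      have "B2 - A2 \<subseteq> (l - A2) \<union> (B \<inter> B2)" using B2 by blast
      from r_mono[OF this] show ?thesis using r_union_le[of "l - A2" "B \<inter> B2"] by linarith
    qed
    then have "2 \<le> r (l - A2)" using fold_rank[OF f] rk by linarith
    then obtain u v where uv: "u \<in> l - A2" "v \<in> l - A2" "r {u} = 1" "v \<notin> cl {u}" by (rule rank_two_points)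
    have "\<not> B2 - A2 \<subseteq> l" using r_mono[of "B2 - A2" l] fold_rank[OF f] rk by auto
    then obtain z where z: "z \<in> B2" "z \<notin> A2" "z \<notin> l" by auto
    have zB: "z \<in> B \<inter> B2" using z B2 by auto
    have v1: "r {v} = 1" using nonpar_nonloop[OF uv(4)] .
    have una: "u \<notin> cl {a}" "v \<notin> cl {a}" using cl_least[of "{a}" A2] 2 uv by auto
    have spans: "cl {u, v} = l" "cl {a, u} = l" "cl {a, v} = l"
      using line_span[OF fl rk(2)] uv al a1 una by blast+
    have r3: "r {z, u, v} = 3" "r {z, u, a} = 3" "r {z, v, a} = 3"
      using r_insert_notin[of z "{u, v}"] r_insert_notin[of z "{u, a}"] r_insert_notin[of z "{v, a}"] z spans rk(2)
        r_cl[of "{u, v}"] r_cl[of "{a, u}"] r_cl[of "{a, v}"] by (auto simp: insert_commute)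
    have vz: "vert_conn r {z}"
      by (rule three_lines[OF f z(1,2) _ _ _ r3]) (use uv 2 in \<open>auto simp: l_def\<close>)
    have z1: "r {z} = 1" using notin_flat_nonloop[OF 2(1) z(2)] .
    have "W z"
    proof (cases "card EN \<le> 3")
      case True then show ?thesis by (simp add: W_def)
    next
      case big: False
      then obtain C g where em: "{a} \<subseteq> C" "is_embedding C g" using WA[OF a] by (auto simp: W_def minor_after_def)
      have "card {e \<in> EN. g e \<notin> A2} \<le> 1 \<or> card {e \<in> EN. g e \<notin> B2} \<le> 1"
        by (rule emb_sides[OF em(2,1) cov']) (use 2 a1 in auto)
      then show ?thesis
      proof
        assume c: "card {e \<in> EN. g e \<notin> A2} \<le> 1"
        have "is_minor_after {a, z}"
          by (rule small_side[OF em(2) _ cov' 2(5,4) a1 _ c z(1) 2(1) z(2)]) (use em 2 f in \<open>auto simp: fold_at_def\<close>)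
        then show ?thesis using nm_mono[of "{a, z}" "{z}"] by (auto simp: W_def)
      next
        assume c: "card {e \<in> EN. g e \<notin> B2} \<le> 1"
        have c1: "card {e \<in> EN. g e \<in> S} \<le> 1" if "r (S \<union> C) \<le> r C + 1" for S
        proof -
          have "r (g ` {e \<in> EN. g e \<in> S} \<union> C) \<le> r (S \<union> C)" by (rule r_mono) auto
          then show ?thesis using embD[OF em(2), of "{e \<in> EN. g e \<in> S}"] that by (intro rN_le1_card) auto
        qed
        have "r (l \<union> C) + r {a} \<le> r l + r C" by (rule submod_le) (use al em in auto)
        then have cl: "card {e \<in> EN. g e \<in> l} \<le> 1" using a1 rk by (intro c1) auto
        have cb: "card {e \<in> EN. g e \<in> B \<inter> B2} \<le> 1" using r_union_le[of "B \<inter> B2" C] rk by (intro c1) auto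
        \<comment> \<open>Each of the three parts contains at most one element of \<open>N\<close>;
          this is the origin of the bound 3 in \<open>W\<close>.\<close>
        have "EN = {e \<in> EN. g e \<notin> B2} \<union> {e \<in> EN. g e \<in> l} \<union> {e \<in> EN. g e \<in> B \<inter> B2}" using B2 by blast
        then have "card EN \<le> card {e \<in> EN. g e \<notin> B2} + card {e \<in> EN. g e \<in> l} + card {e \<in> EN. g e \<in> B \<inter> B2}"
          by (metis (no_types, lifting) card_Un_le order_trans add_le_mono1)
        then show ?thesis using c cl cb big by linarith
      qed
    qed
    then show False using bad[OF z1] vz by blast
  qed
qed

end

section \<open>Lifting filaments from a contracted point\<close>

context conn_minor
begin

lemma not_three_points:
  assumes "flt K" "r K = 2" "x \<in> K" "x' \<in> K" "r {x} = 1" "x' \<notin> cl {x}" "\<not> three_points r K"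
  shows "K \<subseteq> cl {x} \<union> cl {x'}"
  using assms unfolding three_points_def by blast

lemma con_mono_nm: "is_contractible F \<Longrightarrow> S \<subseteq> F \<Longrightarrow> is_minor_after S"
  by (auto simp: contractible_def intro: nm_mono)

text \<open>If all points of \<open>F\<close> off \<open>x\<close> are bad, the separations blocking them are of three kinds \<open>T1\<close>, \<open>T2\<close>, \<open>T3\<close>
  and force \<open>F\<close> to be a line \<open>L\<close> together with \<open>x\<close>. A separation showing that \<open>L\<close> is not contractible
  would be crossed in one of two ways by the wing at each point of \<open>L\<close>, and each way can occur only
  once.\<close>
lemma fil_lift_point:
  assumes x: "r {x} = 1" "vert_conn r {x}" and fil: "filament_line (contract_rank r {x}) rN EN F"
  shows "(\<exists>s\<in>F. s \<notin> cl {x} \<and> is_good s) \<or> (\<exists>L. is_filament L \<and> L \<subseteq> F \<and> x \<notin> L)"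
proof (rule ccontr)
  assume neg: "\<not> ?thesis"
  interpret c: conn_minor "contract_rank r {x}" E rN EN using x by (intro ctr_conn)
  have F: "flt F" "x \<in> F" using fil by (auto simp: filament_line_def flat_ctr)
  have xF: "F \<union> {x} = F" "{x} \<union> F = F" using F by auto
  have rF: "r F = 3" using fil x xF by (simp add: filament_line_def contract_rank_def)
  have conF: "is_contractible F" using fil xF by (simp add: filament_line_def con_ctr)
  have vF: "vert_conn r F" using conF by (simp add: contractible_def)
  have tp: "three_points (contract_rank r {x}) F" using fil by (simp add: filament_line_def)
  have cr: "contract_rank r {x} S = r (insert x S) - 1" for S using x by (simp add: contract_rank_def)
  have cc: "rank_closure (contract_rank r {x}) S = cl (insert x S)" for S by (simp add: clos_ctr)
  have loop: "w \<in> cl {x} \<or> r {w} = 1" for w using nonpar_nonloop[of w x] by blast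
  have bad: "\<not> vert_conn r {w}" if "w \<in> F" "w \<notin> cl {x}" for w
    using neg that conF con_mono_nm[of F "{w}"] loop[of w] by (auto simp: good_def contractible_def)
  have r2: "r {x, w} = 2" if "w \<notin> cl {x}" for w using r_pair[OF x(1) that] .
  have badc: "\<not> vert_conn r {x, w}" if "w \<in> F" "w \<notin> cl {x}" for w
  proof
    assume "vert_conn r {x, w}"
    then have "is_contractible {x, w}" using con_mono_nm[OF conF, of "{x, w}"] F that by (simp add: contractible_def)
    then have "good (contract_rank r {x}) rN EN w" using r2[OF that(2)] by (simp add: good_def con_ctr cr insert_commute)
    then show False using fil that by (simp add: filament_line_def)
  qed
  \<comment> \<open>The wings of the filament \<open>F\<close> of \<open>M/x\<close>, read in
    \<open>M\<close>: the parallel class of the tip becomes the line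
    \<open>cl {x, x'}\<close>.\<close>
  have wing_c: "\<exists>x' H. flt H \<and> x \<in> H \<and> r H = r UNIV - 1 \<and> H \<inter> F = cl {x, w} \<and> x' \<notin> H \<and> x' \<notin> F
      \<and> (\<forall>e. e \<in> F \<or> e \<in> cl {x, x'} \<or> e \<in> H) \<and> cl (insert x' F) = F \<union> cl {x, x'} \<and> 5 \<le> r UNIV"
    if w: "w \<in> F" "w \<notin> cl {x}" for w
  proof -
    have "contract_rank r {x} {w} = 1" using r2[OF w(2)] by (simp add: cr)
    then obtain x' H where x': "wing (contract_rank r {x}) F w x' H" "good (contract_rank r {x}) rN EN x'" "4 \<le> contract_rank r {x} UNIV"
      "rank_closure (contract_rank r {x}) (insert x' F) = F \<union> rank_closure (contract_rank r {x}) {x'}" by (rule c.fil_wing[OF fil w(1)])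
    have H: "flt H" "x \<in> H" using x'(1) by (auto simp: wing_def flat_ctr)
    then have "r H = r UNIV - 1" using x'(1) by (auto simp: wing_def cr insert_absorb)
    moreover have "insert x (insert x' F) = insert x' F" using F by auto
    ultimately show ?thesis using x' H by (intro exI[of _ x'] exI[of _ H]) (auto simp: wing_def cr cc)
  qed
  have span: "F \<subseteq> G" if "flt G" "x \<in> G" "w \<in> G" "u \<in> G" "w \<in> F" "u \<in> F" "w \<notin> cl {x}" "u \<notin> cl {x, w}" for G w u
  proof -
    have "r {x, w, u} = 3" using r_triple_flat[OF x(1) that(7,8)] .
    then have "cl {x, w, u} = F" using F rF that by (intro flat_spanned) auto
    then show ?thesis using cl_least[of "{x, w, u}" G] that by auto
  qed
  have Fsub: "F \<inter> G = cl {x, w}" if "flt G" "x \<in> G" "w \<in> G" "w \<in> F" "w \<notin> cl {x}" "\<not> F \<subseteq> G" for G w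
    using flat_psubset[OF F(1) that(1,6)] that F rF r2[OF that(5)]
    by (intro flat_spanned[symmetric] flat_Int) auto
  \<comment> \<open>The candidate for the filament of \<open>M\<close>. Outside the line through
    \<open>x\<close> and \<open>w\<close> it has to carry all of \<open>F\<close>.\<close>
  define Ln where "Ln = (\<lambda>w L. flt L \<and> r L = 2 \<and> L \<subseteq> F \<and> x \<notin> L \<and> w \<in> L \<and> F \<subseteq> L \<union> cl {x, w})"
  define T1 where "T1 = (\<lambda>w. \<exists>L c H. Ln w L \<and> wing r L w c H \<and> (x \<in> H \<or> c = x))"
  define T2 where "T2 = (\<lambda>w. \<exists>L P H. Ln w L \<and> fold_at r P H w \<and> x \<in> P \<and> x \<notin> H \<and> P \<inter> F = cl {x, w} \<and> L \<subseteq> H)"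
  \<comment> \<open>In this type the separation is a fold only in \<open>M/x\<close>, and the tip is
    replaced by a line \<open>K\<close> through \<open>x\<close> with at least three points.\<close>
  define T3 where "T3 = (\<lambda>w A B K. flt A \<and> flt B \<and> (\<forall>e. e \<in> A \<or> e \<in> B) \<and> w \<in> B \<and> x \<notin> B \<and> r A = 4
     \<and> r B = r UNIV - 2 \<and> F \<subseteq> A \<and> F \<inter> B \<subseteq> cl {x, w} \<and> A = F \<union> K \<and> flt K \<and> r K = 2 \<and> x \<in> K
     \<and> three_points r K \<and> K \<inter> F = cl {x})"
  obtain w' where w': "w' \<in> F" "w' \<notin> cl {x}"
  proof -
    have "\<not> F \<subseteq> cl {x}" using r_mono[of F "cl {x}"] rF x by auto
    then show ?thesis using that by auto
  qed
  have R5: "5 \<le> r UNIV" using wing_c[OF w'] by blast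
  have tpw: "\<exists>u v. u \<in> F \<and> v \<in> F \<and> u \<notin> cl {x, w} \<and> v \<notin> cl {x, w} \<and> v \<notin> cl {x, u} \<and> u \<notin> cl {x, v} \<and> w \<notin> cl {x, u} \<and> w \<notin> cl {x, v}"
    if w: "w \<in> F" "w \<notin> cl {x}" for w
  proof -
    have w1: "contract_rank r {x} {w} = 1" using r2[OF w(2)] by (simp add: cr)
    obtain u v where "u \<in> F" "v \<in> F" "u \<notin> rank_closure (contract_rank r {x}) {w}" "v \<notin> rank_closure (contract_rank r {x}) {w}" "v \<notin> rank_closure (contract_rank r {x}) {u}"
      by (rule c.three_points_pair[OF tp w1])
    then have uv: "u \<in> F" "v \<in> F" "u \<notin> cl {x, w}" "v \<notin> cl {x, w}" "v \<notin> cl {x, u}" by (simp_all add: cc)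
    have "contract_rank r {x} {u} = 1" "contract_rank r {x} {v} = 1"
      using c.nonpar_nonloop[of u w] c.nonpar_nonloop[of v w] uv by (auto simp: cc)
    then show ?thesis using uv c.nonpar_sym[of u w] c.nonpar_sym[of v w] c.nonpar_sym[of v u] w1
      by (intro exI[of _ u] exI[of _ v]) (auto simp: cc)
  qed
  have sub2: "z \<notin> cl {x}" if "z \<notin> cl {x, w}" for z w using that cl_mono[of "{x}" "{x, w}"] by auto
  \<comment> \<open>All points of \<open>F\<close> off \<open>cl {x}\<close> are bad, so the
    unblocked point that \<open>fold_struct\<close> provides is parallel to \<open>x\<close>, and
    \<open>x\<close> is the tip of a wing.\<close>
  have type_F: "T1 w" if f: "fold_at r F G w" and xG: "x \<notin> G" for w G
  proof -
    have "r (F - G) \<le> r (F - G - cl {x}) + r (cl {x})"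
      using r_union_le[of "F - G - cl {x}" "cl {x}"] r_mono[of "F - G" "(F - G - cl {x}) \<union> cl {x}"] by auto
    then have "2 \<le> r (F - G - cl {x})" using fold_rank[OF f] x by simp
    then obtain a b where ab: "a \<in> F - G - cl {x}" "b \<in> F - G - cl {x}" "r {a} = 1" "b \<notin> cl {a}"
      by (rule rank_two_points)
    obtain d where d: "d \<in> F" "d \<notin> G" "vert_conn r {d}" "d \<notin> cl {a, b}" "w \<in> cl {a, b}" "F = cl {a, b} \<union> cl {d}"
      "F \<inter> G = cl {w}" "cl {a, b} \<inter> G = cl {w}"
      by (rule fold_struct[OF f, of a b]) (use ab bad in auto)
    have dx: "d \<in> cl {x}" using bad d by auto
    have G: "flt G" "r G = r UNIV - 1" using f by (auto simp: fold_at_def)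
    have d1: "r {d} = 1" using notin_flat_nonloop[OF G(1) d(2)] .
    have cd: "cl {d} = cl {x}" using par_sym[OF dx d1] dx by (intro cl_eqI) auto
    have xL: "x \<notin> cl {a, b}" using dx cl_least[of "{x}" "cl {a, b}"] d(4) by auto
    have "wing r (cl {a, b}) w x G"
      unfolding wing_def using G d(8) xG xL fold_cover[OF f] d(6) cd by blast
    moreover have "Ln w (cl {a, b})"
      unfolding Ln_def using r_pair[OF ab(3,4)] d cd xL cl_mono[of "{x}" "{x, w}"] by auto
    ultimately show ?thesis unfolding T1_def by blast
  qed
  have types: "T1 w \<or> T2 w \<or> (\<exists>A B K. T3 w A B K)" if w: "w \<in> F" "w \<notin> cl {x}" for w
  proof -
    have w1: "r {w} = 1" using loop w by blast
    obtain u v where uv: "u \<in> F" "v \<in> F" "u \<notin> cl {x, w}" "v \<notin> cl {x, w}" "v \<notin> cl {x, u}" using tpw[OF w] by blast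
    have ux: "u \<notin> cl {x}" "v \<notin> cl {x}" using sub2 uv by blast+
    obtain A B where AB: "flt A" "flt B" "\<And>e. e \<in> A \<or> e \<in> B" "w \<in> A" "w \<in> B" "r A < r UNIV" "r B < r UNIV"
      "r A + r B = r UNIV + 2" "x \<in> A"
      by (rule sep_choose[OF bad[OF w] w1, where Q = "\<lambda>A. x \<in> A"]) auto
    have xB: "x \<notin> B" using vcD[OF x(2) AB(3)] AB x by auto
    have rxB: "r (insert x B) = r B + 1" by (rule flat_insert[OF AB(2) xB])
    let ?H = "cl (insert x B)"
    have BH: "insert x B \<subseteq> ?H" by (rule subset_cl)
    have covH: "e \<in> A \<or> e \<in> ?H" for e using AB(3)[of e] BH by auto
    show ?thesis
    proof (cases "r (insert x B) = r UNIV")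
      case True
      then have f: "fold_at r A B w" unfolding fold_at_def using AB rxB R5 w1 by auto
      have rA: "r A = 3" using f by (simp add: fold_at_def)
      show ?thesis
      proof (cases "F \<subseteq> A")
        case True
        then have "F = A" using flat_eq[OF F(1), of A] rA rF by auto
        then show ?thesis using type_F f xB by blast
      next
        case False
        have PF: "F \<inter> A = cl {x, w}" using Fsub[OF AB(1,9,4) w False] .
        then have uB: "u \<in> B" using AB(3)[of u] uv by auto
        have nFB: "\<not> F \<subseteq> B" using xB F by auto
        have uw: "u \<notin> cl {w}" using uv cl_mono[of "{w}" "{x, w}"] by auto
        have "2 \<le> r (F \<inter> B)" using r_pair[OF w1 uw] r_mono[of "{w, u}" "F \<inter> B"] w uv uB AB by auto
        moreover have "r (F \<inter> B) < 3" using flat_psubset[OF F(1) AB(2) nFB] rF by simp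
        ultimately have "Ln w (F \<inter> B)" unfolding Ln_def
          using flat_Int[OF F(1) AB(2)] w xB AB(3,5) PF by auto
        then show ?thesis unfolding T2_def using f AB(9) xB PF by (metis Int_commute Int_lower1)
      qed
    next
      case False
      then have lt: "r ?H < r UNIV" using r_le_UNIV[of "insert x B"] by simp
      have rH: "r ?H = r B + 1" using rxB by simp
      \<comment> \<open>The side of \<open>u\<close> decides. With \<open>u\<close> in
        \<open>A\<close>, also \<open>F\<close> is in \<open>A\<close>, and there is a fold of
        \<open>M/x\<close>; otherwise \<open>F\<close> is in the closure of \<open>B\<close> with
        \<open>x\<close>, and there is a fold of \<open>M\<close> whose plane is
        \<open>B\<close>.\<close>
      show ?thesis
      proof (cases "u \<in> A")
        case True
        have FA: "F \<subseteq> A" by (rule span[OF AB(1,9,4) True w(1) uv(1) w(2) uv(3)])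
        have nFH: "\<not> F \<subseteq> ?H" using vcD[OF vF covH FA _ AB(6) lt] rH AB rF by auto
        have uH: "u \<notin> ?H" using span[OF flat_cl _ _ _ w(1) uv(1) w(2) uv(3)] nFH BH AB(5) by auto
        have vH: "v \<notin> ?H" using span[OF flat_cl _ _ _ w(1) uv(2) w(2) uv(4)] nFH BH AB(5) by auto
        let ?G = "cl (insert u ?H)"
        have GH: "insert u ?H \<subseteq> ?G" by (rule subset_cl)
        have rG: "r ?G = r B + 2" using flat_insert[OF flat_cl uH] rH by simp
        have covG: "e \<in> A \<or> e \<in> ?G" for e using covH[of e] GH by auto
        have "F \<subseteq> ?G" using span[OF flat_cl _ _ _ w(1) uv(1) w(2) uv(3), of "insert u ?H"] GH BH AB(5) by auto
        then have "\<not> r ?G < r UNIV" using vcD[OF vF covG FA _ AB(6)] rG AB rF by auto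
        then have rAB: "r B = r UNIV - 2" "r A = 4" using rG lt rH AB by auto
        have FH: "F \<inter> ?H = cl {x, w}" by (rule Fsub) (use BH AB w nFH in auto)
        have fc: "fold_at (contract_rank r {x}) A ?H w"
          unfolding fold_at_def flat_ctr cr using AB covH rAB rH R5 r2[OF w(2)] BH
          by (auto simp: insert_absorb)
        have "v \<notin> rank_closure (contract_rank r {x}) {u}" using uv(5) unfolding cc .
        moreover have "\<not> vert_conn (contract_rank r {x}) {u}" "\<not> vert_conn (contract_rank r {x}) {v}"
          using badc[OF uv(1) ux(1)] badc[OF uv(2) ux(2)] unfolding vc_ctr by (simp_all add: insert_commute)
        ultimately obtain x' where "x' \<in> A" "x' \<notin> ?H" "vert_conn (contract_rank r {x}) {x'}" "x' \<notin> rank_closure (contract_rank r {x}) {u, v}"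
          "w \<in> rank_closure (contract_rank r {x}) {u, v}" "A = rank_closure (contract_rank r {x}) {u, v} \<union> rank_closure (contract_rank r {x}) {x'}"
          "A \<inter> ?H = rank_closure (contract_rank r {x}) {w}" "rank_closure (contract_rank r {x}) {u, v} \<inter> ?H = rank_closure (contract_rank r {x}) {w}"
          by (rule c.fold_struct[OF fc True uH subsetD[OF FA uv(2)] vH])
        then have x': "x' \<in> A" "x' \<notin> ?H" "x' \<notin> cl {x, u, v}" "A = cl {x, u, v} \<union> cl {x, x'}" by (simp_all add: cc)
        have Fs: "cl {x, u, v} = F" using F uv r_triple_flat[OF x(1) ux(1) uv(5)] rF by (intro flat_spanned) auto
        have xx: "x' \<notin> cl {x}" using x'(2) cl_mono[of "{x}" "insert x B"] by auto
        let ?K = "cl {x, x'}"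
        have K: "flt ?K" "r ?K = 2" "x \<in> ?K" "x' \<in> ?K" using r2[OF xx] subset_cl[of "{x, x'}"] by auto
        have KF: "?K \<inter> F = cl {x}" by (rule line_meet) (use K F x x' Fs in auto)
        show ?thesis
        proof (cases "three_points r ?K")
          case True
          have "T3 w A B ?K" unfolding T3_def
            using AB rAB FA FH BH x'(4) Fs K KF True xB by auto
          then show ?thesis by blast
        next
          case False
          have Ksub: "?K \<subseteq> cl {x} \<union> cl {x'}" by (rule not_three_points[OF K x(1) xx False])
          \<comment> \<open>Without a third point on the line \<open>cl {x, x'}\<close>, its points
            off \<open>cl {x}\<close> can be moved to \<open>B\<close>, which leaves
            \<open>F\<close> as the plane of a fold.\<close>
          let ?G' = "cl (insert x' B)"
          have G'B: "insert x' B \<subseteq> ?G'" by (rule subset_cl)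
          have x'G: "cl {x'} \<subseteq> ?G'" by (rule cl_mono) auto
          have xxF: "cl {x} \<subseteq> F" by (rule cl_least) (use F in auto)
          have covG': "e \<in> F \<or> e \<in> ?G'" for e
            using AB(3)[of e] x'(4) Fs Ksub x'G xxF G'B by blast
          have rG': "r ?G' \<le> r UNIV - 1" using r_insert_le[of x' B] rAB by simp
          have "r UNIV + 2 \<le> r F + r ?G'" by (rule cover0[OF covG']) (use rF R5 rG' in auto)
          then have "r ?G' = r UNIV - 1" using rG' rF by linarith
          then have "fold_at r F ?G' w" unfolding fold_at_def using F covG' rF R5 w w1 G'B AB(5) by auto
          moreover have "x \<notin> ?G'" using exchange[of x x' B] x'(2) xB AB(2) by (auto simp: flat_def)
          ultimately show ?thesis using type_F by blast
        qed
      next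
        case False
        then have uB: "u \<in> B" using AB(3)[of u] by auto
        have FH: "F \<subseteq> ?H" by (rule span[OF flat_cl _ _ _ w(1) uv(1) w(2) uv(3)]) (use BH AB uB in auto)
        let ?A = "cl (insert u A)"
        have AA: "insert u A \<subseteq> ?A" by (rule subset_cl)
        have rA: "r ?A = r A + 1" using flat_insert[OF AB(1) False] by simp
        have FA: "F \<subseteq> ?A" by (rule span[OF flat_cl _ _ _ w(1) uv(1) w(2) uv(3)]) (use AA AB in auto)
        have cov: "e \<in> ?A \<or> e \<in> ?H" for e using covH[of e] AA by auto
        have "\<not> r ?A < r UNIV" using vcD[OF vF cov FA FH _ lt] rA rH AB rF by auto
        then have rAB: "r A = r UNIV - 1" "r B = 3" using rA AB by auto
        have f: "fold_at r B A w" unfolding fold_at_def using AB rAB R5 w1 by auto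
        have nFA: "\<not> F \<subseteq> A" using False uv by auto
        have FA2: "F \<inter> A = cl {x, w}" using Fsub[OF AB(1,9,4) w nFA] .
        have eB: "e \<in> B \<and> e \<notin> A" if "e \<in> F" "e \<notin> cl {x, w}" for e using that FA2 AB(3)[of e] by auto
        have u1: "r {u} = 1" using loop ux by blast
        have vu: "v \<notin> cl {u}" using uv(5) cl_mono[of "{u}" "{x, u}"] by auto
        obtain d where d: "d \<in> B" "d \<notin> A" "vert_conn r {d}" "d \<notin> cl {u, v}" "w \<in> cl {u, v}" "B = cl {u, v} \<union> cl {d}"
          "B \<inter> A = cl {w}" "cl {u, v} \<inter> A = cl {w}"
          by (rule fold_struct[OF f, of u v]) (use vu bad[OF uv(1) ux(1)] bad[OF uv(2) ux(2)] eB uv in auto)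
        let ?L = "cl {u, v}"
        have L: "flt ?L" "r ?L = 2" "?L \<subseteq> F" "?L \<subseteq> B"
          using r_pair[OF u1 vu] cl_least[of "{u, v}" F] uv F d(6) by auto
        have "F \<subseteq> ?L \<union> cl {x, w}"
        proof
          fix e assume e: "e \<in> F"
          show "e \<in> ?L \<union> cl {x, w}"
          proof (rule ccontr)
            assume n: "e \<notin> ?L \<union> cl {x, w}"
            then have "e \<in> cl {d}" using eB[OF e] d(6) by auto
            moreover have "e \<notin> cl {x}" using n sub2 by blast
            ultimately show False using vc_par[OF d(3)] bad[OF e] loop[of e] by auto
          qed
        qed
        then have "Ln w ?L" unfolding Ln_def using L d(5) xB by auto
        moreover have "wing r ?L w d A"
          unfolding wing_def using AB rAB d fold_cover[OF f] by blast
        ultimately show ?thesis unfolding T1_def using AB(9) by blast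
      qed
    qed
  qed
  \<comment> \<open>\<open>w0\<close> is of type \<open>T3\<close> whenever any point is; this
    confines \<open>T3\<close> to \<open>w0\<close> among the three points \<open>w0\<close>,
    \<open>w2\<close>, \<open>w3\<close>.\<close>
  obtain w0 where w0: "w0 \<in> F" "w0 \<notin> cl {x}"
    and T3w0: "(\<exists>A B K. T3 w0 A B K) \<or> (\<forall>w\<in>F. w \<notin> cl {x} \<longrightarrow> (\<forall>A B K. \<not> T3 w A B K))"
    using w' by blast
  obtain w2 w3 where w23: "w2 \<in> F" "w3 \<in> F" "w2 \<notin> cl {x, w0}" "w3 \<notin> cl {x, w0}" "w3 \<notin> cl {x, w2}"
    "w2 \<notin> cl {x, w3}" "w0 \<notin> cl {x, w2}" "w0 \<notin> cl {x, w3}" using tpw[OF w0] by blast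
  have w23x: "w2 \<notin> cl {x}" "w3 \<notin> cl {x}" using sub2 w23 by blast+
  \<comment> \<open>If some point of \<open>K\<close> off \<open>x\<close> lies outside
    \<open>B2\<close>, the lines and hence the sides of rank 4 coincide, and the other sides meet in
    too small a set to complete the cover. Otherwise \<open>B2\<close> contains \<open>K\<close> and
    so \<open>x\<close>.\<close>
  have noT3: "\<not> T3 w A2 B2 K2" if w: "w \<in> F" "w \<notin> cl {x}" "w0 \<notin> cl {x, w}" for w A2 B2 K2
  proof
    assume t: "T3 w A2 B2 K2"
    then obtain A B K where t0: "T3 w0 A B K" using T3w0 w by blast
    have A: "flt A" "flt B" "\<And>e. e \<in> A \<or> e \<in> B" "w0 \<in> B" "r A = 4" "r B = r UNIV - 2" "A = F \<union> K" "flt K" "r K = 2"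
      "x \<in> K" "three_points r K" "K \<inter> F = cl {x}" using t0 unfolding T3_def by blast+
    have A2: "flt A2" "flt B2" "\<And>e. e \<in> A2 \<or> e \<in> B2" "x \<notin> B2" "F \<inter> B2 \<subseteq> cl {x, w}" "A2 = F \<union> K2" "flt K2" "r K2 = 2"
      "x \<in> K2" using t unfolding T3_def by blast+
    obtain k1 k2 where k: "k1 \<in> K" "k2 \<in> K" "k1 \<notin> cl {x}" "k2 \<notin> cl {x}" "k2 \<notin> cl {k1}"
      using three_points_pair[OF A(11) x(1)] by blast
    have kB: "k \<in> B2" if "k \<in> K" "k \<notin> cl {x}" for k
    proof (rule ccontr)
      assume "k \<notin> B2"
      then have "k \<in> A2" using A2(3)[of k] by auto
      then have "k \<in> K2" using A(12) A2(6) that by auto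
      then have "K2 = K" using line_span[OF A(8,9,10) that(1) x(1) that(2)] line_span[OF A2(7-9) _ x(1) that(2)] by auto
      then have "A2 = A" using A A2 by simp
      have "w0 \<notin> B2" using A2(5) w0 w(3) by auto
      then have lt: "r (B \<inter> B2) < r B" using A A2 by (intro flat_psubset) auto
      have cov: "e \<in> A \<or> e \<in> B \<inter> B2" for e using A(3)[of e] A2(3)[of e] \<open>A2 = A\<close> by auto
      show False using cover0[OF cov] lt A R5 by auto
    qed
    have k1: "r {k1} = 1" using loop k by blast
    have "K \<subseteq> B2" using line_in_flat[OF A(8,9) A2(2) k(1,2) k1 k(5)] kB k by blast
    then show False using A A2 by auto
  qed
  have T23: "T1 w \<or> T2 w" if "w = w2 \<or> w = w3" for w
    using types[OF w23(1) w23x(1)] types[OF w23(2) w23x(2)] noT3[OF w23(1) w23x(1) w23(7)]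
      noT3[OF w23(2) w23x(2) w23(8)] that by blast
  have TLn: "\<exists>L. Ln w L" if "T1 w \<or> T2 w" for w using that unfolding T1_def T2_def by blast
  define L where "L = cl {w2, w3}"
  have w32: "w3 \<notin> cl {w2}" using w23(5) cl_mono[of "{w2}" "{x, w2}"] by auto
  have w20: "w2 \<notin> cl {w0}" using w23(3) cl_mono[of "{w0}" "{x, w0}"] by auto
  have w30: "w3 \<notin> cl {w0}" using w23(4) cl_mono[of "{w0}" "{x, w0}"] by auto
  have wn: "r {w0} = 1" "r {w2} = 1" "r {w3} = 1" using loop w0 w23x by blast+
  have LnL: "L' = L \<and> w0 \<in> L'" if "Ln w L'" "w = w0 \<or> w = w2 \<or> w = w3" for w L'
  proof -
    have L': "flt L'" "r L' = 2" "w \<in> L'" "F \<subseteq> L' \<union> cl {x, w}" using that(1) unfolding Ln_def by blast+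
    then have "w0 \<in> L'" "w2 \<in> L'" "w3 \<in> L'" using w23 w0 that(2) by auto
    then show ?thesis using line_span[OF L'(1,2) _ _ wn(2) w32] by (simp add: L_def)
  qed
  obtain L2 where L2: "Ln w2 L2" using TLn T23 by blast
  obtain L3 where L3: "Ln w3 L3" using TLn T23 by blast
  have Leq: "Ln w2 L" "Ln w3 L" "w0 \<in> L" using LnL[OF L2] LnL[OF L3] L2 L3 by auto
  have L: "flt L" "r L = 2" "L \<subseteq> F" "x \<notin> L" "w2 \<in> L" "w3 \<in> L" using Leq unfolding Ln_def by blast+
  have FL: "F \<subseteq> L \<union> cl {x}"
  proof -
    have "cl {x, w2} \<inter> cl {x, w3} = cl {x}"
      by (rule line_meet) (use r2 w23x w23 x subset_cl[of "{x, w2}"] subset_cl[of "{x, w3}"] in auto)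
    then show ?thesis using Leq unfolding Ln_def by blast
  qed
  have nx: "y \<notin> cl {x}" if "y \<in> L" "r {y} = 1" for y using par_flat[OF L(1) _ that(2,1)] L(4) by blast
  have "\<not> vert_conn r L"
  proof
    assume "vert_conn r L"
    then have "is_contractible L" using con_mono_nm[OF conF L(3)] by (simp add: contractible_def)
    moreover have "three_points r L" unfolding three_points_def using Leq(3) L w20 w30 w32 wn by blast
    moreover have "\<not> is_good y" if "y \<in> L" for y
      using neg nx[OF that] that L(3) by (auto simp: good_def)
    ultimately have "is_filament L" using L by (auto simp: filament_line_def)
    then show False using neg L by blast
  qed
  then obtain A B where AB0: "flt A" "flt B" "\<And>e. e \<in> A \<or> e \<in> B" "L \<subseteq> A" "L \<subseteq> B" "r A < r UNIV" "r B < r UNIV"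
    "r A + r B \<le> r UNIV + r L + 1" "x \<in> A" by (rule not_vc_choose[where Q = "\<lambda>A. x \<in> A"]) blast+
  have "r A + r B \<le> r UNIV + 3" using AB0(8) L by simp
  note AB = AB0(1-7) this AB0(9)
  have FG: "F \<subseteq> G" if "flt G" "L \<subseteq> G" "x \<in> G" for G using FL cl_least[of "{x}" G] that by auto
  have FA: "F \<subseteq> A" using FG AB by blast
  have xB: "x \<notin> B"
  proof
    assume "x \<in> B"
    then have "F \<subseteq> B" using FG AB by blast
    then show False using vcD[OF vF AB(3) FA _ AB(6,7)] rF AB by auto
  qed
  \<comment> \<open>If \<open>B\<close> were smaller, \<open>x\<close> could be added to it, and the
    resulting separation would block \<open>F\<close>.\<close>
  have rB: "r B = r UNIV - 1"
  proof (rule ccontr)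
    assume n: "r B \<noteq> r UNIV - 1"
    let ?B = "cl (insert x B)"
    have sB: "insert x B \<subseteq> ?B" by (rule subset_cl)
    have rB': "r ?B = r B + 1" using flat_insert[OF AB(2) xB] by simp
    have cov: "e \<in> A \<or> e \<in> ?B" for e using AB(3)[of e] sB by auto
    have "F \<subseteq> ?B" using FG[of ?B] sB AB by auto
    then show False using vcD[OF vF cov FA _ AB(6)] rB' n AB rF by auto
  qed
  have rA: "r A \<le> 4" using AB rB by linarith
  \<comment> \<open>A point of type \<open>T2\<close> also has a wing, namely the one from
    \<open>M/x\<close>: if the line through \<open>x\<close> and its tip had three points, it would
    lie in \<open>P\<close> and contain \<open>P - H\<close>, which has rank 3.\<close>
  have Ex: "\<exists>c H. wing r L w c H \<and> (x \<in> H \<or> c = x)" if w: "w = w0 \<or> w = w2 \<or> w = w3" "T1 w \<or> T2 w" for w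
  proof -
    have wF: "w \<in> F" "w \<notin> cl {x}" "w \<in> L" "r {w} = 1" using w w0 w23 w23x Leq L wn by auto
    show ?thesis
    proof (cases "T1 w")
      case True then show ?thesis using LnL w unfolding T1_def by blast
    next
      case False
      then obtain L' P H where f: "Ln w L'" "fold_at r P H w" "x \<in> P" "x \<notin> H" "P \<inter> F = cl {x, w}" "L' \<subseteq> H"
        using w(2) unfolding T2_def by blast
      have LH: "L \<subseteq> H" using LnL[OF f(1) w(1)] f(6) by blast
      have PH: "flt P" "flt H" "r P = 3" "w \<in> P" "w \<in> H" using f(2) by (auto simp: fold_at_def)
      obtain x' H' where x': "flt H'" "x \<in> H'" "r H' = r UNIV - 1" "H' \<inter> F = cl {x, w}" "x' \<notin> H'" "x' \<notin> F"
        "\<And>e. e \<in> F \<or> e \<in> cl {x, x'} \<or> e \<in> H'" "cl (insert x' F) = F \<union> cl {x, x'}" using wing_c[OF wF(1,2)] by blast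
      have xxF: "cl {x} \<subseteq> F" by (rule cl_least) (use F in auto)
      have xx: "x' \<notin> cl {x}" using x' xxF by auto
      let ?K = "cl {x, x'}"
      have K: "flt ?K" "r ?K = 2" "x \<in> ?K" "x' \<in> ?K" using r2[OF xx] subset_cl[of "{x, x'}"] by auto
      show ?thesis
      proof (cases "three_points r ?K")
        case False
        have Ks: "?K \<subseteq> cl {x} \<union> cl {x'}" by (rule not_three_points[OF K x(1) xx False])
        have xH': "cl {x} \<subseteq> H'" by (rule cl_least) (use x' in auto)
        have wH': "w \<in> H'" using x'(4) subset_cl[of "{x, w}"] by auto
        have "\<not> L \<subseteq> H'" using x'(4) L Leq(3) w23 w(1) by auto
        then have "H' \<inter> L = cl {w}" using line_meet[OF L(1,2) x'(1) _ wF(3) wH' wF(4)] by (simp add: Int_commute)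
        moreover have "e \<in> L \<or> e \<in> cl {x'} \<or> e \<in> H'" for e using x'(7)[of e] FL Ks xH' by auto
        moreover have "x' \<notin> L" using x'(6) L(3) by auto
        ultimately have "wing r L w x' H'" unfolding wing_def using x'(1,3,5) by auto
        then show ?thesis using x' by blast
      next
        case True
        have KPH: "?K \<subseteq> P"
          using three_points_side[OF True K(1,2) PH(1,2) fold_cover[OF f(2)]] f(4) K by blast
        have KF: "?K \<inter> F = cl {x}" by (rule line_meet) (use K F x x' in auto)
        then have wK: "w \<notin> ?K" using wF by auto
        have "cl (insert w ?K) = P"
          using flat_insert[OF K(1) wK] K PH KPH by (intro flat_spanned) auto
        moreover have "insert w ?K \<subseteq> cl (insert x' F)" using x'(8) wF by auto
        then have "cl (insert w ?K) \<subseteq> cl (insert x' F)" by (rule cl_least) simp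
        ultimately have "P \<subseteq> F \<union> ?K" using x'(8) by simp
        moreover have "cl {x} \<subseteq> ?K" by (rule cl_mono) auto
        ultimately have "P - H \<subseteq> ?K" using FL LH by blast
        then show ?thesis using r_mono[of "P - H" ?K] fold_rank[OF f(2)] K by auto
      qed
    qed
  qed
  have clB: "cl {e} \<subseteq> B" if "e \<in> B" for e using cl_least[of "{e}" B] that AB by auto
  \<comment> \<open>The two ways of crossing differ in whether the tip lies in \<open>B\<close>. Two
    tips in \<open>B\<close> allow \<open>A\<close> to be cut down to both hyperplanes, two tips
    outside allow this for \<open>B\<close>; either leaves too small a cover.\<close>
  have two_ord: False if w: "wing r L p d H" "wing r L p' d' H'" "p \<notin> cl {p'}" "r {p'} = 1" "d \<in> B" "d' \<in> B" for p d H p' d' H'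
  proof -
    have cov: "e \<in> A \<inter> H \<inter> H' \<or> e \<in> B" for e
      using AB(3)[of e] wing_cover[OF w(1), of e] wing_cover[OF w(2), of e] clB[OF w(5)] clB[OF w(6)] AB(5) by auto
    show False using cover0[OF cov] wing_meet[OF AB(1,4) w(1-4)] rA rB R5 by auto
  qed
  have two_exc: False if w: "wing r L p d H" "wing r L p' d' H'" "p \<notin> cl {p'}" "r {p'} = 1" "d \<notin> B" "d' \<notin> B" for p d H p' d' H'
  proof -
    have H: "flt H" "flt H'" "r H = r UNIV - 1" using w by (auto simp: wing_def)
    have clA: "cl {e} \<subseteq> A" if "e \<notin> B" for e using cl_least[of "{e}" A] that AB(1) AB(3)[of e] by auto
    have cov: "e \<in> A \<or> e \<in> H \<inter> B \<inter> H'" for e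
      using AB(3)[of e] wing_cover[OF w(1), of e] wing_cover[OF w(2), of e] clA[OF w(5)] clA[OF w(6)] AB(4) by auto
    have p: "p \<in> H" "p \<in> B" "p' \<in> B" "p \<notin> H'" "p' \<notin> H"
      using wing_point[OF w(1)] wing_point[OF w(2)] AB(5) w(3,4) par_sym[of p' p] w(1,2) unfolding wing_def by auto
    have "r (H \<inter> B \<inter> H') < r (H \<inter> B)" using p H AB by (intro flat_psubset flat_Int) auto
    moreover have "\<not> H \<subseteq> B" using flat_eq[OF H(1), of B] rB H p by auto
    then have "r (H \<inter> B) < r H" using H AB by (intro flat_psubset) auto
    ultimately show False using cover0[OF cov] rA H R5 AB(6) by auto
  qed
  obtain c2 H2 where e2: "wing r L w2 c2 H2" "x \<in> H2 \<or> c2 = x" using Ex[of w2] T23 by blast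
  obtain c3 H3 where e3: "wing r L w3 c3 H3" "x \<in> H3 \<or> c3 = x" using Ex[of w3] T23 by blast
  have same: "(c2 \<in> B) \<noteq> (c3 \<in> B)" using two_ord[OF e3(1) e2(1) w32 wn(2)] two_exc[OF e3(1) e2(1) w32 wn(2)] by blast
  show False
  proof (cases "T1 w0 \<or> T2 w0")
    case True
    then obtain c0 H0 where e0: "wing r L w0 c0 H0" using Ex[of w0] by blast
    show False
      using same two_ord[OF e2(1) e0 w20 wn(1)] two_exc[OF e2(1) e0 w20 wn(1)]
        two_ord[OF e3(1) e0 w30 wn(1)] two_exc[OF e3(1) e0 w30 wn(1)] by blast
  next
    case False
    then obtain A1 B1 K where t0: "T3 w0 A1 B1 K" using types[OF w0] by blast
    have K: "flt A1" "A1 = F \<union> K" "flt K" "r K = 2" "x \<in> K" "three_points r K" "K \<inter> F = cl {x}"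
      using t0 unfolding T3_def by blast+
    \<comment> \<open>At a point \<open>w0\<close> of type \<open>T3\<close> there is no third wing,
      but its line \<open>K\<close> rules out a tip in \<open>B\<close>, and \<open>same\<close>
      says that one of the two tips is there.\<close>
    have ord: False if w: "wing r L w d H" "x \<in> H \<or> d = x" "d \<in> B" "w \<in> L" "r {w} = 1" "w = w2 \<or> w = w3" for w d H
    proof -
      have H: "flt H" "x \<in> H" "w \<in> H" using w(1,2,3) xB wing_point[OF w(1)] by (auto simp: wing_def)
      let ?P = "A \<inter> H"
      have fP: "flt ?P" using AB H by (intro flat_Int) auto
      have cov: "e \<in> ?P \<or> e \<in> B" for e
        using AB(3)[of e] wing_cover[OF w(1), of e] clB[OF w(3)] AB(5) by auto
      have "\<not> L \<subseteq> H" using w(1,6) L w32 nonpar_sym[OF w32 wn(2)] unfolding wing_def by auto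
      then have "\<not> A \<subseteq> H" using AB by blast
      then have rP: "r ?P \<le> 3" using flat_psubset[OF AB(1) H(1)] rA by linarith
      have KP: "K \<subseteq> ?P" using three_points_side[OF K(6,3,4) fP AB(2) cov] K xB by blast
      have wK: "w \<notin> K" using K(7) nx[OF w(4,5)] w(4) L by auto
      have "cl (insert w K) = ?P"
        using flat_insert[OF K(3) wK] K KP rP w AB(4) H by (intro flat_spanned[OF fP]) auto
      moreover have "cl (insert w K) \<subseteq> A1" using K w L by (intro cl_least) auto
      ultimately have P: "?P \<subseteq> F \<union> K" using K by simp
      have "cl {x} \<subseteq> K" by (rule cl_least) (use K in auto)
      then have cov2: "e \<in> K \<or> e \<in> B" for e using cov[of e] P FL AB(5) by blast
      show False using cover0[OF cov2] K rB R5 by auto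
    qed
    show False using same ord[OF e2] ord[OF e3] L wn by blast
  qed
qed

end

section \<open>Lines through which elements are lost\<close>

context conn_minor
begin

abbreviation "V \<equiv> {v. is_good v}"

text \<open>As \<open>y\<close> is outside the span of good elements, they do not span
  \<open>P\<close>. Two non-parallel bad points span a contractible line through \<open>y\<close>
  with three points, which has a good point for not being a filament. If all bad points of
  \<open>P - H\<close> are parallel to one \<open>a\<close>, the badness of \<open>a\<close> itself
  restricts the lines through it.\<close>

lemma fold_line:
  assumes nofil: "\<nexists>L. is_filament L" and f: "fold_at r P H y" and x: "x \<in> P" "x \<notin> H" "is_contractible {x, y}"
    and yV: "y \<notin> cl V"
  obtains u v a where "is_good u" "is_good v" "u \<in> P" "u \<notin> H" "v \<in> P" "v \<notin> H" "a \<in> P" "a \<notin> H" "\<not> is_good a"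
    "a \<notin> cl {u}" "y \<in> cl {u, a}" "v \<notin> cl {u, a}" "P - H \<subseteq> cl {u, a} \<union> cl {v}" "is_contractible (cl {u, a})"
    "\<And>b. b \<in> P \<Longrightarrow> b \<notin> H \<Longrightarrow> \<not> is_good b \<Longrightarrow> b \<in> cl {u, a}"
proof -
  note result = that
  have F: "flt P" "flt H" "r P = 3" "y \<in> P" "y \<in> H" "r {y} = 1" using f by (auto simp: fold_at_def)
  have n1: "r {c} = 1" if "c \<notin> H" for c using notin_flat_nonloop F that by blast
  have cy: "c \<notin> cl {y}" if "c \<notin> H" for c using cl_least[of "{y}" H] F that by auto
  have contractible: "is_contractible {c, y}" if "c \<in> P" "c \<notin> H" for c using fold_con[OF f x(1,2) that x(3)] .
  have gv: "is_good c" if "c \<in> P" "c \<notin> H" "vert_conn r {c}" for c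
    using con_mono_nm[OF contractible[OF that(1,2)], of "{c}"] that n1 by (auto simp: good_def contractible_def)
  have gV: "s \<notin> cl {y}" if "is_good s" for s
  proof
    assume "s \<in> cl {y}"
    then have "y \<in> cl {s}" using par_sym[of s y] that by (auto simp: good_def)
    then show False using yV cl_mono[of "{s}" V] that by auto
  qed
  have spanning: "cl S = P" if "S \<subseteq> P" "r S = 3" for S using flat_spanned[OF F(1) that(1)] F that by auto
  show ?thesis
  proof (cases "\<exists>a b. a \<in> P \<and> b \<in> P \<and> a \<notin> H \<and> b \<notin> H \<and> \<not> is_good a \<and> \<not> is_good b \<and> b \<notin> cl {a}")
    case True
    then obtain a b where ab: "a \<in> P" "b \<in> P" "a \<notin> H" "b \<notin> H" "\<not> is_good a" "\<not> is_good b" "b \<notin> cl {a}" by blast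
    then have nvc: "\<not> vert_conn r {a}" "\<not> vert_conn r {b}" using gv by blast+
    obtain c where c: "c \<in> P" "c \<notin> H" "vert_conn r {c}" "c \<notin> cl {a, b}" "y \<in> cl {a, b}"
      "P = cl {a, b} \<union> cl {c}" "P \<inter> H = cl {y}" "cl {a, b} \<inter> H = cl {y}"
      by (rule fold_struct[OF f ab(1,3,2,4,7) nvc])
    have gc: "is_good c" by (rule gv[OF c(1-3)])
    let ?L = "cl {a, b}"
    have rL: "r ?L = 2" using r_pair[OF n1[OF ab(3)] ab(7)] by simp
    have abL: "a \<in> ?L" "b \<in> ?L" using subset_cl[of "{a, b}"] by auto
    have "cl {y, a} = ?L" by (rule line_span[OF flat_cl rL c(5) abL(1) F(6) cy[OF ab(3)]])
    then have cL: "is_contractible ?L" using contractible[OF ab(1,3)] con_cong[of "{a, y}" ?L] by (simp add: insert_commute)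
    have "three_points r ?L" unfolding three_points_def
      using c(5) abL F(6) cy[OF ab(3)] cy[OF ab(4)] ab(7) by blast
    then obtain u where u: "u \<in> ?L" "is_good u" using nofil rL cL by (auto simp: filament_line_def)
    have uH: "u \<notin> H" using gV[OF u(2)] c(8) u(1) by auto
    have au: "a \<notin> cl {u}" using good_par[OF u(2) _ n1[OF ab(3)]] ab(5) by blast
    have K: "cl {u, a} = ?L" using line_span[OF flat_cl rL u(1) abL(1) _ au] u(2) by (simp add: good_def)
    have badL: "e \<in> ?L" if "e \<in> P" "e \<notin> H" "\<not> is_good e" for e
      using that c(6) good_par[OF gc _ n1[OF that(2)]] by auto
    have "u \<in> P" using u(1) c(6) by auto
    then show ?thesis
      using that[OF u(2) gc _ uH c(1,2) ab(1,3,5) au] c u K cL badL by auto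
  next
    case False
    then have par: "b \<in> cl {a}" if "a \<in> P" "b \<in> P" "a \<notin> H" "b \<notin> H" "\<not> is_good a" "\<not> is_good b" for a b
      using that by blast
    have "\<not> P - H \<subseteq> V"
    proof
      assume "P - H \<subseteq> V"
      then have "cl (P - H) \<subseteq> cl V" by (rule cl_mono)
      then show False using spanning[of "P - H"] fold_rank[OF f] F yV by auto
    qed
    then obtain a where a: "a \<in> P" "a \<notin> H" "\<not> is_good a" by auto
    have nva: "\<not> vert_conn r {a}" using gv a by blast
    have "r (P - H) \<le> r (P - H - cl {a}) + r (cl {a})"
      using r_union_le[of "P - H - cl {a}" "cl {a}"] r_mono[of "P - H" "(P - H - cl {a}) \<union> cl {a}"] by auto
    then have "2 \<le> r (P - H - cl {a})" using fold_rank[OF f] n1[OF a(2)] by simp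
    then obtain u0 v0 where uv0: "u0 \<in> P - H - cl {a}" "v0 \<in> P - H - cl {a}" "r {u0} = 1" "v0 \<notin> cl {u0}"
      by (rule rank_two_points)
    \<comment> \<open>All bad points of \<open>P - H\<close> are parallel to \<open>a\<close>, so
      \<open>u\<close> and \<open>v\<close> are good; a good point off their line would make good
      elements span \<open>P\<close>, and with it \<open>y\<close>.\<close>
    have pair: "is_good u \<and> is_good v \<and> r {u, v} = 2 \<and> r {a, u, v} = 3 \<and> (\<forall>e\<in>P. is_good e \<longrightarrow> e \<in> cl {u, v})"
      if uv: "u \<in> P - H - cl {a}" "v \<in> P - H - cl {a}" "v \<notin> cl {u}" for u v
    proof -
      have uvP: "u \<in> P" "u \<notin> H" "v \<in> P" "v \<notin> H" using uv by auto
      have g: "is_good u" "is_good v" using par[OF a(1) uvP(1) a(2) uvP(2) a(3)] par[OF a(1) uvP(3) a(2) uvP(4) a(3)] uv by auto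
      have VP: "e \<in> cl {u, v}" if "e \<in> P" "is_good e" for e
      proof (rule ccontr)
        assume "e \<notin> cl {u, v}"
        then have "r {u, v, e} = 3" using r_triple_flat[OF n1[OF uvP(2)] uv(3)] by blast
        then have "cl {u, v, e} = P" using spanning[of "{u, v, e}"] that uvP by auto
        moreover have "cl {u, v, e} \<subseteq> cl V" by (rule cl_mono) (use g that in auto)
        ultimately show False using F yV by auto
      qed
      have ruv: "r {u, v} = 2" using r_pair[OF n1[OF uvP(2)] uv(3)] .
      have auv: "a \<notin> cl {u, v}"
      proof
        assume auv: "a \<in> cl {u, v}"
        have "P - H \<subseteq> cl {u, v}"
        proof
          fix e assume e: "e \<in> P - H"
          have "cl {a} \<subseteq> cl {u, v}" using auv by (intro cl_least) auto
          then show "e \<in> cl {u, v}" using VP[of e] par[OF a(1) _ a(2) _ a(3), of e] e by auto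
        qed
        then show False using r_mono[of "P - H" "cl {u, v}"] fold_rank[OF f] ruv by simp
      qed
      then show ?thesis using g VP ruv r_insert_notin[OF auv] by auto
    qed
    have key: thesis if uv: "u \<in> P - H - cl {a}" "v \<in> P - H - cl {a}" "v \<notin> cl {u}" and ruy: "r {a, u, y} \<le> 2" for u v
    proof -
      have uvP: "u \<in> P" "u \<notin> H" "v \<in> P" "v \<notin> H" using uv by auto
      have g: "is_good u" "is_good v" and ruv: "r {u, v} = 2" and r3: "r {a, u, v} = 3"
        and VP: "\<And>e. e \<in> P \<Longrightarrow> is_good e \<Longrightarrow> e \<in> cl {u, v}" using pair[OF uv] by auto
      have auv: "a \<notin> cl {u, v}" using r3 ruv by (simp add: in_cl_iff)
      have au: "a \<notin> cl {u}" using good_par[OF g(1) _ n1[OF a(2)]] a(3) by blast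
      have rua: "r {u, a} = 2" using r_pair[OF n1[OF uvP(2)] au] .
      have yK: "y \<in> cl {u, a}"
        using subset_cl_if_rank[of "{u, a}" "{a, u, y}"] ruy rua by auto
      have aK: "u \<in> cl {u, a}" "a \<in> cl {u, a}" using subset_cl[of "{u, a}"] by auto
      have "cl {y, a} = cl {u, a}" by (rule line_span[OF flat_cl _ yK aK(2) F(6) cy[OF a(2)]]) (simp add: rua)
      then have cK: "is_contractible (cl {u, a})" using contractible[OF a(1,2)] con_cong[of "{a, y}" "cl {u, a}"] by (simp add: insert_commute)
      have vK: "v \<notin> cl {u, a}" using exchange[of v a "{u}"] uv(3) auv by (auto simp: insert_commute)
      have uav: "u \<notin> cl {a, v}"
      proof
        assume "u \<in> cl {a, v}"
        then have "r {u, a, v} = r {a, v}" by (simp add: in_cl_iff)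
        then show False using r3 r_pair_le[of a v] by (simp add: insert_commute)
      qed
      have vm: "cl {u, v} \<inter> cl {a, v} = cl {v}"
        by (rule line_meet) (use ruv uav subset_cl[of "{u, v}"] subset_cl[of "{a, v}"] n1[OF uvP(4)] in auto)
      have badK: "e \<in> cl {u, a}" if "e \<in> P" "e \<notin> H" "\<not> is_good e" for e
        using par[OF a(1) that(1) a(2) that(2) a(3) that(3)] cl_mono[of "{a}" "{u, a}"] by auto
      have "P - H \<subseteq> cl {u, a} \<union> cl {v}"
      proof
        fix e assume e: "e \<in> P - H"
        show "e \<in> cl {u, a} \<union> cl {v}"
        proof (cases "is_good e")
          case False then show ?thesis using badK e by auto
        next
          case True
          have eu: "e \<in> cl {u, v}" using VP True e by auto
          have "r {a, u, e} \<le> 2 \<or> r {a, v, e} \<le> 2"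
            using bad_two_lines[OF f a(1,2) uvP(1,3) _ nva, of e] r3 e by auto
          then show ?thesis
          proof
            assume "r {a, u, e} \<le> 2"
            then show ?thesis using subset_cl_if_rank[of "{u, a}" "{a, u, e}"] rua by auto
          next
            assume "r {a, v, e} \<le> 2"
            moreover have "r {a, v} = 2" using r_insert_notin[OF uav] r3 by (simp add: insert_commute)
            ultimately have "e \<in> cl {a, v}" using subset_cl_if_rank[of "{a, v}" "{a, v, e}"] by auto
            then show ?thesis using vm eu by auto
          qed
        qed
      qed
      then show thesis using result[OF g uvP a au yK vK _ cK badK] by blast
    qed
    have vu: "u0 \<notin> cl {v0}" using nonpar_sym[OF uv0(4,3)] .
    have "r {a, u0, v0} = 3" using pair[OF uv0(1,2,4)] by blast
    \<comment> \<open>Of \<open>u0\<close>, \<open>v0\<close> and \<open>y\<close>, two are on a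
      line through \<open>a\<close>, and the first two are not; so \<open>y\<close> is on such a
      line with one of them, which is renamed \<open>u\<close>.\<close>
    then have "r {a, u0, y} \<le> 2 \<or> r {a, v0, y} \<le> 2"
      using bad_two_lines[OF f a(1,2) _ _ F(4) nva, of u0 v0] uv0 by auto
    then show ?thesis using key[OF uv0(1,2,4)] key[OF uv0(2,1) vu] by blast
  qed
qed

text \<open>Since \<open>u\<close> is good and \<open>p\<close> is not spanned by good elements,
  \<open>V\<close> and \<open>K\<close> together have rank just one more than \<open>V\<close>: this
  is the dimension lost. The tips at \<open>p\<close> and \<open>q\<close> play the role of those of
  a filament.\<close>

definition loss_line where
  "loss_line K u p vp Hp q vq Hq \<longleftrightarrow> flt K \<and> r K = 2 \<and> is_contractible K \<and> three_points r K \<and> is_good u \<and> u \<in> K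
     \<and> r {p} = 1 \<and> r {q} = 1 \<and> q \<notin> cl {p} \<and> p \<notin> cl {q} \<and> p \<notin> cl V \<and> q \<notin> cl V \<and> is_good vp \<and> is_good vq
     \<and> wing r K p vp Hp \<and> wing r K q vq Hq \<and> 4 \<le> r UNIV"

text \<open>\<open>fold_line\<close> at \<open>y\<close> gives the line through \<open>u\<close> and
  a bad point \<open>a\<close>. With \<open>u\<close> and \<open>a\<close> spanning
  \<open>y\<close>, also \<open>a\<close> is outside the span of \<open>V\<close>, so
  \<open>fold_line\<close> applies again at \<open>a\<close> with \<open>y\<close> in place of
  \<open>x\<close>. Both lines are \<open>cl {y, a}\<close>, and their folds give the wings at
  \<open>p = y\<close> and \<open>q = a\<close>.\<close>

lemma loss_line_exists:
  assumes nofil: "\<nexists>L. is_filament L" and x: "is_good x" and xy: "is_contractible {x, y}" "y \<notin> cl {x}" and yV: "y \<notin> cl V"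
  obtains K u p vp Hp q vq Hq where "loss_line K u p vp Hp q vq Hq"
proof -
  have y1: "r {y} = 1" using nonpar_nonloop xy by blast
  have x1: "r {x} = 1" using x by (simp add: good_def)
  have xny: "x \<notin> cl {y}" using nonpar_sym[OF xy(2) x1] .
  have "y \<notin> V" using yV subset_cl[of V] by auto
  then have nvy: "\<not> vert_conn r {y}" using con_mono_nm[OF xy(1), of "{y}"] y1 by (auto simp: good_def contractible_def)
  obtain P H where f: "fold_at r P H y" "x \<in> P" "x \<notin> H"
    using fold_from_pair[OF nvy y1 _ xny] xy by (auto simp: contractible_def)
  obtain u v a where g: "is_good u" "is_good v" "u \<in> P" "u \<notin> H" "v \<in> P" "v \<notin> H" "a \<in> P" "a \<notin> H" "\<not> is_good a"
    "a \<notin> cl {u}" "y \<in> cl {u, a}" "v \<notin> cl {u, a}" "P - H \<subseteq> cl {u, a} \<union> cl {v}" "is_contractible (cl {u, a})"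
    by (rule fold_line[OF nofil f xy(1) yV]) blast
  let ?K = "cl {u, a}"
  have H: "flt H" "r H = r UNIV - 1" "y \<in> H" "4 \<le> r UNIV" using f by (auto simp: fold_at_def)
  have u1: "r {u} = 1" using g by (simp add: good_def)
  have rK: "r ?K = 2" using r_pair[OF u1 g(10)] by simp
  have uK: "u \<in> ?K" "a \<in> ?K" using subset_cl[of "{u, a}"] by auto
  have a1: "r {a} = 1" using nonpar_nonloop g by blast
  have any: "a \<notin> cl {y}" using cl_least[of "{y}" H] H g by auto
  have yna: "y \<notin> cl {a}" using nonpar_sym[OF any y1] .
  have w1: "wing r ?K y v H" unfolding wing_def
  proof (intro conjI allI)
    show "H \<inter> ?K = cl {y}"
      using line_meet[OF flat_cl rK H(1) _ g(11) H(3) y1] uK g(4) by (auto simp: Int_commute)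
    show "e \<in> ?K \<or> e \<in> cl {v} \<or> e \<in> H" for e using g(13) fold_cover[OF f(1), of e] by auto
  qed (use H g in auto)
  have cay: "is_contractible {a, y}" using fold_con[OF f g(7,8) xy(1)] .
  have aV: "a \<notin> cl V"
  proof
    assume "a \<in> cl V"
    then have "?K \<subseteq> cl V" using g(1) subset_cl[of V] by (intro cl_least) auto
    then show False using g(11) yV by auto
  qed
  have nva: "\<not> vert_conn r {a}" using con_mono_nm[OF cay, of "{a}"] g(9) a1 by (auto simp: good_def contractible_def)
  have cya: "is_contractible {y, a}" using cay by (simp add: insert_commute)
  obtain P' H' where f': "fold_at r P' H' a" "y \<in> P'" "y \<notin> H'"
    using fold_from_pair[OF nva a1 _ yna] cya by (auto simp: contractible_def)
  have yg: "\<not> is_good y" using \<open>y \<notin> V\<close> by simp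
  obtain u' v' a' where g': "is_good u'" "is_good v'" "v' \<notin> H'" "a' \<notin> cl {u'}" "a \<in> cl {u', a'}" "v' \<notin> cl {u', a'}"
    "P' - H' \<subseteq> cl {u', a'} \<union> cl {v'}" "y \<in> cl {u', a'}"
    by (rule fold_line[OF nofil f' cya aV]) (use yg f' in blast)
  have rK': "r (cl {u', a'}) = 2" using r_pair[OF _ g'(4)] g'(1) by (simp add: good_def)
  have "cl {y, a} = ?K" by (rule line_span[OF flat_cl rK g(11) uK(2) y1 any])
  moreover have "cl {y, a} = cl {u', a'}" by (rule line_span[OF flat_cl rK' g'(8,5) y1 any])
  ultimately have KK: "cl {u', a'} = ?K" by simp
  have H': "flt H'" "r H' = r UNIV - 1" "a \<in> H'" using f' by (auto simp: fold_at_def)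
  have w2: "wing r ?K a v' H'" unfolding wing_def
  proof (intro conjI allI)
    show "H' \<inter> ?K = cl {a}"
      using line_meet[OF flat_cl rK H'(1) _ uK(2) H'(3) a1] g(11) f'(3) by (auto simp: Int_commute)
    show "e \<in> ?K \<or> e \<in> cl {v'} \<or> e \<in> H'" for e using g'(7) KK fold_cover[OF f'(1), of e] by auto
  qed (use H' g' KK in auto)
  have ynu: "y \<notin> cl {u}" using yV cl_mono[of "{u}" V] g(1) by auto
  have "three_points r ?K" unfolding three_points_def using uK g(10,11) u1 ynu any by blast
  then show ?thesis using that[of ?K u y v H a v' H'] rK g g' uK y1 a1 any yna yV aV w1 w2 H unfolding loss_line_def by auto
qed

text \<open>The plane of the fold at \<open>y\<close> contains \<open>K\<close>, as \<open>u\<close>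
  is off the hyperplane and \<open>K\<close> has three points. It also has a good point off
  \<open>K\<close>, because good elements do not span \<open>K\<close>; this point and
  \<open>K\<close> span the plane.\<close>

lemma loss_line_point:
  assumes nofil: "\<nexists>L. is_filament L" and k: "loss_line K u p vp Hp q vq Hq" and y: "is_contractible {u, y}" "y \<notin> cl {u}"
  shows "y \<in> cl (V \<union> K)"
proof (cases "y \<in> cl V")
  case True then show ?thesis using cl_mono[of V "V \<union> K"] by auto
next
  case yV: False
  have K: "flt K" "r K = 2" "three_points r K" "is_good u" "u \<in> K" "p \<notin> cl V" "p \<in> K"
    using k wing_point[of K p vp Hp] by (auto simp: loss_line_def)
  have y1: "r {y} = 1" using nonpar_nonloop y by blast
  have uny: "u \<notin> cl {y}" using nonpar_sym[OF y(2)] K(4) by (simp add: good_def)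
  have "y \<notin> V" using yV subset_cl[of V] by auto
  then have nvy: "\<not> vert_conn r {y}" using con_mono_nm[OF y(1), of "{y}"] y1 by (auto simp: good_def contractible_def)
  obtain P H where f: "fold_at r P H y" "u \<in> P" "u \<notin> H"
    using fold_from_pair[OF nvy y1 _ uny] y by (auto simp: contractible_def)
  have PH: "flt P" "flt H" "r P = 3" "y \<in> P" using f by (auto simp: fold_at_def)
  have KP: "K \<subseteq> P" using three_points_side[OF K(3,1,2) PH(1,2) fold_cover[OF f(1)]] K(5) f(3) by auto
  obtain u' v' a' where g: "is_good u'" "is_good v'" "u' \<in> P" "v' \<in> P" "a' \<notin> cl {u'}" "v' \<notin> cl {u', a'}"
    by (rule fold_line[OF nofil f y(1) yV]) blast
  have v'u': "v' \<notin> cl {u'}" using g(6) cl_mono[of "{u'}" "{u', a'}"] by auto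
  obtain s where s: "is_good s" "s \<in> P" "s \<notin> K"
  proof (cases "u' \<in> K \<and> v' \<in> K")
    case True
    then have "cl {u', v'} = K" using line_span[OF K(1,2) _ _ _ v'u'] g(1) by (auto simp: good_def)
    moreover have "cl {u', v'} \<subseteq> cl V" by (rule cl_mono) (use g in auto)
    ultimately show ?thesis using K by auto
  next
    case False then show ?thesis using that g by blast
  qed
  have "cl (insert s K) = P" using flat_spanned[OF PH(1), of "insert s K"] flat_insert[OF K(1) s(3)] K(2) PH(3) KP s(2) by auto
  moreover have "cl (insert s K) \<subseteq> cl (V \<union> K)" by (rule cl_mono) (use s in auto)
  ultimately show ?thesis using PH by auto
qed

text \<open>The critical separation \<open>(A, B)\<close> at \<open>z\<close> has \<open>A\<close> of rank 4, containing one of the two wing elements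
  but not the other; then \<open>A\<close> contains a further good element, found by uncrossing.\<close>
lemma loss_line_touched:
  assumes k: "loss_line K u p vp Hp q vq Hq" and z: "z \<notin> K" "is_contractible (insert z K)"
  shows "touched r V K (cl (insert z K))"
proof (rule ccontr)
  assume nt: "\<not> ?thesis"
  define F where "F = cl (insert z K)"
  have K: "flt K" "r K = 2" "three_points r K" "is_good vp" "is_good vq" "wing r K p vp Hp" "wing r K q vq Hq"
    "q \<notin> cl {p}" "p \<notin> cl {q}" "r {p} = 1" "r {q} = 1" "4 \<le> r UNIV" using k by (auto simp: loss_line_def)
  have F: "flt F" "r F = 3" "K \<subseteq> F" "z \<in> F" "vert_conn r F"
    using flat_insert[OF K(1) z(1)] K z(2) subset_cl[of "insert z K"] by (auto simp: F_def contractible_def vc_cl)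
  have nt': "\<not> touched r V K F" using nt by (simp add: F_def)
  have out: "v \<notin> F" if "is_good v" "v \<notin> K" for v
    using touched_element[of v V F K] nt' that K(1) by (auto simp: flat_def)
  have vF: "vp \<notin> F" "vq \<notin> F" using out K by (auto simp: wing_def)
  have H: "flt Hp" "flt Hq" "vp \<notin> K" "vq \<notin> K" using K by (auto simp: wing_def)
  have zH: "z \<in> Hp" "z \<in> Hq"
    using wing_sub[OF K(6) F(1) vF(1) F(4) z(1)] wing_sub[OF K(7) F(1) vF(2) F(4) z(1)] by auto
  have z1: "r {z} = 1" using notin_flat_nonloop K(1) z(1) by blast
  have nmz: "is_minor_after {z}" using con_mono_nm[OF z(2), of "{z}"] by auto
  have nvz: "\<not> vert_conn r {z}" using out[of z] z(1) F(4) nmz z1 by (auto simp: good_def contractible_def)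
  \<comment> \<open>The two hyperplanes reduce the plane \<open>F\<close> to the single point
    \<open>z\<close>.\<close>
  have Fz: "e \<in> cl {z}" if "e \<in> F" "e \<in> Hp" "e \<in> Hq" for e
  proof -
    have "r {e, z} \<le> r (F \<inter> Hp \<inter> Hq)" by (rule r_mono) (use that F zH in auto)
    then have "r {e, z} \<le> 1" using wing_meet[OF F(1,3) K(6,7) K(9,11)] F(2) by linarith
    then show ?thesis using r_insert_ge[of "{z}" e] z1 by (simp add: in_cl_iff)
  qed
  obtain A B where AB: "flt A" "flt B" "\<And>e. e \<in> A \<or> e \<in> B" "z \<in> A" "z \<in> B" "r A < r UNIV" "r B < r UNIV"
    "r A + r B = r UNIV + 2" "K \<subseteq> A"
    by (rule sep_choose[OF nvz z1 three_points_sides[OF K(3,1,2)]]) blast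
  have FA: "F \<subseteq> A" unfolding F_def using AB by (intro cl_least) auto
  \<comment> \<open>Otherwise adding \<open>K\<close> to \<open>B\<close> would give a separation
    that blocks \<open>F\<close>. Consequently \<open>A\<close> has rank at most 4.\<close>
  have rBK: "r (B \<union> K) = r UNIV"
  proof (rule ccontr)
    assume "r (B \<union> K) \<noteq> r UNIV"
    then have lt: "r (cl (B \<union> K)) < r UNIV" using r_le_UNIV[of "B \<union> K"] by simp
    have FB: "F \<subseteq> cl (B \<union> K)" unfolding F_def by (rule cl_mono) (use AB in auto)
    have cov: "e \<in> A \<or> e \<in> cl (B \<union> K)" for e using AB(3)[of e] subset_cl[of "B \<union> K"] by auto
    show False using vcD[OF F(5) cov FA FB AB(6) lt] F(2) r_union_le[of B K] K(2) AB(8) by simp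
  qed
  have rAB: "r A \<le> 4" "r UNIV - 2 \<le> r B" using rBK r_union_le[of B K] K(2) AB(8) by linarith+
  have "\<not> (vp \<notin> A \<and> vq \<notin> A)"
    using two_wings_out[OF K(2) AB(1,9,3) K(6,7) K(9,11), of "{z}"] zH AB z1 K(12) by auto
  moreover have "\<not> (vp \<in> A \<and> vq \<in> A)"
  proof
    assume v: "vp \<in> A \<and> vq \<in> A"
    have "r (K \<union> {vp, vq}) = 4" by (rule wing_distinct[OF K(1,2) K(6,7) K(9) K(12)])
    moreover have "r ({vp, vq} \<union> F) \<le> r A" using FA v by (intro r_mono) auto
    ultimately have "touched r V K F"
      using K rAB F by (intro touchedI[of "{vp, vq}"]) (auto simp: Un_commute)
    then show False using nt' by blast
  qed
  moreover have False if w: "wing r K p1 v H1" "wing r K p2 v2 H2" "p1 \<notin> cl {p2}" "r {p2} = 1" "is_good v"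
    "v \<in> A" "v2 \<notin> A" "H1 = Hp \<and> H2 = Hq \<or> H1 = Hq \<and> H2 = Hp" for p1 v H1 p2 v2 H2
  proof -
    have H1: "flt H1" "flt H2" "v \<notin> K" using w by (auto simp: wing_def)
    have zH1: "z \<in> H1" "z \<in> H2" using zH w(8) by auto
    have Fz1: "e \<in> cl {z}" if "e \<in> F" "e \<in> H1" "e \<in> H2" for e using Fz[of e] that w(8) by auto
    \<comment> \<open>What remains of \<open>A\<close> outside \<open>K\<close> and the class of the
      tip \<open>v\<close>. Two hyperplanes leave it rank at most 2.\<close>
    define Q where "Q = A \<inter> H1 \<inter> H2"
    have fQ: "flt Q" unfolding Q_def using AB H1 by (intro flat_Int) auto
    have rQ: "r Q \<le> 2" unfolding Q_def using wing_meet[OF AB(1,9) w(1-4)] rAB by linarith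
    have AQ: "e \<in> K \<or> e \<in> cl {v} \<or> e \<in> Q" if "e \<in> A" for e
      using wing_cover[OF w(1), of e] wing_sub[OF w(2) AB(1) w(7) that] that by (auto simp: Q_def)
    have zQ: "z \<in> Q" using AB zH1 by (auto simp: Q_def)
    define P where "P = cl (insert v K)"
    have P: "flt P" "r P = 3" "K \<subseteq> P" "v \<in> P" "P \<subseteq> A"
      using flat_insert[OF K(1) H1(3)] K(2) subset_cl[of "insert v K"] cl_least[of "insert v K" A] AB w(6)
      by (auto simp: P_def)
    have clvP: "cl {v} \<subseteq> P" using cl_least[of "{v}" P] P by auto
    \<comment> \<open>Otherwise \<open>P\<close> and \<open>B\<close> already cover, so that
      \<open>A\<close> is a plane; it equals \<open>F\<close> and contains the good
      \<open>v\<close>.\<close>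
    have "\<not> Q \<subseteq> B \<union> P"
    proof
      assume QB: "Q \<subseteq> B \<union> P"
      have cov: "e \<in> P \<or> e \<in> B" for e using AB(3)[of e] AQ[of e] QB P clvP by auto
      have "r B = r UNIV - 1" using cover0[OF cov] P AB K(12) by linarith
      then have "r A = 3" using AB by linarith
      then have "F = A" using flat_eq[OF F(1) FA] F by auto
      then show False using out[OF w(5) H1(3)] w(6) by auto
    qed
    then obtain w' where w': "w' \<in> Q" "w' \<notin> B" "w' \<notin> P" by auto
    have w'A: "w' \<in> A" using w' by (auto simp: Q_def)
    have w'1: "r {w'} = 1" using notin_flat_nonloop[OF AB(2) w'(2)] .
    have rwP: "r (insert w' P) = 4" using flat_insert[OF P(1) w'(3)] P(2) by simp
    have rA: "r A = 4" using r_mono[of "insert w' P" A] rwP P w'A rAB by auto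
    have rB: "r B = r UNIV - 2" using rA AB by linarith
    have R5: "5 \<le> r UNIV" using rA AB by linarith
    have "A \<union> insert z K = A" using AB by auto
    then have "is_minor_after {z, w'}"
      using nm_transfer[of "insert z K" z A B w'] z(2) AB(1-5,8) z1 w'(2) w'A rA flat_insert[OF K(1) z(1)] K(2) R5
      by (auto simp: contractible_def)
    then have nmw: "is_minor_after {w'}" by (rule nm_mono) auto
    \<comment> \<open>Were \<open>w'\<close> good, then \<open>v\<close> and \<open>w'\<close> would
      add two dimensions to \<open>K\<close> but, both lying in \<open>A\<close>, only one to
      \<open>F\<close>. So \<open>w'\<close> has to be blocked, and its separation is uncrossed with
      \<open>(A, B)\<close>.\<close>
    have "\<not> is_good w'"
    proof
      assume g: "is_good w'"
      have "r ({v, w'} \<union> F) \<le> r A" using FA w'A w by (intro r_mono) auto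
      moreover have "r (insert w' (insert v K)) = 4"
        using rwP r_cl_Un(2)[of "{w'}" "insert v K"] by (simp add: P_def insert_commute)
      ultimately have "touched r V K F"
        using g w rA F K by (intro touchedI[of "{v, w'}"]) (auto simp: insert_commute)
      then show False using nt' by blast
    qed
    then have nvw: "\<not> vert_conn r {w'}" using nmw w'1 by (auto simp: good_def contractible_def)
    obtain A2 B2 where 2: "flt A2" "flt B2" "\<And>e. e \<in> A2 \<or> e \<in> B2" "w' \<in> A2" "w' \<in> B2" "r A2 < r UNIV" "r B2 < r UNIV"
      "r A2 + r B2 = r UNIV + 2" "K \<subseteq> A2"
      by (rule sep_choose[OF nvw w'1 three_points_sides[OF K(3,1,2)]]) blast
    have w'K: "w' \<notin> K" using w' P by auto
    have Qline: "Q = cl {w', e}" if "e \<in> Q" "e \<notin> cl {w'}" for e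
    proof -
      have "r {w', e} = 2" by (rule r_pair[OF w'1 that(2)])
      then show ?thesis using that w' rQ by (intro flat_spanned[OF fQ, symmetric]) auto
    qed
    show False
    proof (cases "r (A \<inter> A2) + r (B \<union> B2) \<le> r UNIV + 2")
      case True
      \<comment> \<open>In this case \<open>A \<inter> A2\<close> is the plane through
        \<open>K\<close> and \<open>w'\<close>; its points off \<open>K\<close> are in
        \<open>B \<union> B2\<close>, so \<open>K\<close> and \<open>B \<union> B2\<close> form a
        cover of too small rank.\<close>
      have fQp: "flt (A \<inter> A2)" by (rule flat_Int[OF AB(1) 2(1)])
      have "\<not> A \<subseteq> A2"
      proof
        assume "A \<subseteq> A2"
        then have "r (B \<union> B2) \<le> r B" using True AB by (simp add: Int_absorb2)
        moreover have "r (insert w' B) \<le> r (B \<union> B2)" using 2 by (intro r_mono) auto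
        ultimately show False using flat_insert[OF AB(2) w'(2)] by linarith
      qed
      then have "r (A \<inter> A2) \<le> 3" using flat_psubset[OF AB(1) 2(1)] rA by linarith
      moreover have rwK: "r (insert w' K) = 3" using flat_insert[OF K(1) w'K] K(2) by simp
      ultimately have Qp: "cl (insert w' K) = A \<inter> A2"
        using 2 AB w'A by (intro flat_spanned[OF fQp]) auto
      then have rQp: "r (A \<inter> A2) = 3" using rwK r_cl[of "insert w' K"] by simp
      have rBB: "r (B \<union> B2) \<le> r UNIV - 1" using True rQp by linarith
      have vQp: "v \<notin> A \<inter> A2"
      proof
        assume v: "v \<in> A \<inter> A2"
        have "P = A \<inter> A2" unfolding P_def
          using v AB 2 P rQp flat_insert[OF K(1) H1(3)] K(2) by (intro flat_spanned[OF fQp]) auto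
        then show False using w' 2 w'A by auto
      qed
      have clw: "cl {w'} \<subseteq> B2" using cl_least[of "{w'}" B2] 2 by auto
      have "e \<in> K \<or> e \<in> B \<union> B2" for e
      proof (cases "e \<in> A \<inter> A2")
        case False then show ?thesis using AB(3)[of e] 2(3)[of e] by auto
      next
        case eQp: True
        then consider "e \<in> K" | "e \<in> cl {v}" "e \<notin> K" | "e \<in> Q" using AQ[of e] by auto
        then show ?thesis
        proof cases
          case 2
          then have "r {e} = 1" using notin_flat_nonloop K(1) by blast
          then show ?thesis using par_flat[OF fQp 2(1) _ eQp] vQp by auto
        next
          case 3
          have "e \<in> cl {w'}"
          proof (rule ccontr)
            assume "e \<notin> cl {w'}"
            then have "Q = cl {w', e}" using Qline 3 by blast
            then have "Q \<subseteq> A \<inter> A2" using cl_least[OF _ fQp, of "{w', e}"] eQp w'A 2 \<open>w' \<in> A2\<close> by auto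
            then have "z \<in> A \<inter> A2" using zQ by auto
            then have "F = A \<inter> A2" unfolding F_def
              using AB \<open>K \<subseteq> A2\<close> rQp flat_insert[OF K(1) z(1)] K(2) by (intro flat_spanned[OF fQp]) auto
            then have "w' \<in> F" using w'A \<open>w' \<in> A2\<close> by auto
            then have "w' \<in> cl {z}" using Fz1 w' by (auto simp: Q_def)
            then show False using cl_least[of "{z}" B] AB w' by auto
          qed
          then show ?thesis using clw by auto
        qed auto
      qed
      then show False using cover0[of K "B \<union> B2"] K R5 rBB by auto
    next
      case False
      \<comment> \<open>In this case \<open>w'\<close> is blocked by a fold whose plane meets
        \<open>A\<close> in a line \<open>l\<close>. The part of \<open>l\<close> off the hyperplane
        has rank 2, but it is disjoint from \<open>K\<close> and \<open>Q\<close>, so its points are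
        parallel to \<open>v\<close>.\<close>
      have cov2: "e \<in> B2 \<or> e \<in> A2" for e using 2(3)[of e] by auto
      have b1: "r (B \<inter> B2) \<le> 1" using uncross[OF AB(3) 2(3) AB(8) 2(8) AB(7)] False by blast
      have "B \<subseteq> (B \<inter> A2) \<union> (B \<inter> B2)" using 2(3) by blast
      then have "r B \<le> r (B \<inter> A2) + r (B \<inter> B2)"
        using r_mono[of B "(B \<inter> A2) \<union> (B \<inter> B2)"] r_union_le[of "B \<inter> A2" "B \<inter> B2"] by linarith
      then have "\<not> r (B \<inter> A2) \<le> 1" using b1 rB R5 by linarith
      moreover have "r B2 + r A2 = r UNIV + 2" using 2 by simp
      ultimately have s: "r (A \<inter> B2) + r (B \<union> A2) \<le> r UNIV + 2" using uncross[OF AB(3) cov2 AB(8) _ AB(7)] by blast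
      have "r UNIV \<le> r (B \<union> A2)" using r_mono[of "B \<union> K" "B \<union> A2"] rBK 2 by auto
      then have l2: "r (A \<inter> B2) \<le> 2" using s by linarith
      define l where "l = A \<inter> B2"
      have B2s: "B2 \<subseteq> l \<union> (B \<inter> B2)" using AB(3) by (auto simp: l_def)
      have "r B2 \<le> r l + r (B \<inter> B2)" using r_union_le[of l "B \<inter> B2"] r_mono[OF B2s] by linarith
      then have rk: "r B2 = 3" "r l = 2" "r (B \<inter> B2) = 1" "r A2 = r UNIV - 1"
        using l2 b1 2(6,7,8) by (auto simp: l_def)
      have fl: "flt l" unfolding l_def by (rule flat_Int[OF AB(1) 2(2)])
      have f: "fold_at r B2 A2 w'" unfolding fold_at_def using 2 rk w'1 R5 by auto
      have wl: "w' \<in> l" using w'A 2 by (auto simp: l_def)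
      have "B2 - A2 \<subseteq> (l - A2) \<union> (B \<inter> B2)" using B2s by blast
      from r_mono[OF this] have "2 \<le> r (l - A2)"
        using r_union_le[of "l - A2" "B \<inter> B2"] fold_rank[OF f] rk by linarith
      then obtain e1 e2 where e: "e1 \<in> l - A2" "e2 \<in> l - A2" "r {e1} = 1" "e2 \<notin> cl {e1}" by (rule rank_two_points)
      have notQ: "e \<notin> Q" if "e \<in> l - A2" for e
      proof
        assume eQ: "e \<in> Q"
        have ew: "e \<notin> cl {w'}" using cl_least[of "{w'}" A2] 2 that by auto
        have "Q = l" using Qline[OF eQ ew] line_span[OF fl rk(2) wl _ w'1 ew] that by auto
        then have zl: "z \<in> B \<inter> B2" "z \<in> l" using zQ AB by (auto simp: l_def)
        have "B \<inter> B2 = cl {z}" using zl rk z1 flat_Int[OF AB(2) 2(2)] by (intro flat_spanned[symmetric]) auto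
        then have "B2 \<subseteq> l" using B2s cl_least[OF _ fl, of "{z}"] zl by auto
        then show False using r_mono[of B2 l] rk by simp
      qed
      have ev: "e \<in> cl {v}" if "e \<in> l - A2" for e using AQ[of e] notQ[OF that] that 2(9) by (auto simp: l_def)
      have "cl {v} \<subseteq> cl {e1}" using par_sym[OF ev[OF e(1)] e(3)] by (intro cl_least) auto
      then show False using ev[OF e(2)] e(4) by auto
    qed
  qed
  ultimately show False using K by blast
qed

end

section \<open>The induction\<close>

definition member :: "('a set \<Rightarrow> int) \<Rightarrow> ('b set \<Rightarrow> int) \<Rightarrow> 'b set \<Rightarrow> 'a set \<Rightarrow> bool" where
  "member r rN EN Y \<longleftrightarrow> (\<exists>v. Y = {v} \<and> good r rN EN v) \<or> filament_line r rN EN Y"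

text \<open>From \<open>k = 2\<close> on this is the rounded-up half of \<open>k\<close> plus 1. The
  values at 0 and 1 start the induction: they are what makes a step from \<open>k - 1\<close> gain
  at most one everywhere, including at 2.\<close>

definition bound :: "nat \<Rightarrow> nat" where
  "bound k = (if k \<le> 1 then k else (k + 1) div 2 + 1)"

section \<open>Skew families and their lifting\<close>

context matroid_rank
begin

lemma r_Union_le: "r (X \<union> \<Union>(set Fs)) \<le> r X + (\<Sum>Y\<leftarrow>Fs. r Y)"
proof (induction Fs)
  case (Cons Y Fs)
  have "r (X \<union> \<Union>(set (Y # Fs))) \<le> r (X \<union> \<Union>(set Fs)) + r Y"
    using r_union_le[of "X \<union> \<Union>(set Fs)" Y] by (simp add: Un_ac)
  then show ?case using Cons by simp
qed simp

lemma skew_sub: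
  assumes "r (X \<union> \<Union>(set Fs)) = r X + (\<Sum>Y\<leftarrow>Fs. r Y)" "X0 \<subseteq> X"
  shows "r (X0 \<union> \<Union>(set Fs)) = r X0 + (\<Sum>Y\<leftarrow>Fs. r Y)"
proof -
  have "r (X \<union> \<Union>(set Fs)) + r X0 \<le> r (X0 \<union> \<Union>(set Fs)) + r X" by (rule submod_le) (use assms in auto)
  then show ?thesis using assms r_Union_le[of X0 Fs] by linarith
qed

lemma ctr_cl: "contract_rank r (cl X) = contract_rank r X"
  by (rule ext) (simp add: contract_rank_def)

end

context conn_minor
begin

abbreviation "is_member \<equiv> member r rN EN"

text \<open>The two fates of a member of \<open>M/X\<close>: exchange for a good element, or
  replacement by a filament of \<open>M\<close> that is skew to \<open>X\<close>.\<close>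

definition liftable where
  "liftable X G \<longleftrightarrow> touched r V X (cl (G \<union> X)) \<or> (\<exists>L. is_filament L \<and> L \<subseteq> cl (G \<union> X) \<and> r (L \<union> X) = r X + 2)"

text \<open>Members are replaced one at a time: \<open>Fs\<close> are those of \<open>M\<close>,
  \<open>Gs\<close> those still belonging to \<open>M/X\<close>, and the mixed family remains skew
  over \<open>X\<close>. Lists make a repeated member count twice in the sum, so skewness also
  excludes repetitions.\<close>

lemma lift_family_aux:
  assumes "\<And>G. G \<in> set Gs \<Longrightarrow> liftable X G" "\<And>Y. Y \<in> set Fs \<Longrightarrow> is_member Y"
    and "r (X \<union> \<Union>(set Fs) \<union> \<Union>(set Gs)) = r X + (\<Sum>Y\<leftarrow>Fs. r Y) + (\<Sum>Y\<leftarrow>Gs. contract_rank r X Y)"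
  shows "\<exists>Fs'. length Fs' = length Fs + length Gs \<and> (\<forall>Y\<in>set Fs'. is_member Y)
    \<and> r (X \<union> \<Union>(set Fs')) = r X + (\<Sum>Y\<leftarrow>Fs'. r Y)"
  using assms
proof (induction Gs arbitrary: Fs)
  case Nil then show ?case by (intro exI[of _ Fs]) auto
next
  case (Cons G Gs)
  interpret c: matroid_rank "contract_rank r X" E by (rule ctr_rank)
  define T where "T = \<Union>(set Fs) \<union> \<Union>(set Gs)"
  define F where "F = cl (G \<union> X)"
  have rF: "r F = r X + contract_rank r X G" "X \<subseteq> F" "G \<subseteq> F" using subset_cl[of "G \<union> X"] by (auto simp: F_def contract_rank_def)
  have tot: "r (X \<union> T \<union> G) = r X + (\<Sum>Y\<leftarrow>Fs. r Y) + (\<Sum>Y\<leftarrow>Gs. contract_rank r X Y) + contract_rank r X G"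
    using Cons.prems(3) by (simp add: T_def Un_ac)
  have XT: "r (X \<union> T) = r X + (\<Sum>Y\<leftarrow>Fs. r Y) + (\<Sum>Y\<leftarrow>Gs. contract_rank r X Y)"
  proof (rule antisym)
    have "r (X \<union> \<Union>(set Gs)) = r X + contract_rank r X (\<Union>(set Gs))" by (simp add: contract_rank_def Un_commute)
    moreover have "contract_rank r X (\<Union>(set Gs)) \<le> (\<Sum>Y\<leftarrow>Gs. contract_rank r X Y)" using c.r_Union_le[of "{}" Gs] c.r_empty by simp
    moreover have "r (X \<union> T) \<le> r (X \<union> \<Union>(set Gs)) + (\<Sum>Y\<leftarrow>Fs. r Y)"
      using r_Union_le[of "X \<union> \<Union>(set Gs)" Fs] by (simp add: T_def Un_ac)
    ultimately show "r (X \<union> T) \<le> r X + (\<Sum>Y\<leftarrow>Fs. r Y) + (\<Sum>Y\<leftarrow>Gs. contract_rank r X Y)" by linarith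
    have "r (X \<union> T \<union> G) + r X \<le> r (X \<union> T) + r (G \<union> X)" by (rule submod_le) auto
    then show "r X + (\<Sum>Y\<leftarrow>Fs. r Y) + (\<Sum>Y\<leftarrow>Gs. contract_rank r X Y) \<le> r (X \<union> T)" using tot by (simp add: contract_rank_def)
  qed
  have TF: "r (T \<union> F) = r (T \<union> X) + r F - r X"
  proof -
    have "r (T \<union> F) = r (X \<union> T \<union> G)" by (simp add: F_def Un_ac)
    then show ?thesis using tot XT rF by (simp add: Un_commute)
  qed
  have extend: ?case if Y: "is_member Y" "r (X \<union> T \<union> Y) = r (X \<union> T) + r Y" for Y
  proof -
    have "\<exists>Fs'. length Fs' = length (Y # Fs) + length Gs \<and> (\<forall>Y\<in>set Fs'. is_member Y)
      \<and> r (X \<union> \<Union>(set Fs')) = r X + (\<Sum>Y\<leftarrow>Fs'. r Y)"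
    proof (rule Cons.IH)
      show "r (X \<union> \<Union>(set (Y # Fs)) \<union> \<Union>(set Gs)) = r X + (\<Sum>Y\<leftarrow>Y # Fs. r Y) + (\<Sum>Y\<leftarrow>Gs. contract_rank r X Y)"
        using Y(2) XT by (simp add: T_def Un_ac)
    qed (use Cons.prems Y in auto)
    then show ?thesis by simp
  qed
  have "liftable X G" using Cons.prems by auto
  then have "touched r V X F \<or> (\<exists>L. is_filament L \<and> L \<subseteq> F \<and> r (L \<union> X) = r X + 2)"
    unfolding liftable_def F_def .
  then show ?case
  proof
    assume t: "touched r V X F"
    obtain v where v: "v \<in> V" "v \<notin> cl (T \<union> X)" by (rule touched_exchange[OF t rF(2) TF])
    have "r {v} = 1" using v by (simp add: good_def)
    then have "r (X \<union> T \<union> {v}) = r (X \<union> T) + r {v}" using r_insert_notin[OF v(2)] by (simp add: Un_commute)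
    then show ?case using v by (intro extend[of "{v}"]) (auto simp: member_def)
  next
    assume "\<exists>L. is_filament L \<and> L \<subseteq> F \<and> r (L \<union> X) = r X + 2"
    then obtain L where L: "is_filament L" "L \<subseteq> F" "r (L \<union> X) = r X + 2" by blast
    have rL: "r L = 2" using L by (simp add: filament_line_def)
    have "r (T \<union> F) + r (L \<union> X) \<le> r (X \<union> T \<union> L) + r F" by (rule submod_le) (use L rF in auto)
    then have "r (X \<union> T \<union> L) = r (X \<union> T) + r L"
      using TF L rL r_union_le[of "X \<union> T" L] by (simp add: Un_commute)
    then show ?case using L by (intro extend[of L]) (auto simp: member_def)
  qed
qed

text \<open>The lifted members are skew to \<open>X\<close>, so one member inside \<open>X\<close>
  can be added. For a filament this is all of \<open>X\<close>, for a loss line only its good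
  point.\<close>

lemma lift_family:
  assumes "\<And>G. G \<in> set Gs \<Longrightarrow> liftable X G" "contract_rank r X (\<Union>(set Gs)) = (\<Sum>Y\<leftarrow>Gs. contract_rank r X Y)" "X0 \<subseteq> X" "is_member X0"
  shows "\<exists>Fs. length Fs = length Gs + 1 \<and> (\<forall>Y\<in>set Fs. is_member Y) \<and> r (\<Union>(set Fs)) = (\<Sum>Y\<leftarrow>Fs. r Y)"
proof -
  obtain Fs where Fs: "length Fs = length Gs" "\<forall>Y\<in>set Fs. is_member Y" "r (X \<union> \<Union>(set Fs)) = r X + (\<Sum>Y\<leftarrow>Fs. r Y)"
    using lift_family_aux[OF assms(1), of Gs "[]"] assms(2) by (auto simp: contract_rank_def Un_commute)
  show ?thesis
    using skew_sub[OF Fs(3) assms(3)] Fs assms(4) by (intro exI[of _ "X0 # Fs"]) auto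
qed

lemma nm_rank: assumes "is_minor_after X" shows "r X + rN EN \<le> r UNIV"
proof -
  obtain C g where C: "X \<subseteq> C" "is_embedding C g" using assms by (auto simp: minor_after_def)
  then have "rN EN + r C \<le> r UNIV" using embD[OF C(2), of EN] r_le_UNIV[of "g ` EN \<union> C"] by simp
  then show ?thesis using r_mono[OF C(1)] by linarith
qed

lemma ctr_three_points:
  assumes t: "three_points (contract_rank r X) F" and F: "F = X \<union> Y"
  shows "three_points r Y"
proof -
  interpret c: matroid_rank "contract_rank r X" E by (rule ctr_rank)
  obtain a b d where abd: "a \<in> F" "b \<in> F" "d \<in> F" "contract_rank r X {a} = 1" "b \<notin> cl ({a} \<union> X)" "d \<notin> cl ({a} \<union> X)"
    "d \<notin> cl ({b} \<union> X)" using t by (auto simp: three_points_def clos_ctr)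
  have "a \<notin> X" using abd(4) by (auto simp: contract_rank_def insert_absorb)
  moreover have "b \<notin> X" "d \<notin> X" using abd subset_cl[of "{a} \<union> X"] by auto
  moreover have "b \<notin> cl {a}" "d \<notin> cl {a}" "d \<notin> cl {b}"
    using abd cl_mono[of "{a}" "{a} \<union> X"] cl_mono[of "{b}" "{b} \<union> X"] by auto
  moreover have "r {a} = 1"
    using abd(4) r_single_le[of a] r_union_le[of "{a}" X] by (simp add: contract_rank_def)
  ultimately show ?thesis using abd F unfolding three_points_def by blast
qed

text \<open>If \<open>F\<close> is not touched, \<open>fil_lift_core\<close> leaves a flat
  \<open>Y\<close> skew to \<open>L\<close>. It inherits contractibility, and it is a good point or
  a filament according to \<open>G\<close>.\<close>

lemma fil_liftable:
  assumes L: "is_filament L" and G: "member (contract_rank r L) rN EN G"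
  shows "liftable L G"
proof (rule ccontr)
  assume n: "\<not> ?thesis"
  define F where "F = cl (G \<union> L)"
  have L': "flt L" "r L = 2" "\<And>y. y \<in> L \<Longrightarrow> \<not> is_good y" using L by (auto simp: filament_line_def)
  have F: "flt F" "L \<subseteq> F" "G \<subseteq> F" using subset_cl[of "G \<union> L"] by (auto simp: F_def)
  have nt: "\<not> touched r V L F" using n by (simp add: liftable_def F_def)
  have out: "\<not> is_good v" if "v \<in> F" for v
    using touched_element[of v V F L] nt that L' by (auto simp: flat_def)
  have contractible: "is_contractible (L \<union> G)" using G by (auto simp: member_def good_def filament_line_def con_ctr)
  then have conF: "is_contractible F" using con_cong[of "L \<union> G" F] by (simp add: F_def Un_commute)
  then have "vert_conn r F" by (simp add: contractible_def)
  from fil_lift_core[OF L F(1,2) this] nt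
  obtain Y where Y: "flt Y" "Y \<subseteq> F" "F = L \<union> Y" "r F = r Y + 2" "vert_conn r Y" by auto
  have nY: "is_minor_after S" if "S \<subseteq> Y" for S using con_mono_nm[OF conF, of S] that Y by auto
  from G show False unfolding member_def
  proof
    assume "\<exists>v. G = {v} \<and> good (contract_rank r L) rN EN v"
    then obtain z where z: "G = {z}" "contract_rank r L {z} = 1" by (auto simp: good_def)
    have rF: "r F = 3" using z L' by (simp add: F_def contract_rank_def)
    have zL: "z \<notin> L" using z by (auto simp: contract_rank_def insert_absorb)
    then have zY: "z \<in> Y" using F z Y by auto
    have z1: "r {z} = 1" using notin_flat_nonloop[OF L'(1) zL] .
    have "cl {z} = Y" using Y rF zY z1 by (intro flat_spanned) auto
    then have "vert_conn r {z}" using vc_cl[of "{z}"] Y by simp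
    then have "is_good z" using nY[of "{z}"] zY z1 by (auto simp: good_def contractible_def)
    then show False using out zY Y by auto
  next
    assume f: "filament_line (contract_rank r L) rN EN G"
    then have G': "flt G" "L \<subseteq> G" "contract_rank r L G = 2" "three_points (contract_rank r L) G" by (auto simp: filament_line_def flat_ctr)
    have GF: "F = G" using G' by (simp add: F_def Un_absorb2 flat_def)
    have rF: "r F = 4" using G' L' GF by (simp add: contract_rank_def Un_absorb2)
    have "is_filament Y" unfolding filament_line_def
      using Y rF nY[of Y] ctr_three_points[OF G'(4)] GF out by (auto simp: contractible_def)
    moreover have "r (Y \<union> L) = r L + 2" using Y rF L' by (simp add: Un_commute)
    ultimately show False using n Y unfolding liftable_def F_def[symmetric] by blast
  qed
qed

lemma loss_line_span:
  assumes k: "loss_line K u p vp Hp q vq Hq"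
  shows "cl {u, p} = K" "u \<notin> cl {p}" "p \<notin> cl {u}" "p \<in> K"
proof -
  have K: "flt K" "r K = 2" "is_good u" "u \<in> K" "p \<notin> cl V" "r {p} = 1" using k by (auto simp: loss_line_def)
  show p: "p \<in> K" using k wing_point[of K p vp Hp] by (auto simp: loss_line_def)
  show pu: "p \<notin> cl {u}" using K(5) cl_mono[of "{u}" V] K(3) by auto
  show "u \<notin> cl {p}" using nonpar_sym[OF pu] K(3) by (simp add: good_def)
  show "cl {u, p} = K" using line_span[OF K(1,2,4) p _ pu] K(3) by (simp add: good_def)
qed

lemma loss_line_liftable:
  assumes nofil: "\<nexists>L. is_filament L" and k: "loss_line K u p vp Hp q vq Hq" and G: "member (contract_rank r K) rN EN G"
  shows "liftable K G"
proof -
  have K: "flt K" "r K = 2" "is_contractible K" "is_good u" "u \<in> K" "r {p} = 1" using k by (auto simp: loss_line_def)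
  note up = loss_line_span[OF k]
  from G show ?thesis unfolding member_def
  proof
    assume "\<exists>v. G = {v} \<and> good (contract_rank r K) rN EN v"
    then obtain z where z: "G = {z}" "contract_rank r K {z} = 1" "is_contractible (insert z K)" by (auto simp: good_def con_ctr)
    have "z \<notin> K" using z by (auto simp: contract_rank_def insert_absorb)
    then show ?thesis using loss_line_touched[OF k _ z(3)] z by (simp add: liftable_def)
  next
    assume f: "filament_line (contract_rank r K) rN EN G"
    then have G': "flt G" "K \<subseteq> G" by (auto simp: filament_line_def flat_ctr)
    have GF: "cl (G \<union> K) = G" using G' by (simp add: Un_absorb2 flat_def)
    have Kc: "cl K = K" using K by (simp add: flat_def)
    have u: "r {u} = 1" "vert_conn r {u}" using K by (auto simp: good_def contractible_def)
    interpret c: conn_minor "contract_rank r {u}" E rN EN by (rule ctr_conn[OF u(2)])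
    \<comment> \<open>\<open>M/K\<close> is obtained from \<open>M/u\<close> by contracting
      \<open>p\<close>, so the filament is lifted in two steps, to \<open>M/u\<close> and then to
      \<open>M\<close>.\<close>
    have cc: "contract_rank (contract_rank r {u}) {p} = contract_rank r K"
      using ctr_cl[of "{u, p}"] up by (simp add: ctr_ctr insert_commute)
    have p1: "contract_rank r {u} {p} = 1" using r_pair[OF u(1) up(3)] u by (simp add: contract_rank_def insert_commute)
    have vp: "vert_conn (contract_rank r {u}) {p}" using vc_cl[of "{u, p}"] up K(3) by (simp add: vc_ctr contractible_def insert_commute)
    have clp: "rank_closure (contract_rank r {u}) {p} = K" using up by (simp add: clos_ctr insert_commute)
    have "(\<exists>s\<in>G. s \<notin> K \<and> good (contract_rank r {u}) rN EN s) \<or> (\<exists>L. filament_line (contract_rank r {u}) rN EN L \<and> L \<subseteq> G \<and> p \<notin> L)"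
      using c.fil_lift_point[OF p1 vp, of G] f cc clp by simp
    then have "touched r V K G"
    proof
      assume "\<exists>s\<in>G. s \<notin> K \<and> good (contract_rank r {u}) rN EN s"
      then obtain s where s: "s \<in> G" "s \<notin> K" "is_contractible {u, s}" by (auto simp: good_def con_ctr insert_commute)
      have "cl {u} \<subseteq> K" using cl_least[of "{u}" K] K by auto
      then have "s \<in> cl (V \<union> K)" using loss_line_point[OF nofil k s(3)] s by blast
      then show ?thesis using touched_cl[of s V K G] s G' Kc by simp
    next
      assume "\<exists>L. filament_line (contract_rank r {u}) rN EN L \<and> L \<subseteq> G \<and> p \<notin> L"
      then obtain L where L: "filament_line (contract_rank r {u}) rN EN L" "L \<subseteq> G" "p \<notin> L" by blast
      have fL: "flt L" "u \<in> L" using L(1) by (auto simp: filament_line_def flat_ctr)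
      obtain s where s: "s \<in> L" "s \<notin> cl {u}" "is_good s" using fil_lift_point[OF u L(1)] nofil by blast
      have "K \<inter> L = cl {u}" using line_meet[OF K(1,2) fL(1) _ K(5) fL(2) u(1)] L(3) up by auto
      then have "s \<notin> K" using s by auto
      then show ?thesis using touched_element[of s V G K] s L Kc by auto
    qed
    then show ?thesis by (simp add: liftable_def GF)
  qed
qed

lemma point_liftable:
  assumes nofil: "\<nexists>L. is_filament L" and x: "is_good x" and noloss: "\<And>y. good (contract_rank r {x}) rN EN y \<Longrightarrow> y \<in> cl V"
    and G: "member (contract_rank r {x}) rN EN G"
  shows "liftable {x} G"
proof -
  have x1: "r {x} = 1" "vert_conn r {x}" using x by (auto simp: good_def contractible_def)
  from G have "touched r V {x} (cl (G \<union> {x}))" unfolding member_def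
  proof
    assume "\<exists>v. G = {v} \<and> good (contract_rank r {x}) rN EN v"
    then obtain z where z: "G = {z}" "good (contract_rank r {x}) rN EN z" by auto
    have "z \<notin> cl {x}" using z(2) by (auto simp: good_def contract_rank_def in_cl_iff insert_commute)
    moreover have "z \<in> cl (V \<union> {x})" using noloss[OF z(2)] cl_mono[of V "V \<union> {x}"] by auto
    ultimately show ?thesis using z subset_cl[of "G \<union> {x}"] by (intro touched_cl[of z]) auto
  next
    assume f: "filament_line (contract_rank r {x}) rN EN G"
    then have G': "flt G" "x \<in> G" by (auto simp: filament_line_def flat_ctr)
    obtain s where "s \<in> G" "s \<notin> cl {x}" "is_good s" using fil_lift_point[OF x1 f] nofil by blast
    then show ?thesis using subset_cl[of "G \<union> {x}"] by (intro touched_element[of s]) auto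
  qed
  then show ?thesis by (simp add: liftable_def)
qed

end

text \<open>Only the rank function varies in the induction, since all contractions keep
  \<open>E\<close>. The sum of ranks encodes freeness.\<close>

theorem free_members:
  assumes "conn_minor r E rN EN" "minor_after r rN EN {}"
  shows "\<exists>Fs. bound (nat (r UNIV - rN EN)) \<le> length Fs \<and> (\<forall>Y\<in>set Fs. member r rN EN Y) \<and> r (\<Union>(set Fs)) = (\<Sum>Y\<leftarrow>Fs. r Y)"
  using assms
proof (induction "nat (r UNIV - rN EN)" arbitrary: r rule: less_induct)
  case (less r)
  interpret conn_minor r E rN EN by (rule less.prems)
  define k where "k = nat (r UNIV - rN EN)"
  have R: "rN EN \<le> r UNIV" using nm_rank[OF less.prems(2)] r_empty by simp
  have IH: "\<exists>Gs. bound (k - nat (r X)) \<le> length Gs \<and> (\<forall>Y\<in>set Gs. member (contract_rank r X) rN EN Y)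
      \<and> contract_rank r X (\<Union>(set Gs)) = (\<Sum>Y\<leftarrow>Gs. contract_rank r X Y)" if X: "is_contractible X" "1 \<le> r X" for X
  proof -
    have "r X + rN EN \<le> r UNIV" using nm_rank X by (simp add: contractible_def)
    moreover have cR: "contract_rank r X UNIV = r UNIV - r X" by (simp add: contract_rank_def)
    ultimately have "nat (contract_rank r X UNIV - rN EN) = k - nat (r X)" "k - nat (r X) < k" using X by (auto simp: k_def)
    then show ?thesis using less.hyps[of "contract_rank r X"] ctr_conn[of X] X nm_ctr[of X "{}"] by (simp add: contractible_def k_def)
  qed
  have done3: ?case if "\<forall>Y\<in>set Fs. is_member Y" "r (\<Union>(set Fs)) = (\<Sum>Y\<leftarrow>Fs. r Y)" "bound k \<le> length Fs" for Fs
    using that by (auto simp: k_def)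
  show ?case
  proof (cases "k = 0")
    case True then show ?thesis using r_empty by (intro done3[of "[]"]) (auto simp: bound_def)
  next
    case k1: False
    show ?thesis
    proof (cases "\<exists>L. is_filament L")
      case True
      then obtain L where L: "is_filament L" by blast
      have L': "flt L" "r L = 2" "is_contractible L" "three_points r L" using L by (auto simp: filament_line_def)
      have k2: "2 \<le> k" using nm_rank[of L] L' by (simp add: contractible_def k_def)
      show ?thesis
      proof (cases "k \<le> 3")
        case True
        \<comment> \<open>For \<open>k = 2, 3\<close> a family of \<open>M/L\<close> would be one
          member short; the tips at two points of \<open>L\<close> fill the gap.\<close>
        obtain a b where ab: "a \<in> L" "b \<in> L" "r {a} = 1" "b \<notin> cl {a}" using L'(4) by (auto simp: three_points_def)
        have b1: "r {b} = 1" using nonpar_nonloop[OF ab(4)] .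
        obtain c H where c: "wing r L a c H" "is_good c" "4 \<le> r UNIV" using fil_wing[OF L ab(1,3)] by blast
        obtain d H' where d: "wing r L b d H'" "is_good d" using fil_wing[OF L ab(2) b1] by blast
        have "r (L \<union> {d, c}) = 4" by (rule wing_distinct[OF L'(1,2) d(1) c(1) ab(4) c(3)])
        moreover have "\<Union>(set [L, {c}, {d}]) = L \<union> {d, c}" by auto
        ultimately have "r (\<Union>(set [L, {c}, {d}])) = (\<Sum>Y\<leftarrow>[L, {c}, {d}]. r Y)"
          using c(2) d(2) L' by (simp add: good_def)
        then show ?thesis using c(2) d(2) L True
          by (intro done3[of "[L, {c}, {d}]"]) (auto simp: member_def bound_def)
      next
        case k4: False
        obtain Gs where Gs: "bound (k - 2) \<le> length Gs" "\<forall>Y\<in>set Gs. member (contract_rank r L) rN EN Y"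
          "contract_rank r L (\<Union>(set Gs)) = (\<Sum>Y\<leftarrow>Gs. contract_rank r L Y)" using IH[of L] L' by auto
        have "bound k = bound (k - 2) + 1" using k4 by (auto simp: bound_def)
        moreover obtain Fs where "length Fs = length Gs + 1" "\<forall>Y\<in>set Fs. is_member Y" "r (\<Union>(set Fs)) = (\<Sum>Y\<leftarrow>Fs. r Y)"
          using lift_family[OF fil_liftable[OF L] Gs(3), of L] Gs(2) L by (auto simp: member_def)
        ultimately show ?thesis using Gs(1) by (intro done3[of Fs]) auto
      qed
    next
      case nofil: False
      obtain x where x: "is_good x" using exists_good[OF less.prems(2)] k1 by (auto simp: k_def)
      show ?thesis
      \<comment> \<open>If no element is lost in this way, contracting a point suffices. A lost
        element leads to a loss line, over which exchanges are possible again.\<close>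
      proof (cases "\<exists>x y. is_good x \<and> good (contract_rank r {x}) rN EN y \<and> y \<notin> cl V")
        case True
        then obtain x y where xy: "is_good x" "good (contract_rank r {x}) rN EN y" "y \<notin> cl V" by blast
        have "is_contractible {x, y}" "y \<notin> cl {x}"
          using xy(2) by (auto simp: good_def con_ctr insert_commute contract_rank_def in_cl_iff)
        then obtain K u p vp Hp q vq Hq where K: "loss_line K u p vp Hp q vq Hq"
          using loss_line_exists[OF nofil xy(1) _ _ xy(3)] by metis
        have K': "flt K" "r K = 2" "is_contractible K" "is_good u" "u \<in> K" "is_good vp" "is_good vq" "wing r K p vp Hp" "wing r K q vq Hq"
          "p \<notin> cl {q}" "4 \<le> r UNIV" using K by (auto simp: loss_line_def)
        have u1: "r {u} = 1" using K' by (simp add: good_def)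
        have k2: "2 \<le> k" using nm_rank[of K] K' by (simp add: contractible_def k_def)
        show ?thesis
        proof (cases "k \<le> 3")
          case True
          \<comment> \<open>\<open>K\<close> is spanned by \<open>u\<close> and \<open>p\<close>;
            giving up \<open>p\<close> costs at most one dimension and leaves three independent good
            elements.\<close>
          have "r (K \<union> {vp, vq}) = 4" by (rule wing_distinct[OF K'(1,2,8-11)])
          moreover have "r (K \<union> {vp, vq}) = r ({u, p} \<union> {vp, vq})" using loss_line_span(1)[OF K] r_cl_Un(1)[of "{u, p}" "{vp, vq}"] by simp
          moreover have "{u, p} \<union> {vp, vq} = insert p {u, vp, vq}" by auto
          ultimately have "r {u, vp, vq} = 3"
            using r_insert_le[of p "{u, vp, vq}"] r_triple_le[of u vp vq] by simp
          moreover have "\<Union>(set [{u}, {vp}, {vq}]) = {u, vp, vq}" by auto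
          ultimately have "r (\<Union>(set [{u}, {vp}, {vq}])) = (\<Sum>Y\<leftarrow>[{u}, {vp}, {vq}]. r Y)"
            using K' by (simp add: good_def)
          then show ?thesis using K'(4,6,7) True
            by (intro done3[of "[{u}, {vp}, {vq}]"]) (auto simp: member_def bound_def)
        next
          case k4: False
          obtain Gs where Gs: "bound (k - 2) \<le> length Gs" "\<forall>Y\<in>set Gs. member (contract_rank r K) rN EN Y"
            "contract_rank r K (\<Union>(set Gs)) = (\<Sum>Y\<leftarrow>Gs. contract_rank r K Y)" using IH[of K] K' by auto
          have "bound k = bound (k - 2) + 1" using k4 by (auto simp: bound_def)
          moreover obtain Fs where "length Fs = length Gs + 1" "\<forall>Y\<in>set Fs. is_member Y" "r (\<Union>(set Fs)) = (\<Sum>Y\<leftarrow>Fs. r Y)"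
            using lift_family[OF loss_line_liftable[OF nofil K] Gs(3), of "{u}"] Gs(2) K' by (auto simp: member_def)
          ultimately show ?thesis using Gs(1) by (intro done3[of Fs]) auto
        qed
      next
        case False
        have x1: "r {x} = 1" "is_contractible {x}" using x by (auto simp: good_def)
        obtain Gs where Gs: "bound (k - 1) \<le> length Gs" "\<forall>Y\<in>set Gs. member (contract_rank r {x}) rN EN Y"
          "contract_rank r {x} (\<Union>(set Gs)) = (\<Sum>Y\<leftarrow>Gs. contract_rank r {x} Y)" using IH[of "{x}"] x1 by auto
        have "bound k \<le> bound (k - 1) + 1" using k1 by (auto simp: bound_def)
        moreover have "liftable {x} G" if "G \<in> set Gs" for G
          using point_liftable[OF nofil x] False x Gs(2) that by blast
        then obtain Fs where "length Fs = length Gs + 1" "\<forall>Y\<in>set Fs. is_member Y" "r (\<Union>(set Fs)) = (\<Sum>Y\<leftarrow>Fs. r Y)"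
          using lift_family[OF _ Gs(3), of "{x}"] x by (auto simp: member_def)
        ultimately show ?thesis using Gs(1) by (intro done3[of Fs]) auto
      qed
    qed
  qed
qed

section \<open>From matroids to rank functions\<close>

definition rank_matroid :: "('a set \<Rightarrow> int) \<Rightarrow> 'a set \<Rightarrow> 'a matroid" where
  "rank_matroid r E = \<lparr>carrier = E, indep = (\<lambda>I. I \<subseteq> E \<and> r I = int (card I))\<rparr>"

lemma rank_matroid_sel [simp]:
  "carrier (rank_matroid r E) = E" "indep (rank_matroid r E) I \<longleftrightarrow> I \<subseteq> E \<and> r I = int (card I)"
  by (simp_all add: rank_matroid_def)

lemma matroidD:
  assumes "matroid M"
  shows "finite (carrier M)" "indep M I \<Longrightarrow> I \<subseteq> carrier M" "indep M {}"
    "indep M J \<Longrightarrow> I \<subseteq> J \<Longrightarrow> indep M I"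
    "indep M I \<Longrightarrow> indep M J \<Longrightarrow> card I < card J \<Longrightarrow> \<exists>e\<in>J - I. indep M (insert e I)"
  using assms unfolding matroid_def by blast+

lemma finite_indeps: assumes "matroid M" shows "finite {I. I \<subseteq> X \<and> indep M I}"
  by (rule finite_subset[of _ "Pow (carrier M)"]) (use matroidD[OF assms] in auto)

lemma indep_finite: "matroid M \<Longrightarrow> indep M I \<Longrightarrow> finite I"
  using matroidD(1,2) finite_subset by metis

lemma card_le_rank: assumes "matroid M" "I \<subseteq> X" "indep M I" shows "card I \<le> rank M X"
  unfolding rank_def by (rule Max_ge) (use finite_indeps[OF assms(1)] assms in auto)

lemma rank_attained: assumes "matroid M" obtains I where "I \<subseteq> X" "indep M I" "card I = rank M X"
proof -
  have "{} \<in> {I. I \<subseteq> X \<and> indep M I}" using matroidD(3)[OF assms] by simp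
  then have "rank M X \<in> card ` {I. I \<subseteq> X \<and> indep M I}"
    unfolding rank_def using finite_indeps[OF assms] by (intro Max_in) auto
  then show ?thesis using that by auto
qed

lemma indep_extend:
  assumes M: "matroid M" and I: "I \<subseteq> X" "indep M I"
  obtains J where "I \<subseteq> J" "J \<subseteq> X" "indep M J" "card J = rank M X"
proof -
  let ?S = "{J. I \<subseteq> J \<and> J \<subseteq> X \<and> indep M J}"
  have "finite ?S" by (rule finite_subset[OF _ finite_indeps[OF M, of X]]) auto
  moreover have "I \<in> ?S" using I by auto
  ultimately have "Max (card ` ?S) \<in> card ` ?S" "\<forall>K\<in>?S. card K \<le> Max (card ` ?S)"
    by (auto intro!: Max_in simp del: mem_Collect_eq)
  then obtain J where J: "J \<in> ?S" "\<And>K. K \<in> ?S \<Longrightarrow> card K \<le> card J" by auto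
  have "card J = rank M X"
  proof (rule ccontr)
    assume "card J \<noteq> rank M X"
    then have "card J < rank M X" using card_le_rank[OF M, of J X] J(1) by auto
    moreover obtain B where B: "B \<subseteq> X" "indep M B" "card B = rank M X" using rank_attained[OF M] .
    ultimately obtain e where e: "e \<in> B - J" "indep M (insert e J)" using matroidD(5)[OF M, of J B] J(1) by auto
    then have "insert e J \<in> ?S" using J(1) B by auto
    then have "card (insert e J) \<le> card J" by (rule J(2))
    then show False using e indep_finite[OF M, of J] J(1) by auto
  qed
  then show ?thesis using that J(1) by auto
qed

lemma rank_eq_card: assumes "matroid M" "indep M I" shows "rank M I = card I"
proof -
  obtain J where "I \<subseteq> J" "J \<subseteq> I" "card J = rank M I" using indep_extend[OF assms(1) order.refl assms(2)] by metis
  then show ?thesis by simp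
qed

lemma matroid_rank_rank: assumes M: "matroid M" shows "matroid_rank (\<lambda>X. int (rank M X)) (carrier M)"
proof
  show "finite (carrier M)" using matroidD(1)[OF M] .
  fix A B :: "'a set" and e
  have "{I. I \<subseteq> A \<inter> carrier M \<and> indep M I} = {I. I \<subseteq> A \<and> indep M I}" using matroidD(2)[OF M] by blast
  then show "int (rank M (A \<inter> carrier M)) = int (rank M A)" by (simp add: rank_def)
  show "int (rank M {}) = 0" using rank_eq_card[OF M matroidD(3)[OF M]] by simp
  show mono: "int (rank M A) \<le> int (rank M B)" if "A \<subseteq> B" for A B
  proof -
    obtain I where "I \<subseteq> A" "indep M I" "card I = rank M A" using rank_attained[OF M] .
    then show ?thesis using card_le_rank[OF M, of I B] that by auto
  qed
  show "int (rank M (insert e A)) \<le> int (rank M A) + 1"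
  proof -
    obtain I where I: "I \<subseteq> insert e A" "indep M I" "card I = rank M (insert e A)" using rank_attained[OF M] .
    have "card (I - {e}) \<le> rank M A"
      using I matroidD(4)[OF M I(2), of "I - {e}"] by (intro card_le_rank[OF M]) auto
    then show ?thesis using I(3) by (cases "e \<in> I") auto
  qed
  show "int (rank M (A \<union> B)) + int (rank M (A \<inter> B)) \<le> int (rank M A) + int (rank M B)"
  proof -
    obtain I where I: "I \<subseteq> A \<inter> B" "indep M I" "card I = rank M (A \<inter> B)" using rank_attained[OF M] .
    then obtain K where K: "I \<subseteq> K" "K \<subseteq> A \<union> B" "indep M K" "card K = rank M (A \<union> B)"
      using indep_extend[OF M, of I "A \<union> B"] by blast
    have fK: "finite K" using indep_finite[OF M K(3)] .
    have "card (K \<inter> A) \<le> rank M A" "card (K \<inter> B) \<le> rank M B"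
      using matroidD(4)[OF M K(3)] by (auto intro!: card_le_rank[OF M])
    moreover have "K \<inter> A \<union> K \<inter> B = K" using K(2) by auto
    then have "card (K \<inter> A) + card (K \<inter> B) = card K + card (K \<inter> A \<inter> (K \<inter> B))"
      using fK card_Un_Int[of "K \<inter> A" "K \<inter> B"] by simp
    moreover have "card I \<le> card (K \<inter> A \<inter> (K \<inter> B))" using I K(1) fK by (intro card_mono) auto
    ultimately show ?thesis using K(4) I(3) by linarith
  qed
qed

lemma indep_iff_rank: assumes M: "matroid M" shows "indep M I \<longleftrightarrow> I \<subseteq> carrier M \<and> rank M I = card I"
proof
  assume "indep M I" then show "I \<subseteq> carrier M \<and> rank M I = card I" using rank_eq_card[OF M] matroidD(2)[OF M] by blast
next
  assume I: "I \<subseteq> carrier M \<and> rank M I = card I"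
  obtain J where J: "J \<subseteq> I" "indep M J" "card J = rank M I" using rank_attained[OF M] .
  have "finite I" using I matroidD(1)[OF M] finite_subset by blast
  then have "J = I" using J I by (intro card_subset_eq) auto
  then show "indep M I" using J by simp
qed

lemma rank_matroid_rank: assumes "matroid M" shows "rank_matroid (\<lambda>X. int (rank M X)) (carrier M) = M"
proof -
  have "(\<lambda>I. I \<subseteq> carrier M \<and> int (rank M I) = int (card I)) = indep M"
    using indep_iff_rank[OF assms] by (intro ext) auto
  then show ?thesis by (simp add: rank_matroid_def)
qed

context matroid_rank
begin

lemma r_le_card: "finite I \<Longrightarrow> r I \<le> int (card I)"
proof (induction I rule: finite_induct)
  case (insert e I) then show ?case using r_insert_le[of e I] by simp
qed (simp add: r_empty)

lemma card_subset: assumes "finite J" "r J = int (card J)" "I \<subseteq> J" shows "r I = int (card I)"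
proof -
  have fI: "finite I" using assms finite_subset by blast
  have "r J \<le> r I + r (J - I)" using r_union_le[of I "J - I"] assms(3) by (simp add: Un_absorb1)
  moreover have "r (J - I) \<le> int (card (J - I))" using assms by (intro r_le_card) auto
  moreover have "card J = card I + card (J - I)" using assms fI by (metis card_Diff_subset card_mono le_add_diff_inverse)
  ultimately show ?thesis using r_le_card[OF fI] assms(2) by linarith
qed

lemma matroid_rank_matroid: assumes "E' \<subseteq> E" shows "matroid (rank_matroid r E')"
  unfolding matroid_def rank_matroid_sel
proof (intro conjI allI impI)
  show fE: "finite E'" using assms finite_E finite_subset by blast
  show "r {} = int (card {})" by (simp add: r_empty)
  fix I J
  show "I \<subseteq> E'" if "I \<subseteq> E' \<and> r I = int (card I)" using that by simp
  show "I \<subseteq> E'" if "(J \<subseteq> E' \<and> r J = int (card J)) \<and> I \<subseteq> J" using that by auto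
  show "r I = int (card I)" if "(J \<subseteq> E' \<and> r J = int (card J)) \<and> I \<subseteq> J"
    using that card_subset[of J I] finite_subset[OF _ fE, of J] by auto
  show "\<exists>e\<in>J - I. insert e I \<subseteq> E' \<and> r (insert e I) = int (card (insert e I))"
    if h: "(I \<subseteq> E' \<and> r I = int (card I)) \<and> (J \<subseteq> E' \<and> r J = int (card J)) \<and> card I < card J"
  proof -
    have "\<not> J \<subseteq> cl I" using r_mono[of J "cl I"] h by auto
    then obtain e where e: "e \<in> J" "e \<notin> cl I" by auto
    have "e \<notin> I" using e subset_cl by auto
    moreover have "finite I" using h finite_subset[OF _ fE] by auto
    ultimately show ?thesis using r_insert_notin[OF e(2)] h e by (intro bexI[of _ e]) auto
  qed
qed auto

lemma rank_rank_matroid: assumes "E' \<subseteq> E" shows "int (rank (rank_matroid r E') Z) = r (Z \<inter> E')"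
proof -
  have M: "matroid (rank_matroid r E')" by (rule matroid_rank_matroid[OF assms])
  obtain I where I: "I \<subseteq> Z" "indep (rank_matroid r E') I" "card I = rank (rank_matroid r E') Z"
    using rank_attained[OF M] .
  have IE: "I \<subseteq> Z \<inter> E'" "r I = int (card I)" using I by auto
  have fI: "finite I" using indep_finite[OF M I(2)] .
  have "Z \<inter> E' \<subseteq> cl I"
  proof
    fix e assume e: "e \<in> Z \<inter> E'"
    show "e \<in> cl I"
    proof (rule ccontr)
      assume n: "e \<notin> cl I"
      then have "e \<notin> I" using subset_cl by auto
      then have "indep (rank_matroid r E') (insert e I)" using IE e fI r_insert_notin[OF n] by auto
      then have "card (insert e I) \<le> card I"
        unfolding I(3) using I e by (intro card_le_rank[OF M]) auto
      then show False using \<open>e \<notin> I\<close> fI by simp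
    qed
  qed
  then have "r (Z \<inter> E') = r I" using IE by (intro r_eq_if_subset_cl)
  then show ?thesis using IE I by simp
qed

lemma rank_rank_matroid_sub: "E' \<subseteq> E \<Longrightarrow> Z \<subseteq> E' \<Longrightarrow> int (rank (rank_matroid r E') Z) = r Z"
  using rank_rank_matroid[of E' Z] by (simp add: Int_absorb2)

lemma contract_rank_matroid:
  assumes "E' \<subseteq> E" "X \<subseteq> E'" shows "contract (rank_matroid r E') X = rank_matroid (contract_rank r X) (E' - X)"
proof -
  have "(I \<subseteq> E' - X \<and> rank (rank_matroid r E') (I \<union> X) = card I + rank (rank_matroid r E') X) \<longleftrightarrow>
      (I \<subseteq> E' - X \<and> contract_rank r X I = int (card I))" for I
  proof (cases "I \<subseteq> E' - X")
    case True
    then have "int (rank (rank_matroid r E') (I \<union> X)) = r (I \<union> X)" "int (rank (rank_matroid r E') X) = r X"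
      using assms by (auto intro!: rank_rank_matroid_sub)
    then show ?thesis by (auto simp: contract_rank_def)
  qed simp
  then show ?thesis by (simp add: contract_def rank_matroid_def)
qed

end

lemma delete_rank_matroid: "delete (rank_matroid r E) D = rank_matroid r (E - D)"
  unfolding delete_def rank_matroid_def by (intro matroid.equality) auto

lemma restrict_rank_matroid: "S \<subseteq> E \<Longrightarrow> restrict (rank_matroid r E) S = rank_matroid r S"
  unfolding restrict_def delete_rank_matroid by (simp add: double_diff)

section \<open>3-connectedness of a matroid as vertical connectivity\<close>

context matroid_rank
begin

lemma r_E: "r E = r UNIV"
  using r_carrier[of UNIV] by simp

lemma nonloop_in_E: assumes "r {e} = 1" shows "e \<in> E"
proof (rule ccontr)
  assume "e \<notin> E"
  then have "r {e} = r {}" using r_carrier[of "{e}"] by simp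
  then show False using assms r_empty by simp
qed

lemma k_separation_iff:
  assumes "E' \<subseteq> E"
  shows "k_separation (rank_matroid r E') k X \<longleftrightarrow>
    X \<subseteq> E' \<and> k \<le> card X \<and> k \<le> card (E' - X) \<and> r X + r (E' - X) < r E' + int k"
proof (cases "X \<subseteq> E'")
  case True
  have "int (rank (rank_matroid r E') X) = r X" "int (rank (rank_matroid r E') (E' - X)) = r (E' - X)"
    "int (rank (rank_matroid r E') E') = r E'" using rank_rank_matroid_sub[OF assms] True by auto
  then show ?thesis unfolding k_separation_def rank_matroid_sel by (auto simp flip: of_nat_less_iff[where 'a=int])
qed (simp add: k_separation_def)

lemma three_connected_no_sep:
  assumes "three_connected (rank_matroid r E)" "X \<subseteq> E" "k = 1 \<or> k = 2" "k \<le> card X" "k \<le> card (E - X)"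
  shows "r UNIV + int k \<le> r X + r (E - X)"
  using assms k_separation_iff[OF order.refl, of k X] r_E unfolding three_connected_def by fastforce

text \<open>Rank at least 2 excludes the small exceptions: a parallel pair is a 2-separation unless
  at most one element is left, and a single element left over would be a 1-separation.\<close>

lemma three_connected_simple:
  assumes t: "three_connected (rank_matroid r E)" and R: "2 \<le> r UNIV"
  shows "\<And>e. e \<in> E \<Longrightarrow> r {e} = 1" "\<And>e f. e \<in> E \<Longrightarrow> f \<in> E \<Longrightarrow> e \<noteq> f \<Longrightarrow> f \<notin> cl {e}" "vert_conn r {}"
proof -
  have one: "r UNIV + 1 \<le> r X + r (E - X)" if "X \<subseteq> E" "X \<noteq> {}" "X \<noteq> E" for X
  proof -
    have "card X \<noteq> 0" "card (E - X) \<noteq> 0"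
      using that finite_E finite_subset[OF that(1)] by (auto simp: card_eq_0_iff)
    then show ?thesis using three_connected_no_sep[OF t that(1), of 1] by simp
  qed
  have two: "r UNIV + 2 \<le> r X + r (E - X)" if "X \<subseteq> E" "2 \<le> card X" "2 \<le> card (E - X)" for X
    using three_connected_no_sep[OF t that(1), of 2] that by simp
  have sub: "r (E - X) \<le> r UNIV" for X by (rule r_le_UNIV)
  show nl: "r {e} = 1" if e: "e \<in> E" for e
  proof -
    have "{e} \<noteq> E" using r_E R r_single_le[of e] by auto
    then show ?thesis using one[of "{e}"] e sub[of "{e}"] r_single_le[of e] by auto
  qed
  show "f \<notin> cl {e}" if ef: "e \<in> E" "f \<in> E" "e \<noteq> f" for e f
  proof
    assume "f \<in> cl {e}"
    then have r1: "r {e, f} = 1" using nl[OF ef(1)] by (simp add: in_cl_iff insert_commute)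
    have "card (E - {e, f}) < 2"
      using two[of "{e, f}"] ef r1 sub[of "{e, f}"] by force
    then consider "card (E - {e, f}) = 0" | "card (E - {e, f}) = 1" by linarith
    then show False
    proof cases
      case 1
      then have "E - {e, f} = {}" using finite_E by simp
      then have "E = {e, f}" using ef by auto
      then show False using r1 R r_E by simp
    next
      case 2
      then obtain g where g: "E - {e, f} = {g}" by (auto simp: card_1_singleton_iff)
      then have gE: "g \<in> E" "E - {g} = {e, f}" using ef by auto
      then have "{g} \<noteq> E" using ef by auto
      then show False using one[of "{g}"] gE r1 r_single_le[of g] R by auto
    qed
  qed
  show "vert_conn r {}" unfolding vert_conn_def
  proof (intro allI impI)
    fix A B :: "'a set" assume AB: "A \<union> B = UNIV" "r A < r UNIV" "r B < r UNIV"
    define Z where "Z = A \<inter> E"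
    define W where "W = E - Z"
    have rZ: "r Z = r A" by (simp add: Z_def r_carrier)
    have WB: "W \<subseteq> B" using AB(1) by (auto simp: W_def Z_def)
    have rW: "r W \<le> r B" by (rule r_mono[OF WB])
    have tot: "r UNIV \<le> r Z + r W" using r_union_le[of Z W] r_E by (simp add: W_def Z_def Un_Diff_cancel Un_absorb1)
    have ZE: "Z \<subseteq> E" "E - Z = W" "E - W = Z" by (auto simp: Z_def W_def)
    have ne: "Z \<noteq> {}" "W \<noteq> {}" using tot rZ rW AB r_empty by auto
    have ne': "Z \<noteq> E" using ne ZE by auto
    show "r UNIV + r {} + 2 \<le> r A + r B"
    proof (cases "2 \<le> card Z \<and> 2 \<le> card W")
      case True then show ?thesis using two[of Z] ZE rZ rW r_empty by auto
    next
      case False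
      have o: "r UNIV + 1 \<le> r Z + r W" using one[OF ZE(1) ne(1) ne'] ZE by simp
      \<comment> \<open>The cardinality conditions of a separation may fail; then a side has rank at
        most 1, and connectedness would make the other side spanning.\<close>
      have small: "r S \<le> 1" if "S \<subseteq> E" "\<not> 2 \<le> card S" for S
        using r_le_card[of S] that finite_subset[OF _ finite_E] by fastforce
      show ?thesis
      proof (cases "2 \<le> card Z")
        case True
        then have "r W \<le> 1" using small[of W] False by (auto simp: W_def)
        then show ?thesis using o rZ rW AB r_empty by linarith
      next
        case False
        then have "r Z \<le> 1" using small[OF ZE(1)] by auto
        then show ?thesis using o rZ rW AB r_empty by linarith
      qed
    qed
  qed
qed

end

section \<open>Simplifications as transversals of the parallel classes\<close>

locale simplification = matroid_rank +
  fixes S :: "'a set"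
  assumes S_carrier: "S \<subseteq> E"
    and S_nonloop: "s \<in> S \<Longrightarrow> r {s} = 1"
    and S_nonpar: "s \<in> S \<Longrightarrow> t \<in> S \<Longrightarrow> s \<noteq> t \<Longrightarrow> t \<notin> cl {s}"
    and S_rep: "r {e} = 1 \<Longrightarrow> \<exists>s\<in>S. cl {s} = cl {e}"
begin

lemma rep: assumes "e \<notin> cl {}" obtains s where "s \<in> S" "cl {s} = cl {e}"
  using S_rep[of e] notin_flat_nonloop[OF flat_cl assms] by blast

lemma cl_S: "cl (S \<inter> cl A) = cl A"
proof (rule cl_eqI)
  show "A \<subseteq> cl (S \<inter> cl A)"
  proof
    fix e assume e: "e \<in> A"
    show "e \<in> cl (S \<inter> cl A)"
    proof (cases "e \<in> cl {}")
      case True then show ?thesis using cl_mono[of "{}" "S \<inter> cl A"] by auto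
    next
      case False
      then obtain s where s: "s \<in> S" "cl {s} = cl {e}" by (rule rep)
      have "s \<in> cl A" using s in_cl_self[of s "{s}"] cl_mono[of "{e}" A] e by auto
      then have "cl {s} \<subseteq> cl (S \<inter> cl A)" using s by (intro cl_mono) auto
      then show ?thesis using s in_cl_self[of e "{e}"] by auto
    qed
  qed
qed auto

lemma r_S: "r S = r UNIV"
proof -
  have "cl UNIV = UNIV" using flat_UNIV by (simp add: flat_def)
  then have "cl S = UNIV" using cl_S[of UNIV] by simp
  then show ?thesis by (metis r_cl)
qed

text \<open>For \<open>k \<le> 2\<close>, a set of \<open>k\<close> elements of the simple set
  \<open>S\<close> has rank \<open>k\<close>. So in a \<open>k\<close>-separation neither closure
  spans, and the two closures form a forbidden cover.\<close>

lemma three_connected_S: assumes v: "vert_conn r {}" shows "three_connected (rank_matroid r S)"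
  unfolding three_connected_def
proof (intro conjI allI impI)
  show "matroid (rank_matroid r S)" by (rule matroid_rank_matroid[OF S_carrier])
  fix k :: nat and Z assume k: "1 \<le> k \<and> k < 3"
  show "\<not> k_separation (rank_matroid r S) k Z"
  proof
    assume "k_separation (rank_matroid r S) k Z"
    then have Z: "Z \<subseteq> S" "k \<le> card Z" "k \<le> card (S - Z)" "r Z + r (S - Z) < r UNIV + int k"
      using k_separation_iff[OF S_carrier] r_S by auto
    have big: "int k \<le> r W" if W: "W \<subseteq> S" "k \<le> card W" for W
    proof -
      have "W \<noteq> {}" using W k by auto
      then obtain s where s: "s \<in> W" by auto
      have s1: "r {s} = 1" using S_nonloop s W by auto
      have 1: "1 \<le> r W" using s1 r_mono[of "{s}" W] s by auto
      show ?thesis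
      proof (cases "k = 1")
        case False
        then have "W \<noteq> {s}" using W k by auto
        then obtain t where t: "t \<in> W" "t \<noteq> s" using s by auto
        have "r {s, t} = 2" using r_pair[OF s1 S_nonpar[of s t]] s t W by auto
        then show ?thesis using r_mono[of "{s, t}" W] s t False k by auto
      qed (use 1 in simp)
    qed
    have cov: "e \<in> cl Z \<or> e \<in> cl (S - Z)" for e
    proof (cases "e \<in> cl {}")
      case True then show ?thesis using cl_mono[of "{}" Z] by auto
    next
      case False
      then obtain s where "s \<in> S" "cl {s} = cl {e}" by (rule rep)
      then show ?thesis using cl_mono[of "{s}" Z] cl_mono[of "{s}" "S - Z"] in_cl_self[of e "{e}"] by auto
    qed
    have "r (cl Z) < r UNIV" "r (cl (S - Z)) < r UNIV" using big[of Z] big[of "S - Z"] Z by auto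
    then have "r UNIV + r {} + 2 \<le> r (cl Z) + r (cl (S - Z))" by (intro vcD[OF v cov]) auto
    then show False using Z k r_empty by simp
  qed
qed

end

text \<open>In the application \<open>E'\<close> is the ground set after contraction of
  \<open>X\<close>. The contracted elements are still present as loops, so the representatives
  chosen by \<open>rp\<close> avoid them.\<close>

lemma simplification_exists:
  assumes "matroid_rank r E" "E' \<subseteq> E" "\<And>e. r {e} = 1 \<Longrightarrow> e \<in> E'"
  obtains S where "simplification r E S" "S \<subseteq> E'" "simplification_set (rank_matroid r E') S"
proof -
  interpret matroid_rank r E by (rule assms(1))
  define rp where "rp = (\<lambda>F. SOME s. r {s} = 1 \<and> cl {s} = F)"
  define S where "S = rp ` {cl {e} |e. r {e} = 1}"
  have rp: "r {rp (cl {e})} = 1" "cl {rp (cl {e})} = cl {e}" if "r {e} = 1" for e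
    using someI[of "\<lambda>s. r {s} = 1 \<and> cl {s} = cl {e}" e] that by (auto simp: rp_def)
  have S: "r {s} = 1 \<and> rp (cl {s}) = s" if s: "s \<in> S" for s
  proof -
    obtain e where "r {e} = 1" "s = rp (cl {e})" using s by (auto simp: S_def)
    then show ?thesis using rp[of e] by simp
  qed
  have eq: "cl {s} = cl {e}" if "s \<in> cl {e}" "r {s} = 1" for s e
    using that par_sym[OF that] by (intro cl_eqI) auto
  have simp: "simplification r E S"
  proof
    show "S \<subseteq> E" using S assms by auto
    show "r {s} = 1" if "s \<in> S" for s using S that by simp
    show "t \<notin> cl {s}" if "s \<in> S" "t \<in> S" "s \<noteq> t" for s t
      using S[OF that(1)] S[OF that(2)] eq[of t s] that(3) by auto
    show "\<exists>s\<in>S. cl {s} = cl {e}" if "r {e} = 1" for e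
      using rp[OF that] that by (intro bexI[of _ "rp (cl {e})"]) (auto simp: S_def)
  qed
  have SE: "S \<subseteq> E'" using S assms(3) by auto
  have lp: "\<not> loop (rank_matroid r E') e \<longleftrightarrow> r {e} = 1" if "e \<in> E'" for e
    using that by (auto simp: loop_def)
  have "simplification_set (rank_matroid r E') S" unfolding simplification_set_def
  proof (intro conjI ballI impI)
    show "S \<subseteq> {e \<in> carrier (rank_matroid r E'). \<not> loop (rank_matroid r E') e}"
      using S SE lp by auto
    fix e assume e: "e \<in> carrier (rank_matroid r E')" "\<not> loop (rank_matroid r E') e"
    then have eE: "e \<in> E'" "r {e} = 1" using lp by auto
    have iff: "rank (rank_matroid r E') {e, s} = 1 \<longleftrightarrow> cl {s} = cl {e}" if s: "s \<in> S" for s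
    proof -
      have "int (rank (rank_matroid r E') {e, s}) = r {e, s}"
        using rank_rank_matroid_sub[OF assms(2)] eE s SE by auto
      moreover have "r {e, s} = 1 \<longleftrightarrow> s \<in> cl {e}" using eE by (simp add: in_cl_iff insert_commute)
      moreover have "s \<in> cl {e} \<longleftrightarrow> cl {s} = cl {e}" using eq[of s e] S[OF s] in_cl_self[of s "{s}"] by auto
      ultimately show ?thesis by linarith
    qed
    show "\<exists>!s. s \<in> S \<and> rank (rank_matroid r E') {e, s} = 1"
    proof (rule ex1I[of _ "rp (cl {e})"])
      have m: "rp (cl {e}) \<in> S" using eE by (auto simp: S_def)
      then show "rp (cl {e}) \<in> S \<and> rank (rank_matroid r E') {e, rp (cl {e})} = 1" using iff[OF m] rp eE by simp
      show "s = rp (cl {e})" if "s \<in> S \<and> rank (rank_matroid r E') {e, s} = 1" for s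
        using that iff[of s] S[of s] by auto
    qed
  qed
  then show ?thesis using that simp SE by blast
qed

section \<open>Minors and embeddings\<close>

lemma iso_rank:
  assumes f: "bij_betw f (carrier M) (carrier N)" "\<And>X. X \<subseteq> carrier M \<Longrightarrow> indep M X \<longleftrightarrow> indep N (f ` X)" and Z: "Z \<subseteq> carrier M"
  shows "rank N (f ` Z) = rank M Z"
proof -
  have inj: "inj_on f Z" using f(1) Z by (auto simp: bij_betw_def intro: inj_on_subset)
  have "card ` {I. I \<subseteq> f ` Z \<and> indep N I} = card ` {I. I \<subseteq> Z \<and> indep M I}" (is "?A = ?B")
  proof (intro subset_antisym subsetI)
    fix n assume "n \<in> ?A"
    then obtain I where I: "I \<subseteq> f ` Z" "indep N I" "n = card I" by auto
    then obtain J where J: "J \<subseteq> Z" "I = f ` J" by (auto simp: subset_image_iff)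
    have "card I = card J" using J inj by (simp add: card_image inj_on_subset)
    then show "n \<in> ?B" using I J f(2)[of J] Z by auto
  next
    fix n assume "n \<in> ?B"
    then obtain J where J: "J \<subseteq> Z" "indep M J" "n = card J" by auto
    have "card (f ` J) = card J" using J inj by (simp add: card_image inj_on_subset)
    then show "n \<in> ?A" using J f(2)[of J] Z by (intro image_eqI[of _ _ "f ` J"]) auto
  qed
  then show ?thesis by (simp add: rank_def)
qed

lemma has_minor_emb:
  assumes M: "matroid M" and h: "has_minor M N"
  shows "minor_after (\<lambda>X. int (rank M X)) (\<lambda>X. int (rank N X)) (carrier N) {}"
proof -
  define r where "r = (\<lambda>X. int (rank M X))"
  define E where "E = carrier M"
  interpret matroid_rank r E unfolding r_def E_def by (rule matroid_rank_rank[OF M])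
  have ME: "M = rank_matroid r E" using rank_matroid_rank[OF M] by (simp add: r_def E_def)
  obtain C D where CD: "C \<subseteq> E" "D \<subseteq> E" "iso (delete (contract M C) D) N"
    using h by (auto simp: has_minor_def E_def)
  interpret c: matroid_rank "contract_rank r C" E by (rule ctr_rank)
  let ?Q = "rank_matroid (contract_rank r C) (E - C - D)"
  have "delete (contract M C) D = ?Q"
    unfolding ME using contract_rank_matroid[OF order.refl CD(1)] by (simp add: delete_rank_matroid)
  then obtain f where f: "bij_betw f (carrier ?Q) (carrier N)" "\<And>X. X \<subseteq> carrier ?Q \<Longrightarrow> indep ?Q X \<longleftrightarrow> indep N (f ` X)"
    using CD(3) by (auto simp: iso_def)
  define g where "g = inv_into (E - C - D) f"
  have "minor_embedding r (\<lambda>X. int (rank N X)) (carrier N) C g" unfolding minor_embedding_def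
  proof (intro allI impI)
    fix Z assume Z: "Z \<subseteq> carrier N"
    have im: "f ` (E - C - D) = carrier N" using f(1) by (simp add: bij_betw_def)
    have g: "g e \<in> E - C - D" "f (g e) = e" if "e \<in> Z" for e
      using that Z im inv_into_into[of e f "E - C - D"] f_inv_into_f[of e f "E - C - D"] by (auto simp: g_def)
    have gZ: "g ` Z \<subseteq> E - C - D" using g by auto
    moreover have "f ` g ` Z = Z" using g(2) by (simp add: image_image)
    ultimately have gZ: "g ` Z \<subseteq> E - C - D" "f ` g ` Z = Z" by simp_all
    have "int (rank N Z) = int (rank ?Q (g ` Z))" using iso_rank[OF f, of "g ` Z"] gZ by simp
    also have "\<dots> = contract_rank r C (g ` Z)" using gZ by (intro c.rank_rank_matroid_sub) auto
    finally show "r (g ` Z \<union> C) = int (rank N Z) + r C" by (simp add: contract_rank_def)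
  qed
  then show ?thesis unfolding minor_after_def r_def by blast
qed

text \<open>An embedding is only sensitive to closures, so it can be moved into \<open>S\<close>:
  \<open>C\<close> is replaced by \<open>S \<inter> cl C\<close> and every image under
  \<open>g\<close> by its representative.\<close>

lemma (in simplification) has_minor_S:
  assumes N: "matroid N" and Ns: "\<And>Z. Z \<subseteq> carrier N \<Longrightarrow> card Z \<le> 2 \<Longrightarrow> rank N Z = card Z"
    and minor_after: "minor_after r (\<lambda>X. int (rank N X)) (carrier N) {}"
  shows "has_minor (rank_matroid r S) N"
proof -
  define EN where "EN = carrier N"
  obtain C g where em: "\<And>Z. Z \<subseteq> EN \<Longrightarrow> r (g ` Z \<union> C) = int (rank N Z) + r C"
    using minor_after by (auto simp: minor_after_def minor_embedding_def EN_def)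
  define C' where "C' = S \<inter> cl C"
  have clC: "cl C' = cl C" unfolding C'_def by (rule cl_S)
  have gC: "g e \<notin> cl C" if "e \<in> EN" for e
  proof -
    have "r (insert (g e) C) = r C + 1" using em[of "{e}"] Ns[of "{e}"] that by (simp add: EN_def)
    then show ?thesis by (simp add: in_cl_iff)
  qed
  have "\<exists>s. s \<in> S \<and> cl {s} = cl {g e}" if "e \<in> EN" for e
  proof -
    have "g e \<notin> cl {}" using gC[OF that] cl_mono[of "{}" C] by auto
    then show ?thesis by (rule rep) blast
  qed
  then obtain g' where g': "\<And>e. e \<in> EN \<Longrightarrow> g' e \<in> S" "\<And>e. e \<in> EN \<Longrightarrow> cl {g' e} = cl {g e}" by metis
  have em': "r (g' ` Z \<union> C') = int (rank N Z) + r C'" if Z: "Z \<subseteq> EN" for Z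
  proof -
    have sub: "A ` Z \<union> C1 \<subseteq> cl (B ` Z \<union> C2)" if "\<And>e. e \<in> EN \<Longrightarrow> cl {A e} = cl {B e}" "cl C1 = cl C2" for A B :: "'b \<Rightarrow> 'a" and C1 C2
    proof -
      have "A e \<in> cl (B ` Z \<union> C2)" if "e \<in> Z" for e
        using \<open>\<And>e. e \<in> EN \<Longrightarrow> cl {A e} = cl {B e}\<close>[of e] that Z cl_mono[of "{B e}" "B ` Z \<union> C2"] in_cl_self[of "A e" "{A e}"] by auto
      moreover have "C1 \<subseteq> cl (B ` Z \<union> C2)" using subset_cl[of C1] that(2) cl_mono[of C2 "B ` Z \<union> C2"] by auto
      ultimately show ?thesis by auto
    qed
    have "cl (g' ` Z \<union> C') = cl (g ` Z \<union> C)"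
      using sub[of g' g C' C] sub[of g g' C C'] g'(2) clC by (intro cl_eqI) auto
    then show ?thesis using em[OF Z] clC by (metis r_cl)
  qed
  have g'C: "g' e \<notin> C'" if "e \<in> EN" for e
    using em'[of "{e}"] Ns[of "{e}"] that by (auto simp: EN_def insert_absorb)
  have inj: "inj_on g' EN"
  proof (rule inj_onI, rule ccontr)
    fix e e' assume e: "e \<in> EN" "e' \<in> EN" "g' e = g' e'" "e \<noteq> e'"
    have "r (insert (g' e) C') = 2 + r C'" using em'[of "{e, e'}"] Ns[of "{e, e'}"] e by (simp add: EN_def)
    then show False using r_insert_le[of "g' e" C'] by simp
  qed
  define D' where "D' = S - C' - g' ` EN"
  have SD: "S - C' - D' = g' ` EN" using g'(1) g'C by (auto simp: D'_def)
  have CS: "C' \<subseteq> S" by (auto simp: C'_def)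
  have Q: "delete (contract (rank_matroid r S) C') D' = rank_matroid (contract_rank r C') (g' ` EN)"
    using contract_rank_matroid[OF S_carrier CS] SD by (simp add: delete_rank_matroid)
  have "iso (rank_matroid (contract_rank r C') (g' ` EN)) N" unfolding iso_def rank_matroid_sel
  proof (intro exI[of _ "inv_into EN g'"] conjI allI impI)
    show "bij_betw (inv_into EN g') (g' ` EN) (carrier N)"
      using inj by (simp add: EN_def bij_betw_inv_into inj_on_imp_bij_betw)
    fix X assume X: "X \<subseteq> g' ` EN"
    define Y where "Y = inv_into EN g' ` X"
    have "inv_into EN g' e \<in> EN" "g' (inv_into EN g' e) = e" if "e \<in> X" for e
      using that X inv_into_into[of e g' EN] f_inv_into_f[of e g' EN] by auto
    then have Y: "Y \<subseteq> EN" "g' ` Y = X" by (auto simp: Y_def image_image)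
    have "card X = card Y" using Y inj by (metis card_image inj_on_subset)
    moreover have "contract_rank r C' X = int (rank N Y)" using em'[OF Y(1)] Y by (simp add: contract_rank_def)
    ultimately show "(X \<subseteq> g' ` EN \<and> contract_rank r C' X = int (card X)) \<longleftrightarrow> indep N (inv_into EN g' ` X)"
      unfolding Y_def[symmetric] using indep_iff_rank[OF N, of Y] X Y(1) by (simp add: EN_def)
  qed
  then show ?thesis unfolding has_minor_def rank_matroid_sel
    using Q CS by (intro exI[of _ C'] exI[of _ D']) (auto simp: D'_def)
qed

lemma simple_rank:
  assumes N: "matroid N" and s: "simple N" and Z: "Z \<subseteq> carrier N" "card Z \<le> 2" shows "rank N Z = card Z"
proof (rule rank_eq_card[OF N], rule ccontr)
  assume "\<not> indep N Z"
  have fZ: "finite Z" using Z matroidD(1)[OF N] finite_subset by blast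
  then obtain C where C: "C \<subseteq> Z" "\<not> indep N C" "\<And>C'. C' \<subset> C \<Longrightarrow> indep N C'"
    using finite_minimal_subset[of Z "\<lambda>C. \<not> indep N C"] \<open>\<not> indep N Z\<close> by auto
  have "C - {x} \<subset> C" if "x \<in> C" for x using that by auto
  then have "circuit N C" unfolding circuit_def using C(1,2,3) Z(1) by auto
  then have "3 \<le> card C" using s by (simp add: simple_def)
  then show False using card_mono[OF fZ C(1)] Z by simp
qed

lemma minor_data:
  assumes M: "matroid M" and N: "three_connected N" "simple N"
  shows "matroid_minor (\<lambda>X. int (rank M X)) (carrier M) (\<lambda>X. int (rank N X)) (carrier N)"
proof -
  have mN: "matroid N" using N by (simp add: three_connected_def)
  interpret n: matroid_rank "\<lambda>X. int (rank N X)" "carrier N" by (rule matroid_rank_rank[OF mN])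
  have tN: "three_connected (rank_matroid (\<lambda>X. int (rank N X)) (carrier N))" using N rank_matroid_rank[OF mN] by simp
  show ?thesis unfolding matroid_minor_def matroid_minor_axioms_def
  proof (intro conjI allI impI)
    show "int (rank N Z) = int (card Z)" if "Z \<subseteq> carrier N" "card Z \<le> 2" for Z
      using simple_rank[OF mN N(2) that] by simp
    show "int (rank N (carrier N)) + 1 \<le> int (rank N Z) + int (rank N (carrier N - Z))"
      if "Z \<subseteq> carrier N" "Z \<noteq> {}" "Z \<noteq> carrier N" for Z
    proof -
      have "card Z \<noteq> 0" "card (carrier N - Z) \<noteq> 0"
        using that n.finite_E finite_subset[OF that(1)] by (auto simp: card_eq_0_iff)
      then show ?thesis using n.three_connected_no_sep[OF tN that(1), of 1] n.r_E by simp
    qed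
    show "int (rank N (carrier N)) + 2 \<le> int (rank N Z) + int (rank N (carrier N - Z))"
      if "Z \<subseteq> carrier N" "2 \<le> card Z" "2 \<le> card (carrier N - Z)" for Z
      using n.three_connected_no_sep[OF tN that(1), of 2] that n.r_E by simp
  qed (use matroid_rank_rank[OF M] n.finite_E n.r_mono in auto)
qed

lemma con_vert_contractible:
  assumes M: "matroid M" and N: "three_connected N" "simple N"
    and contractible: "contractible (\<lambda>X. int (rank M X)) (\<lambda>X. int (rank N X)) (carrier N) X" and X: "X \<subseteq> carrier M"
  shows "vert_contractible_set M N X"
proof -
  define r where "r = (\<lambda>X. int (rank M X))"
  define E where "E = carrier M"
  interpret matroid_minor r E "\<lambda>X. int (rank N X)" "carrier N"
    unfolding r_def E_def by (rule minor_data[OF M N])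
  have mN: "matroid N" using N by (simp add: three_connected_def)
  have ME: "M = rank_matroid r E" using rank_matroid_rank[OF M] by (simp add: r_def E_def)
  let ?q = "contract_rank r X"
  interpret c: matroid_minor ?q E "\<lambda>X. int (rank N X)" "carrier N" by (rule ctr_minor)
  have Q: "contract M X = rank_matroid ?q (E - X)"
    unfolding ME by (rule contract_rank_matroid) (use X in \<open>auto simp: E_def\<close>)
  have EX: "e \<in> E - X" if "?q {e} = 1" for e
    using c.nonloop_in_E[OF that] that by (auto simp: contract_rank_def insert_absorb)
  obtain S where S: "simplification ?q E S" "S \<subseteq> E - X" "simplification_set (rank_matroid ?q (E - X)) S"
    using simplification_exists[OF ctr_rank _ EX] by blast
  interpret s: simplification ?q E S by (rule S(1))
  have "contractible r (\<lambda>X. int (rank N X)) (carrier N) X" using contractible by (simp add: r_def)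
  then have v: "vert_conn ?q {}" "minor_after ?q (\<lambda>X. int (rank N X)) (carrier N) {}"
    by (simp_all add: vc_ctr nm_ctr contractible_def)
  have "three_connected (rank_matroid ?q S)" by (rule s.three_connected_S[OF v(1)])
  moreover have "has_minor (rank_matroid ?q S) N"
    by (rule s.has_minor_S[OF mN simple_rank[OF mN N(2)] v(2)])
  ultimately show ?thesis
    unfolding vert_contractible_set_def Q using S X by (auto simp: restrict_rank_matroid)
qed

section \<open>Cocircuits, and independence in skew families\<close>

context matroid_rank
begin

text \<open>A set is coindependent if its complement contains a basis. \<open>H\<close> contains
  none, but it does after any element is added.\<close>

lemma cocircuit_hyperplane:
  assumes H: "flt H" "r H = r UNIV - 1"
  shows "cocircuit (rank_matroid r E) (E - H)"
proof -
  have M: "matroid (rank_matroid r E)" by (rule matroid_rank_matroid) simp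
  have span: "r B = r UNIV" if B: "basis (rank_matroid r E) B" for B
  proof -
    have fB: "finite B" "B \<subseteq> E" "r B = int (card B)" using B finite_E finite_subset by (auto simp: basis_def)
    have "E \<subseteq> cl B"
    proof
      fix e assume e: "e \<in> E"
      show "e \<in> cl B"
      proof (rule ccontr)
        assume n: "e \<notin> cl B"
        then have "e \<notin> B" using subset_cl by auto
        then have "r (insert e B) = int (card (insert e B))" using r_insert_notin[OF n] fB by simp
        then have "indep (rank_matroid r E) (insert e B)" using fB e by simp
        then show False using B e \<open>e \<notin> B\<close> by (simp add: basis_def)
      qed
    qed
    then have "r E \<le> r (cl B)" by (rule r_mono)
    then show ?thesis using r_E r_le_UNIV[of B] by simp
  qed
  have bas: "\<exists>B. basis (rank_matroid r E) B \<and> B \<subseteq> X" if X: "X \<subseteq> E" "r X = r UNIV" for X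
  proof -
    obtain B where B: "B \<subseteq> X" "indep (rank_matroid r E) B" "card B = rank (rank_matroid r E) X" using rank_attained[OF M] .
    have rB: "r B = r UNIV" using B X rank_rank_matroid_sub[of E X] by auto
    have fB: "finite B" using indep_finite[OF M B(2)] .
    have "\<not> indep (rank_matroid r E) (insert e B)" if "e \<in> E - B" for e
      using r_le_UNIV[of "insert e B"] rB fB that B(2) by auto
    then show ?thesis using B by (auto simp: basis_def)
  qed
  have dual: "indep (dual (rank_matroid r E)) I \<longleftrightarrow> I \<subseteq> E \<and> (\<exists>B. basis (rank_matroid r E) B \<and> I \<inter> B = {})" for I
    by (simp add: dual_def)
  have "\<not> indep (dual (rank_matroid r E)) (E - H)"
  proof
    assume "indep (dual (rank_matroid r E)) (E - H)"
    then obtain B where B: "basis (rank_matroid r E) B" "(E - H) \<inter> B = {}" unfolding dual by blast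
    have "B \<subseteq> H" using B by (auto simp: basis_def)
    then show False using span[OF B(1)] r_mono[of B H] H by auto
  qed
  moreover have "indep (dual (rank_matroid r E)) (E - H - {x})" if x: "x \<in> E - H" for x
  proof -
    have "r (insert x H \<inter> E) = r UNIV" using flat_insert[OF H(1), of x] x H(2) r_carrier[of "insert x H"] by simp
    then obtain B where "basis (rank_matroid r E) B" "B \<subseteq> insert x H \<inter> E" using bas[of "insert x H \<inter> E"] by blast
    then show ?thesis unfolding dual by blast
  qed
  ultimately show ?thesis unfolding cocircuit_def circuit_def by (simp add: dual_def)
qed

lemma skew_inter:
  assumes "r (A \<union> B) = r A + r B" shows "r (A \<inter> B) = 0"
  using submod[of A B] assms r_nonneg[of "A \<inter> B"] by linarith

lemma skew_subsets:
  assumes "r (A \<union> B) = r A + r B" "A' \<subseteq> A" "B' \<subseteq> B" shows "r (A' \<union> B') = r A' + r B'"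
proof -
  have "r (A \<union> B) + r A' \<le> r A + r (A' \<union> B)" "r (A' \<union> B) + r B' \<le> r (A' \<union> B') + r B"
    by (rule submod_le; use assms in auto)+
  then show ?thesis using assms(1) r_union_le[of A' B'] by linarith
qed

lemma skew_Cons:
  assumes "r (\<Union>(set (Y # Fs))) = (\<Sum>Y\<leftarrow>Y # Fs. r Y)"
  shows "r (Y \<union> \<Union>(set Fs)) = r Y + r (\<Union>(set Fs))" "r (\<Union>(set Fs)) = (\<Sum>Y\<leftarrow>Fs. r Y)"
  using assms r_union_le[of Y "\<Union>(set Fs)"] r_Union_le[of "{}" Fs] r_empty by auto

lemma skew_take:
  assumes "r (\<Union>(set Fs)) = (\<Sum>Y\<leftarrow>Fs. r Y)" shows "r (\<Union>(set (take n Fs))) = (\<Sum>Y\<leftarrow>take n Fs. r Y)"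
proof -
  have eq: "Fs = take n Fs @ drop n Fs" by simp
  have "r (\<Union>(set Fs)) = r (\<Union>(set (take n Fs)) \<union> \<Union>(set (drop n Fs)))"
    by (metis Union_Un_distrib eq set_append)
  moreover have "(\<Sum>Y\<leftarrow>Fs. r Y) = (\<Sum>Y\<leftarrow>take n Fs. r Y) + (\<Sum>Y\<leftarrow>drop n Fs. r Y)"
    by (metis eq map_append sum_list_append)
  ultimately show ?thesis
    using assms r_Union_le[of "\<Union>(set (take n Fs))" "drop n Fs"] r_Union_le[of "{}" "take n Fs"] r_empty by simp
qed

text \<open>Distinctness comes from the positive ranks: a member occurring twice would be skew to
  itself.\<close>

lemma skew_distinct:
  assumes "r (\<Union>(set Fs)) = (\<Sum>Y\<leftarrow>Fs. r Y)" "\<And>Y. Y \<in> set Fs \<Longrightarrow> 1 \<le> r Y"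
  shows "distinct Fs \<and> (\<forall>Y\<in>set Fs. \<forall>Z\<in>set Fs. Y \<noteq> Z \<longrightarrow> r (Y \<inter> Z) = 0)"
  using assms
proof (induction Fs)
  case (Cons Y Fs)
  note sk = skew_Cons[OF Cons.prems(1)]
  have IH: "distinct Fs \<and> (\<forall>Y\<in>set Fs. \<forall>Z\<in>set Fs. Y \<noteq> Z \<longrightarrow> r (Y \<inter> Z) = 0)"
    using Cons.IH[OF sk(2)] Cons.prems(2) by simp
  have 0: "r (Y \<inter> Z) = 0" if "Z \<in> set Fs" for Z
  proof -
    have "r (Y \<inter> Z) \<le> r (Y \<inter> \<Union>(set Fs))" by (rule r_mono) (use that in auto)
    then show ?thesis using skew_inter[OF sk(1)] r_nonneg[of "Y \<inter> Z"] by simp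
  qed
  have "Y \<notin> set Fs" using 0[of Y] Cons.prems(2)[of Y] by auto
  then show ?case using IH 0 by (auto simp: Int_commute)
qed simp

lemma skew_indep:
  assumes "r (\<Union>(set Fs)) = (\<Sum>Y\<leftarrow>Fs. r Y)" "finite I" "I \<subseteq> \<Union>(set Fs)"
    "\<And>Y. Y \<in> set Fs \<Longrightarrow> r (I \<inter> Y) = int (card (I \<inter> Y))"
  shows "r I = int (card I)"
  using assms
proof (induction Fs arbitrary: I)
  case Nil then show ?case by (simp add: r_empty)
next
  case (Cons Y Fs)
  note sk = skew_Cons[OF Cons.prems(1)]
  let ?J = "I \<inter> \<Union>(set Fs)"
  have 0: "r (I \<inter> Y \<union> ?J) = r (I \<inter> Y) + r ?J" by (rule skew_subsets[OF sk(1)]) auto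
  have "r ?J = int (card ?J)"
  proof (rule Cons.IH[OF sk(2)])
    fix Z assume Z: "Z \<in> set Fs"
    then have "?J \<inter> Z = I \<inter> Z" by auto
    then show "r (?J \<inter> Z) = int (card (?J \<inter> Z))" using Cons.prems(4)[of Z] Z by simp
  qed (use Cons.prems in auto)
  moreover have "I \<inter> Y \<union> ?J = I" using Cons.prems(3) by auto
  moreover have "card (I \<inter> Y \<union> ?J) \<le> card (I \<inter> Y) + card ?J" by (rule card_Un_le)
  ultimately show ?case using 0 Cons.prems(4)[of Y] r_le_card[OF Cons.prems(2)] by simp
qed

end

section \<open>Filaments and free families of matroids\<close>

lemma conn_minor_data:
  assumes M: "three_connected M" "2 \<le> rk M" and N: "three_connected N" "simple N"
    and r: "r = (\<lambda>X. int (rank M X))" and E: "E = carrier M"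
  shows "conn_minor r E (\<lambda>X. int (rank N X)) (carrier N)" "three_connected (rank_matroid r E)"
    "2 \<le> r UNIV" "M = rank_matroid r E"
proof -
  have mM: "matroid M" using M by (simp add: three_connected_def)
  interpret matroid_minor r E "\<lambda>X. int (rank N X)" "carrier N"
    unfolding r E by (rule minor_data[OF mM N])
  show ME: "M = rank_matroid r E" using rank_matroid_rank[OF mM] by (simp add: r E)
  show R: "2 \<le> r UNIV" using M(2) r_E by (simp add: r E)
  show tM: "three_connected (rank_matroid r E)" using M(1) ME by simp
  show "conn_minor r E (\<lambda>X. int (rank N X)) (carrier N)"
    by (intro conn_minor.intro matroid_minor_axioms conn_minor_axioms.intro three_connected_simple(3)[OF tM R])
qed

text \<open>Distinct elements of the 3-connected \<open>M\<close> are not parallel, so the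
  complement in \<open>E\<close> of the hyperplane of a wing at \<open>e\<close> with tip
  \<open>x\<close> is exactly the cocircuit \<open>L - {e} \<union> {x}\<close>.\<close>

lemma filament_of_filam:
  assumes M: "matroid M" "three_connected M" "2 \<le> rk M" and N: "three_connected N" "simple N"
    and r: "r = (\<lambda>X. int (rank M X))" and E: "E = carrier M"
    and fil: "filament_line r (\<lambda>X. int (rank N X)) (carrier N) Y"
  shows "filament M N (Y \<inter> E)"
proof -
  note data = conn_minor_data[OF M(2,3) N r E]
  interpret conn_minor r E "\<lambda>X. int (rank N X)" "carrier N" by (rule data(1))
  note s = three_connected_simple[OF data(2,3)]
  note ME = data(4)
  have Y: "flt Y" "r Y = 2" "is_contractible Y" "three_points r Y" using fil by (auto simp: filament_line_def)
  define L where "L = Y \<inter> E"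
  have rL: "r L = 2" using Y by (simp add: L_def r_carrier)
  have clL: "cl L = Y" using Y rL by (intro flat_spanned) (auto simp: L_def)
  have conL: "is_contractible L" using con_cong[of L Y] clL Y by (simp add: flat_def)
  have LE: "L \<subseteq> E" "finite L" using finite_E by (auto simp: L_def)
  have single: "f = e" if "f \<in> cl {e}" "e \<in> E" "f \<in> E" for e f using s(2)[of e f] that by blast
  obtain a b c where abc: "a \<in> Y" "b \<in> Y" "c \<in> Y" "r {a} = 1" "b \<notin> cl {a}" "c \<notin> cl {a}" "c \<notin> cl {b}"
    using Y(4) by (auto simp: three_points_def)
  have "r {b} = 1" "r {c} = 1" using abc nonpar_nonloop by blast+
  then have "{a, b, c} \<subseteq> L" using abc nonloop_in_E by (auto simp: L_def)
  moreover have "a \<noteq> b" "a \<noteq> c" "b \<noteq> c" using abc in_cl_self[of a "{a}"] in_cl_self[of b "{b}"] by auto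
  then have "card {a, b, c} = 3" by simp
  ultimately have n3: "3 \<le> card L" using card_mono[OF LE(2)] by metis
  obtain y where y: "bij_betw y {..<card L} L" using ex_bij_betw_nat_finite[OF LE(2)] by (metis atLeast0LessThan)
  have "\<exists>x. cocircuit M (L - {e} \<union> {x})" if e: "e \<in> L" for e
  proof -
    have e1: "r {e} = 1" "e \<in> Y" "e \<in> E" using e s(1) by (auto simp: L_def)
    obtain x H where x: "wing r Y e x H" "is_good x" using fil_wing[OF fil e1(2,1)] by blast
    have xE: "x \<in> E" using x(2) nonloop_in_E by (simp add: good_def)
    have H: "flt H" "r H = r UNIV - 1" "H \<inter> Y = cl {e}" "x \<notin> H" using x(1) by (auto simp: wing_def)
    have "E - H = L - {e} \<union> {x}"
    proof (intro subset_antisym subsetI)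
      fix f assume f: "f \<in> E - H"
      have "f \<noteq> e" using f wing_point[OF x(1)] by auto
      then show "f \<in> L - {e} \<union> {x}" using wing_cover[OF x(1), of f] f single[of f x] xE by (auto simp: L_def)
    next
      fix f assume f: "f \<in> L - {e} \<union> {x}"
      then show "f \<in> E - H" using H single[of f e] e1 xE by (auto simp: L_def)
    qed
    then show ?thesis using cocircuit_hyperplane[OF H(1,2)] ME by auto
  qed
  then obtain x where x: "\<And>e. e \<in> L \<Longrightarrow> cocircuit M (L - {e} \<union> {x e})" by metis
  have yL: "y ` {..<card L} = L" "inj_on y {..<card L}" using y by (auto simp: bij_betw_def)
  have "carambole M N (card L) (\<lambda>i. x (y i)) y" unfolding carambole_def yL(1)
  proof (intro conjI allI impI)
    show "line M L" using LE rL by (simp add: line_def r E)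
    show "vert_contractible_set M N L" using con_vert_contractible[OF M(1) N, of L] conL LE by (simp add: r E)
    fix i assume "i < card L"
    then show "cocircuit M (L - {y i} \<union> {x (y i)})" using x[of "y i"] yL(1) by auto
  qed (use n3 yL in auto)
  then show ?thesis unfolding filament_def L_def[symmetric] using yL(1) by metis
qed

lemma bound_ceiling: "2 \<le> k \<Longrightarrow> bound k = nat \<lceil>real k / 2\<rceil> + 1"
proof -
  assume k: "2 \<le> k"
  have "\<lceil>real k / 2\<rceil> = int ((k + 1) div 2)"
  proof (cases "even k")
    case True
    then obtain m where "k = 2 * m" by (rule evenE)
    then show ?thesis by simp
  next
    case False
    then obtain m where m: "k = 2 * m + 1" by (rule oddE)
    have "\<lceil>real k / 2\<rceil> = int m + 1" unfolding m by (rule ceiling_unique) auto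
    then show ?thesis using m by simp
  qed
  then show ?thesis using k by (simp add: bound_def)
qed

theorem theorem1p4:
  fixes M :: "'a matroid" and N :: "'b matroid"
  assumes "three_connected M"
    and "three_connected N" and "simple N" and "has_minor M N"
    and "rk M \<ge> rk N + 2"
  shows "\<exists>F. free_family M F
           \<and> card F = nat \<lceil>real (rk M - rk N) / 2\<rceil> + 1
           \<and> (\<forall>X \<in> F. (\<exists>x. X = {x} \<and> vert_contractible M N x) \<or> filament M N X)"
proof -
  define r where "r = (\<lambda>X. int (rank M X))"
  define E where "E = carrier M"
  define rN where "rN = (\<lambda>X. int (rank N X))"
  define EN where "EN = carrier N"
  have M: "matroid M" using assms(1) by (simp add: three_connected_def)
  have R2: "2 \<le> rk M" using assms(5) by simp
  note data = conn_minor_data[OF assms(1) R2 assms(2,3) r_def E_def]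
  interpret conn_minor r E rN EN unfolding rN_def EN_def by (rule data(1))
  note s = three_connected_simple[OF data(2,3)]
  note ME = data(4)
  have rU: "r UNIV = int (rk M)" using r_E by (simp add: r_def E_def)
  define n where "n = nat \<lceil>real (rk M - rk N) / 2\<rceil> + 1"
  have "nat (r UNIV - rN EN) = rk M - rk N" using rU assms(5) by (simp add: rN_def EN_def nat_diff_distrib)
  then have bn: "bound (nat (r UNIV - rN EN)) = n" using bound_ceiling[of "rk M - rk N"] assms(5) by (simp add: n_def)
  have "is_minor_after {}" using has_minor_emb[OF M assms(4)] by (simp add: r_def rN_def EN_def)
  then obtain Gs where Gs: "n \<le> length Gs" "\<And>Y. Y \<in> set Gs \<Longrightarrow> is_member Y" "r (\<Union>(set Gs)) = (\<Sum>Y\<leftarrow>Gs. r Y)"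
    using free_members[OF conn_minor_axioms] bn by auto
  \<comment> \<open>The induction may give more than \<open>n\<close> members; any part of a skew
    family is skew.\<close>
  define Fs where "Fs = take n Gs"
  have Fs: "length Fs = n" "\<And>Y. Y \<in> set Fs \<Longrightarrow> is_member Y" "r (\<Union>(set Fs)) = (\<Sum>Y\<leftarrow>Fs. r Y)"
    using Gs(1,2) skew_take[OF Gs(3), of n] set_take_subset[of n Gs] by (auto simp: Fs_def)
  have r1: "1 \<le> r Y" if "Y \<in> set Fs" for Y using Fs(2)[OF that] by (auto simp: member_def good_def filament_line_def)
  have dis: "distinct Fs" "\<And>Y Z. Y \<in> set Fs \<Longrightarrow> Z \<in> set Fs \<Longrightarrow> Y \<noteq> Z \<Longrightarrow> r (Y \<inter> Z) = 0"
    using skew_distinct[OF Fs(3) r1] by auto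
  \<comment> \<open>Filaments are flats of the whole type and contain the loops outside the carrier,
    which are now removed.\<close>
  define F where "F = (\<lambda>Y. Y \<inter> E) ` set Fs"
  have disj: "Y \<inter> Z \<inter> E = {}" if YZ: "Y \<in> set Fs" "Z \<in> set Fs" "Y \<noteq> Z" for Y Z
  proof (rule ccontr)
    assume "Y \<inter> Z \<inter> E \<noteq> {}"
    then obtain e where e: "e \<in> Y \<inter> Z" "e \<in> E" by auto
    then have "r {e} \<le> r (Y \<inter> Z)" by (intro r_mono) auto
    then show False using s(1)[OF e(2)] dis(2)[OF YZ] by simp
  qed
  have inj: "inj_on (\<lambda>Y. Y \<inter> E) (set Fs)"
  proof (rule inj_onI, rule ccontr)
    fix Y Z assume YZ: "Y \<in> set Fs" "Z \<in> set Fs" "Y \<inter> E = Z \<inter> E" "Y \<noteq> Z"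
    then have "Y \<inter> E = {}" using disj[of Y Z] by auto
    then show False using r1[OF YZ(1)] r_carrier[of Y] r_empty by simp
  qed
  have "card F = n" unfolding F_def using card_image[OF inj] distinct_card[OF dis(1)] Fs(1) by simp
  moreover have "free_family M F" unfolding free_family_def
  proof (intro conjI ballI allI impI)
    show "X \<subseteq> carrier M" if "X \<in> F" for X using that by (auto simp: F_def E_def)
    show "X \<inter> Y = {}" if XY: "X \<in> F" "Y \<in> F" "X \<noteq> Y" for X Y using XY disj by (fastforce simp: F_def)
    fix I assume I: "I \<subseteq> \<Union>F"
    have IE: "I \<subseteq> E" "I \<subseteq> \<Union>(set Fs)" using I by (auto simp: F_def)
    have fI: "finite I" using IE finite_E finite_subset by blast
    have ind: "indep M J \<longleftrightarrow> J \<subseteq> E \<and> r J = int (card J)" for J using ME by (metis rank_matroid_sel(2))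
    show "indep M I \<longleftrightarrow> (\<forall>X\<in>F. indep M (I \<inter> X))"
    proof
      assume "indep M I"
      then show "\<forall>X\<in>F. indep M (I \<inter> X)" using matroidD(4)[OF M] by auto
    next
      assume h: "\<forall>X\<in>F. indep M (I \<inter> X)"
      have "r (I \<inter> Y) = int (card (I \<inter> Y))" if "Y \<in> set Fs" for Y
      proof -
        have "I \<inter> Y = I \<inter> (Y \<inter> E)" using IE by auto
        moreover have "indep M (I \<inter> (Y \<inter> E))" using h that by (auto simp: F_def)
        ultimately show ?thesis using ind by metis
      qed
      then have "r I = int (card I)" by (rule skew_indep[OF Fs(3) fI IE(2)])
      then show "indep M I" using ind IE by simp
    qed
  qed
  moreover have "(\<exists>x. X = {x} \<and> vert_contractible M N x) \<or> filament M N X" if X: "X \<in> F" for X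
  proof -
    obtain Y where Y: "Y \<in> set Fs" "X = Y \<inter> E" using X by (auto simp: F_def)
    from Fs(2)[OF Y(1)] show ?thesis unfolding member_def
    proof
      assume "\<exists>v. Y = {v} \<and> is_good v"
      then obtain v where v: "Y = {v}" "r {v} = 1" "is_contractible {v}" by (auto simp: good_def)
      have vE: "v \<in> E" using nonloop_in_E[OF v(2)] .
      have "vert_contractible_set M N {v}"
        using con_vert_contractible[OF M assms(2,3), of "{v}"] v(3) vE by (simp add: r_def rN_def EN_def E_def)
      then show ?thesis using v(1) vE Y by (auto simp: vert_contractible_def E_def)
    next
      assume "is_filament Y"
      then show ?thesis
        using filament_of_filam[OF M assms(1) R2 assms(2,3) r_def E_def, of Y] Y by (simp add: rN_def EN_def)
    qed
  qed
  ultimately show ?thesis unfolding n_def by blast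
qed

end
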